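(* Let $1\le j\le k$, $d\ge j+2$, $0<\lambda_0\le\lambda_1$ and $0<L\le\lambda_0$. Let $m_L:\mathbb{R}^d\to\mathbb{C}$ be a smooth function with $|m_L(\xi)|\le B\min\{1,L|\xi|\}$ for all $\xi$. For an admissible frame $y_1,\dots,y_{j-1}$ and $\lambda>0$ let $M_{L,\lambda}=M^{y_1,\dots,y_{j-1}}_{L,\lambda}$ be the Fourier multiplier operator $\widehat{M_{L,\lambda}f}(\xi)=\widehat f(\xi)\,m_L(\xi)\,\widehat{\sigma^{(d-j)}_{y_1,\dots,y_{j-1}}}(\lambda\xi)$, and define $$\mathcal{M}^{(j)}_L(f)(x)=\sup_{\lambda_0\le\lambda\le\lambda_1}\int\!\cdots\!\int|M_{L,\lambda}f(x)|\,d\sigma^{(d-j+1)}_{y_1,\dots,y_{j-2}}(y_{j-1})\cdots d\sigma^{(d-1)}(y_1).$$ Then for all Schwartz $f$, $$\int_{\mathbb{R}^d}|\mathcal{M}^{(j)}_L(f)(x)|^2\,dx\le C\Big(\frac{L}{\lambda_0}\Big)^{1/3}\int_{\mathbb{R}^d}|f(x)|^2\,dx,$$ with $C$ depending only on $d$, $\Delta$ and $B$.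
   Context: Fix a non-degenerate simplex $\Delta=\{0,v_1,\dots,v_k\}\subseteq\mathbb{R}^k\subseteq\mathbb{R}^d$ ($v_i$ linearly independent), normalized so $|v_1|=1$. An admissible frame is $y_1,\dots,y_{j-1}$ with $y_i\cdot y_{i'}=v_i\cdot v_{i'}$ for $1\le i\le i'\le j-1$. $\sigma^{(d-1)}$ is the normalized surface measure on $\{|y|=|v_1|\}$; for $j\ge2$, $\sigma^{(d-j)}_{y_1,\dots,y_{j-1}}$ is the normalized surface measure on the $(d-j)$-sphere $S^{d-1}(0,|v_j|)\cap S^{d-1}(y_1,|v_j-v_1|)\cap\cdots\cap S^{d-1}(y_{j-1},|v_j-v_{j-1}|)$, $S^{d-1}(x,r)=\{x':|x-x'|=r\}$; for $j=1$ it is $\sigma^{(d-1)}$. Integrals over frames are taken with $y_1\sim\sigma^{(d-1)}$, $y_2\sim\sigma^{(d-2)}_{y_1}$, etc. Fourier transforms: $\widehat f(\xi)=\int f(x)e^{-2\pi ix\cdot\xi}dx$, $\widehat\nu(\xi)=\int e^{-2\pi ix\cdot\xi}d\nu(x)$. *)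

theory Defs
  imports "HOL-Analysis.Analysis"
begin

definition fourier :: "(real^'n \<Rightarrow> complex) \<Rightarrow> real^'n \<Rightarrow> complex" where
  "fourier f \<xi> = (\<integral>x. f x * cis (- (2 * pi * (x \<bullet> \<xi>))) \<partial>lborel)"

definition fourier_measure :: "(real^'n) measure \<Rightarrow> real^'n \<Rightarrow> complex" where
  "fourier_measure \<nu> \<xi> = (\<integral>x. cis (- (2 * pi * (x \<bullet> \<xi>))) \<partial>\<nu>)"

definition multiplier_op :: "(real^'n \<Rightarrow> complex) \<Rightarrow> (real^'n \<Rightarrow> complex) \<Rightarrow> real^'n \<Rightarrow> complex" where
  "multiplier_op a f x = (\<integral>\<xi>. fourier f \<xi> * a \<xi> * cis (2 * pi * (x \<bullet> \<xi>)) \<partial>lborel)"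

fun pderivs :: "(real^'n) list \<Rightarrow> (real^'n \<Rightarrow> 'a::real_normed_vector) \<Rightarrow> real^'n \<Rightarrow> 'a" where
  "pderivs [] f = f"
| "pderivs (u # us) f = (\<lambda>x. vector_derivative (\<lambda>t. pderivs us f (x + t *\<^sub>R u)) (at 0))"

definition smooth_fun :: "(real^'n \<Rightarrow> 'a::real_normed_vector) \<Rightarrow> bool" where
  "smooth_fun f \<longleftrightarrow> (\<forall>us \<in> lists Basis. continuous_on UNIV (pderivs us f) \<and>
       (\<forall>u\<in>Basis. \<forall>x. (\<lambda>t. pderivs us f (x + t *\<^sub>R u)) differentiable (at 0)))"

definition schwartz :: "(real^'n \<Rightarrow> complex) \<Rightarrow> bool" where
  "schwartz f \<longleftrightarrow> smooth_fun f \<and>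
     (\<forall>us \<in> lists Basis. \<forall>N::nat. \<exists>C. \<forall>x. (1 + norm x) ^ N * norm (pderivs us f x) \<le> C)"

definition sphere_measure :: "(real^'n) set \<Rightarrow> (real^'n) measure" where
  "sphere_measure S = (THE \<mu>. sets \<mu> = sets borel \<and> emeasure \<mu> (space \<mu>) = 1 \<and>
      emeasure \<mu> (UNIV - S) = 0 \<and>
      (\<forall>T. orthogonal_transformation T \<and> T ` S = S \<longrightarrow> distr \<mu> borel T = \<mu>))"

definition frame_sphere :: "(nat \<Rightarrow> real^'n) \<Rightarrow> nat \<Rightarrow> (nat \<Rightarrow> real^'n) \<Rightarrow> (real^'n) set" where
  "frame_sphere v j y = {x. norm x = norm (v j) \<and> (\<forall>i\<in>{1..<j}. dist (y i) x = norm (v j - v i))}"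

definition frame_sigma :: "(nat \<Rightarrow> real^'n) \<Rightarrow> nat \<Rightarrow> (nat \<Rightarrow> real^'n) \<Rightarrow> (real^'n) measure" where
  "frame_sigma v j y = sphere_measure (frame_sphere v j y)"

text \<open>Iterated integral over frames: frame_int v r i y F integrates y_i ~ sigma_i, ...,
  y_{i+r-1} ~ sigma_{i+r-1} (innermost), with y_1..y_{i-1} already fixed in y.\<close>
fun frame_int :: "(nat \<Rightarrow> real^'n) \<Rightarrow> nat \<Rightarrow> nat \<Rightarrow> (nat \<Rightarrow> real^'n) \<Rightarrow> ((nat \<Rightarrow> real^'n) \<Rightarrow> ennreal) \<Rightarrow> ennreal" where
  "frame_int v 0 i y F = F y"
| "frame_int v (Suc r) i y F = (\<integral>\<^sup>+ z. frame_int v r (Suc i) (y(i := z)) F \<partial>(frame_sigma v i y))"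

definition max_op :: "(nat \<Rightarrow> real^'n) \<Rightarrow> nat \<Rightarrow> real \<Rightarrow> real \<Rightarrow> (real^'n \<Rightarrow> complex)
    \<Rightarrow> (real^'n \<Rightarrow> complex) \<Rightarrow> real^'n \<Rightarrow> ennreal" where
  "max_op v j lam0 lam1 m f x = (SUP lam\<in>{lam0..lam1}.
      frame_int v (j - 1) 1 (\<lambda>_. 0)
        (\<lambda>y. ennreal (cmod (multiplier_op
              (\<lambda>\<xi>. m \<xi> * fourier_measure (frame_sigma v j y) (lam *\<^sub>R \<xi>)) f x))))"

end

theory Submission
  imports Defs "HOL-Probability.Probability"
begin

text \<open>
  A sphere \<open>frame_sphere v (Suc i) y\<close> is transitively permuted by reflections, so its invariant
  probability measure is unique, and it is the image of the uniform measure on the ball under the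
  nearest point map. Write \<open>W\<close> for the orthogonal complement of \<open>y 1, \<dots>, y i\<close>. Invariance under
  rotations in \<open>W\<close> gives, by differentiation, a Bessel equation for the Fourier transform of the measure, and a
  monotone energy for that equation gives decay of order 1 in the component of the frequency
  in \<open>W\<close>, as \<open>dim W \<ge> 3\<close>. A second such identity shows that the averages over frames of
  \<open>1 / (\<delta> + |P\<^sub>W \<xi>|\<^sup>2)\<close> are at most a constant times \<open>1 / (\<delta> + |\<xi>|\<^sup>2)\<close>.

  With \<open>F(\<lambda>)\<close> denoting the multiplier operator applied to \<open>f\<close>, the bound
  \<open>|F(\<lambda>)|\<^sup>2 \<le> |F(\<lambda>\<^sub>0)|\<^sup>2 + \<integral> |F|\<^sup>2 / L + L |F'|\<^sup>2 d\<lambda>\<close> and Plancherel reduce the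
  maximal function to these averages. This yields the factor \<open>L / \<lambda>\<^sub>0\<close>, which is at most its cube root.
\<close>

section \<open>Uniqueness of invariant measures\<close>

text \<open>\<open>sphere_measure\<close> is a definite description, so nothing can be said about
  \<open>frame_sigma\<close> before existence and uniqueness are settled. The obstacle for a single
  frame is that the component of \<xi> in W may vanish however large \<xi> is, so its multiplier
  need not decay in |\<xi>|; only the average over frames repairs this. The supremum stands outside
  that average, and it is removed by moving the square inside the average by Cauchy-Schwarz and
  bounding each frame by a quantity free of \<lambda>. The powers balance as follows.
  \<open>m\<close> gives F a factor L|\<xi>|, and differentiation in \<lambda> gives F' a factor
  |\<xi>|. Decay of order 1 leaves |\<xi>|^2 / (1 + \<lambda>^2 |P \<xi>|^2) in both squares, where
  P projects onto W, and averaging turns this into O(\<lambda>^(-2)). The weights 1/L and L make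
  both contributions L \<lambda>^(-2), whose integral from \<lambda>0 on is L / \<lambda>0, whatever
  \<lambda>1 is. Here dim W = d - j + 1 is at least 3: the decay uses two directions of W orthogonal
  to the frequency. Each averaging step takes place in a complement of dimension at least 4, which
  supplies the three directions needed there.\<close>

text \<open>For \<open>x \<in> U\<close> the ratio \<open>\<nu>(U \<inter> ball x r) / h r\<close> tends to 1 as \<open>r \<rightarrow> 0\<close>; integrate against \<open>\<mu>\<close>,
  apply Fatou's lemma and exchange the integrals.\<close>
lemma uniformly_distributed_le:
  fixes \<mu> \<nu> :: "'a::euclidean_space measure"
  assumes sets[measurable_cong]: "sets \<mu> = sets borel" "sets \<nu> = sets borel"
    and sf: "sigma_finite_measure \<mu>" "sigma_finite_measure \<nu>"
    and S: "AE x in \<nu>. x \<in> S"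
    and ball: "\<And>x r. x \<in> S \<Longrightarrow> 0 < r \<Longrightarrow> emeasure \<mu> (ball x r) = h r"
    and ballS: "AE x in \<mu>. \<forall>r>0. emeasure \<nu> (ball x r) = h r"
    and h: "\<And>r. 0 < r \<Longrightarrow> 0 < h r" "\<And>r. 0 < r \<Longrightarrow> h r < \<infinity>"
    and U: "open U"
  shows "emeasure \<mu> U \<le> emeasure \<nu> U"
proof -
  interpret m: sigma_finite_measure \<mu> by fact
  interpret n: sigma_finite_measure \<nu> by fact
  interpret pair_sigma_finite \<mu> \<nu> ..
  have [measurable]: "U \<in> sets borel" using U by auto
  define r where "r n = 1 / real (Suc n)" for n
  have r: "0 < r n" for n by (simp add: r_def)
  define D where "D n x = indicator U x * (\<integral>\<^sup>+y. indicator U y * indicator {p. dist (fst p) (snd p) < r n} (x,y) \<partial>\<nu>) / h (r n)"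
    for n x
  have [measurable]: "{p. dist (fst p) (snd p) < r n} \<in> sets (borel \<Otimes>\<^sub>M (borel :: 'a measure))" for n
    unfolding borel_prod by (intro borel_open open_Collect_less continuous_intros)
  have [measurable]: "D n \<in> borel_measurable \<mu>" for n
    unfolding D_def by measurable
  have "emeasure \<mu> U = (\<integral>\<^sup>+x. indicator U x \<partial>\<mu>)" by simp
  also have "\<dots> \<le> (\<integral>\<^sup>+x. liminf (\<lambda>n. D n x) \<partial>\<mu>)"
  proof (rule nn_integral_mono_AE)
    show "AE x in \<mu>. indicator U x \<le> liminf (\<lambda>n. D n x)"
      using ballS
    proof eventually_elim
      case (elim x)
      show ?case
      proof (cases "x \<in> U")
        case True
        then obtain e where e: "e > 0" "ball x e \<subseteq> U" using U openE by blast
        have "eventually (\<lambda>n. r n < e) sequentially"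
          using e(1) unfolding r_def
          by real_asymp
        then have "eventually (\<lambda>n. 1 = D n x) sequentially"
        proof eventually_elim
          case (elim n)
          then have "ball x (r n) \<subseteq> U" using e by auto
          then have "(\<integral>\<^sup>+y. indicator U y * indicator {p. dist (fst p) (snd p) < r n} (x,y) \<partial>\<nu>) = (\<integral>\<^sup>+y. indicator (ball x (r n)) y \<partial>\<nu>)"
            by (intro nn_integral_cong) (auto simp: indicator_def)
          also have "\<dots> = h (r n)" using \<open>\<forall>r>0. emeasure \<nu> (ball x r) = h r\<close> r by simp
          finally show ?case unfolding D_def using True h[OF r[of n]]
            by (simp add: ennreal_divide_self)
        qed
        then have "liminf (\<lambda>n. 1::ennreal) \<le> liminf (\<lambda>n. D n x)"
          by (intro Liminf_mono) (auto elim: eventually_mono)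
        then show ?thesis using True by (simp add: Liminf_const)
      qed simp
    qed
  qed
  also have "\<dots> \<le> liminf (\<lambda>n. \<integral>\<^sup>+x. D n x \<partial>\<mu>)"
    by (rule nn_integral_liminf) simp
  also have "\<dots> \<le> liminf (\<lambda>n. emeasure \<nu> U)"
  proof (rule Liminf_mono, rule always_eventually, rule allI)
    fix n
    have "(\<integral>\<^sup>+x. D n x \<partial>\<mu>) = (\<integral>\<^sup>+x. (\<integral>\<^sup>+y. indicator U x * (indicator U y * indicator {p. dist (fst p) (snd p) < r n} (x,y)) \<partial>\<nu>) \<partial>\<mu>) / h (r n)"
      unfolding D_def
      by (subst nn_integral_divide[symmetric]) (auto intro!: nn_integral_cong simp: nn_integral_cmult)
    also have "(\<integral>\<^sup>+x. (\<integral>\<^sup>+y. indicator U x * (indicator U y * indicator {p. dist (fst p) (snd p) < r n} (x,y)) \<partial>\<nu>) \<partial>\<mu>)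
       = (\<integral>\<^sup>+y. (\<integral>\<^sup>+x. indicator U x * (indicator U y * indicator {p. dist (fst p) (snd p) < r n} (x,y)) \<partial>\<mu>) \<partial>\<nu>)"
      by (rule Fubini'[symmetric]) measurable
    also have "\<dots> \<le> (\<integral>\<^sup>+y. indicator U y * h (r n) \<partial>\<nu>)"
    proof (rule nn_integral_mono_AE)
      show "AE y in \<nu>. (\<integral>\<^sup>+x. indicator U x * (indicator U y * indicator {p. dist (fst p) (snd p) < r n} (x,y)) \<partial>\<mu>) \<le> indicator U y * h (r n)"
        using S
      proof eventually_elim
        case (elim y)
        have "(\<integral>\<^sup>+x. indicator U x * (indicator U y * indicator {p. dist (fst p) (snd p) < r n} (x,y)) \<partial>\<mu>)
          \<le> (\<integral>\<^sup>+x. indicator U y * indicator (ball y (r n)) x \<partial>\<mu>)"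
          by (intro nn_integral_mono) (auto simp: indicator_def dist_commute)
        also have "\<dots> = indicator U y * h (r n)"
          using ball[OF elim r[of n]] sets by (subst nn_integral_cmult) (auto intro!: borel_measurable_indicator)
        finally show ?case .
      qed
    qed
    also have "\<dots> = emeasure \<nu> U * h (r n)"
      by (subst nn_integral_multc) auto
    finally show "(\<integral>\<^sup>+x. D n x \<partial>\<mu>) \<le> emeasure \<nu> U"
      using h[OF r[of n]]
      by (metis (no_types, lifting) divide_right_mono_ennreal ennreal_mult_divide_eq infinity_ennreal_def less_irrefl)
  qed
  also have "\<dots> = emeasure \<nu> U" by (simp add: Liminf_const)
  finally show ?thesis .
qed

text \<open>The inequality on open sets is applied in both directions, and open sets form an
  intersection-stable generator of the Borel sets. Finiteness on balls around 0 supplies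
  sigma-finiteness, both for the exchange of integrals and for the generator argument.\<close>

lemma uniformly_distributed_eq:
  fixes \<mu> \<nu> :: "'a::euclidean_space measure"
  assumes sets: "sets \<mu> = sets borel" "sets \<nu> = sets borel"
    and fin: "\<And>n::nat. emeasure \<mu> (ball 0 n) < \<infinity>" "\<And>n::nat. emeasure \<nu> (ball 0 n) < \<infinity>"
    and S: "AE x in \<mu>. x \<in> S" "AE x in \<nu>. x \<in> S"
    and ball: "\<And>x r. x \<in> S \<Longrightarrow> 0 < r \<Longrightarrow> emeasure \<mu> (ball x r) = h r"
      "\<And>x r. x \<in> S \<Longrightarrow> 0 < r \<Longrightarrow> emeasure \<nu> (ball x r) = h r"
    and h: "\<And>r. 0 < r \<Longrightarrow> 0 < h r" "\<And>r. 0 < r \<Longrightarrow> h r < \<infinity>"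
  shows "\<mu> = \<nu>"
proof -
  have un: "(\<Union>n. ball 0 (real n)) = (UNIV :: 'a set)"
    using reals_Archimedean2 by (auto simp: set_eq_iff)
  have sf: "sigma_finite_measure M" if "sets M = sets borel" "\<And>n::nat. emeasure M (ball 0 n) < \<infinity>" for M :: "'a measure"
  proof
    have "emeasure M (ball 0 (real n)) \<noteq> \<infinity>" for n using that(2)[of n] by simp
    then show "\<exists>A. countable A \<and> A \<subseteq> sets M \<and> \<Union>A = space M \<and> (\<forall>a\<in>A. emeasure M a \<noteq> \<infinity>)"
      using that(1) un sets_eq_imp_space_eq[OF that(1)]
      by (intro exI[of _ "range (\<lambda>n::nat. ball 0 (real n))"]) auto
  qed
  have sfs: "sigma_finite_measure \<mu>" "sigma_finite_measure \<nu>" using sf sets fin by blast+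
  have eq: "emeasure \<mu> U = emeasure \<nu> U" if "open U" for U
  proof (rule antisym)
    show "emeasure \<mu> U \<le> emeasure \<nu> U"
      by (rule uniformly_distributed_le[OF sets sfs S(2) ball(1) _ h that])
         (use ball in \<open>auto intro: AE_mp[OF S(1)]\<close>)
    show "emeasure \<nu> U \<le> emeasure \<mu> U"
      by (rule uniformly_distributed_le[OF sets(2,1) sfs(2,1) S(1) ball(2) _ h that])
         (use ball in \<open>auto intro: AE_mp[OF S(2)]\<close>)
  qed
  show ?thesis
  proof (rule measure_eqI_generator_eq[where E="{U. open U}" and \<Omega>=UNIV and A="\<lambda>n::nat. ball 0 (real n)"])
    show "Int_stable {U::'a set. open U}" by (auto simp: Int_stable_def)
    show "sets \<mu> = sigma_sets UNIV {U. open U}" "sets \<nu> = sigma_sets UNIV {U. open U}"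
      by (simp_all add: sets borel_def)
    show "emeasure \<mu> (ball 0 (real n)) \<noteq> \<infinity>" for n
      using fin(1)[of n] by simp
  qed (use eq un in auto)
qed

text \<open>An orthogonal map carries balls to balls of the same radius, so both measures give every
  ball the volume of the centred ball of that radius. Uniqueness of uniformly distributed measures,
  with \<open>S = UNIV\<close>, then replaces a determinant computation.\<close>

lemma distr_lborel_orthogonal:
  fixes T :: "'a::euclidean_space \<Rightarrow> 'a"
  assumes T: "orthogonal_transformation T"
  shows "distr lborel borel T = lborel"
proof -
  have lin: "linear T" using T by (simp add: orthogonal_transformation_linear)
  have [measurable]: "T \<in> borel_measurable borel"
    using lin by (simp add: borel_measurable_continuous_onI linear_continuous_on linear_conv_bounded_linear)
  obtain T' where T': "orthogonal_transformation T'" "\<And>x. T' (T x) = x" "\<And>x. T (T' x) = x"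
    using T by (metis orthogonal_transformation_bij orthogonal_transformation_inv bij_inv_eq_iff)
  have pre: "T -` ball x r = ball (T' x) r" for x r
  proof -
    have "dist x (T y) = dist (T' x) y" for y
    proof -
      have "norm (T (T' x - y)) = norm (T' x - y)" by (rule orthogonal_transformation_norm[OF T])
      then show ?thesis by (simp add: dist_norm linear_diff[OF lin] T')
    qed
    then show ?thesis by (auto simp: ball_def)
  qed
  have vol: "emeasure lborel (ball x r) = emeasure lborel (ball (0::'a) r)" if "r > 0" for x :: 'a and r
  proof -
    have "emeasure lborel (ball x r) = emeasure (distr lborel borel (\<lambda>y. x + y)) (ball x r)"
      by (simp add: lborel_distr_plus)
    also have "\<dots> = emeasure lborel ((\<lambda>y. x + y) -` ball x r)"
      by (subst emeasure_distr) auto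
    also have "(\<lambda>y. x + y) -` ball x r = ball 0 r" by (auto simp: dist_norm)
    finally show ?thesis .
  qed
  show ?thesis
  proof (rule uniformly_distributed_eq[where S=UNIV and h="\<lambda>r. emeasure lborel (ball (0::'a) r)"])
    show "emeasure (distr lborel borel T) (ball 0 (real n)) < \<infinity>" for n
      using emeasure_lborel_ball_finite[of "T' 0" "real n"] by (subst emeasure_distr) (simp_all add: pre)
    show "0 < emeasure lborel (ball (0::'a) r)" if "0 < r" for r
    proof -
      have "\<not> negligible (ball (0::'a) r)"
        using that open_not_negligible[of "ball (0::'a) r"] by simp
      then show ?thesis
        unfolding negligible_iff_null_sets
        by (auto simp: zero_less_iff_neq_zero null_sets_def)
    qed
    show "emeasure (distr lborel borel T) (ball x r) = emeasure lborel (ball (0::'a) r)" if "0 < r" for x r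
      by (subst emeasure_distr) (simp_all add: pre vol[OF that, of "T' x"])
    show "emeasure lborel (ball x r) = emeasure lborel (ball (0::'a) r)" if "0 < r" for x :: 'a and r
      by (rule vol[OF that])
  qed (simp_all add: emeasure_lborel_ball_finite[unfolded infinity_ennreal_def])
qed


section \<open>Invariant probability measures on compact homogeneous sets\<close>

text \<open>The predicate under the definite description in \<open>sphere_measure\<close>, isolated
  so that existence and uniqueness can be stated for it.\<close>

definition invariant_prob_on :: "'a::euclidean_space set \<Rightarrow> 'a measure \<Rightarrow> bool" where
  "invariant_prob_on S \<mu> \<longleftrightarrow> sets \<mu> = sets borel \<and> emeasure \<mu> (space \<mu>) = 1 \<and>
      emeasure \<mu> (UNIV - S) = 0 \<and>
      (\<forall>T. orthogonal_transformation T \<and> T ` S = S \<longrightarrow> distr \<mu> borel T = \<mu>)"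

lemma orthogonal_transformation_measurable:
  fixes T :: "'a::euclidean_space \<Rightarrow> 'a"
  assumes "orthogonal_transformation T"
  shows "T \<in> borel_measurable borel"
proof -
  have "linear T" using assms by (rule orthogonal_transformation_linear)
  then show ?thesis
    by (simp add: borel_measurable_continuous_onI linear_continuous_on linear_conv_bounded_linear)
qed

lemma vimage_ball_orthogonal_transformation:
  fixes T :: "'a::euclidean_space \<Rightarrow> 'a"
  assumes T: "orthogonal_transformation T"
  shows "T -` ball (T x) r = ball x r"
proof -
  have "dist (T x) (T y) = dist x y" for y
    using orthogonal_transformation_norm[OF T, of "x - y"]
    by (simp add: dist_norm linear_diff[OF orthogonal_transformation_linear[OF T]])
  then show ?thesis by (auto simp: ball_def)
qed

lemma
  assumes "invariant_prob_on S \<mu>"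
  shows invariant_prob_on_sets: "sets \<mu> = sets borel"
    and invariant_prob_on_space: "space \<mu> = UNIV"
    and invariant_prob_on_prob: "prob_space \<mu>"
    and invariant_prob_on_distr: "orthogonal_transformation T \<Longrightarrow> T ` S = S \<Longrightarrow> distr \<mu> borel T = \<mu>"
    and invariant_prob_on_AE: "closed S \<Longrightarrow> AE x in \<mu>. x \<in> S"
proof -
  show s: "sets \<mu> = sets borel" and p: "prob_space \<mu>"
    and "orthogonal_transformation T \<Longrightarrow> T ` S = S \<Longrightarrow> distr \<mu> borel T = \<mu>"
    using assms by (auto simp: invariant_prob_on_def intro: prob_spaceI)
  show sp: "space \<mu> = UNIV" using sets_eq_imp_space_eq[OF s] by simp
  assume "closed S"
  then have "UNIV - S \<in> sets \<mu>" using s by auto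
  then have "UNIV - S \<in> null_sets \<mu>" using assms by (auto simp: invariant_prob_on_def null_sets_def)
  then show "AE x in \<mu>. x \<in> S" by (rule AE_I') auto
qed

lemma invariant_prob_on_emeasure_ball:
  assumes \<mu>: "invariant_prob_on S \<mu>" and T: "orthogonal_transformation T" "T ` S = S"
  shows "emeasure \<mu> (ball (T x) r) = emeasure \<mu> (ball x r)"
proof -
  have [measurable_cong]: "sets \<mu> = sets borel" using \<mu> by (rule invariant_prob_on_sets)
  have [measurable]: "T \<in> borel_measurable borel" by (rule orthogonal_transformation_measurable[OF T(1)])
  have "emeasure \<mu> (ball (T x) r) = emeasure (distr \<mu> borel T) (ball (T x) r)"
    using invariant_prob_on_distr[OF \<mu> T] by simp
  also have "\<dots> = emeasure \<mu> (ball x r)"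
    by (subst emeasure_distr)
       (auto simp: vimage_ball_orthogonal_transformation[OF T(1)] invariant_prob_on_space[OF \<mu>])
  finally show ?thesis .
qed

text \<open>Transitivity makes the mass of a ball centred in \<open>S\<close> depend on the radius
  only, for each measure separately. Once the two radius functions are known to agree, both measures
  are uniformly distributed with the same profile, hence equal.\<close>

lemma invariant_prob_on_unique:
  assumes S: "compact S"
    and trans: "\<And>x y. x \<in> S \<Longrightarrow> y \<in> S \<Longrightarrow> \<exists>T. orthogonal_transformation T \<and> T ` S = S \<and> T x = y"
    and \<mu>: "invariant_prob_on S \<mu>" and \<nu>: "invariant_prob_on S \<nu>"
  shows "\<mu> = \<nu>"
proof -
  have cl: "closed S" using S by (rule compact_imp_closed)
  interpret m: prob_space \<mu> using \<mu> by (rule invariant_prob_on_prob)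
  interpret n: prob_space \<nu> using \<nu> by (rule invariant_prob_on_prob)
  interpret pair_sigma_finite \<mu> \<nu> ..
  have sets[measurable_cong]: "sets \<mu> = sets borel" "sets \<nu> = sets borel"
    using \<mu> \<nu> invariant_prob_on_sets by auto
  have AES: "AE x in \<mu>. x \<in> S" "AE x in \<nu>. x \<in> S"
    using \<mu> \<nu> cl by (auto dest: invariant_prob_on_AE)
  have "S \<noteq> {}"
  proof
    assume "S = {}"
    with AES(1) have "AE x in \<mu>. False" by simp
    then show False by (simp add: m.AE_False)
  qed
  then obtain x0 where x0: "x0 \<in> S" by auto
  have const: "emeasure M (ball x r) = emeasure M (ball x0 r)" if "invariant_prob_on S M" "x \<in> S" for M x r
    using trans[OF x0 that(2)] invariant_prob_on_emeasure_ball[OF that(1)] by metis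
  \<comment> \<open>The product measure of the pairs at distance less than \<open>r\<close> is
    computed in both orders; each order yields one of the two sides because both measures have total
    mass 1.\<close>
  have "emeasure \<nu> (ball x0 r) = emeasure \<mu> (ball x0 r)" for r
  proof -
    have [measurable]: "{p. dist (fst p) (snd p) < r} \<in> sets (borel \<Otimes>\<^sub>M (borel :: 'a measure))"
      unfolding borel_prod by (intro borel_open open_Collect_less continuous_intros)
    have "emeasure \<nu> (ball x0 r) = (\<integral>\<^sup>+x. emeasure \<nu> (ball x0 r) \<partial>\<mu>)"
      by (simp add: m.emeasure_space_1)
    also have "\<dots> = (\<integral>\<^sup>+x. (\<integral>\<^sup>+y. indicator {p. dist (fst p) (snd p) < r} (x,y) \<partial>\<nu>) \<partial>\<mu>)"
    proof (rule nn_integral_cong_AE, rule AE_mp[OF AES(1)], rule AE_I2, rule impI)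
      fix x assume "x \<in> S"
      have "(\<integral>\<^sup>+y. indicator {p. dist (fst p) (snd p) < r} (x,y) \<partial>\<nu>) = (\<integral>\<^sup>+y. indicator (ball x r) y \<partial>\<nu>)"
        by (intro nn_integral_cong) (auto simp: indicator_def)
      then show "emeasure \<nu> (ball x0 r) = (\<integral>\<^sup>+y. indicator {p. dist (fst p) (snd p) < r} (x,y) \<partial>\<nu>)"
        using const[OF \<nu> \<open>x \<in> S\<close>, of r] sets by simp
    qed
    also have "\<dots> = (\<integral>\<^sup>+y. (\<integral>\<^sup>+x. indicator {p. dist (fst p) (snd p) < r} (x,y) \<partial>\<mu>) \<partial>\<nu>)"
      by (rule Fubini'[symmetric]) measurable
    also have "\<dots> = (\<integral>\<^sup>+x. emeasure \<mu> (ball x0 r) \<partial>\<nu>)"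
    proof (rule nn_integral_cong_AE, rule AE_mp[OF AES(2)], rule AE_I2, rule impI)
      fix y assume "y \<in> S"
      have "(\<integral>\<^sup>+x. indicator {p. dist (fst p) (snd p) < r} (x,y) \<partial>\<mu>) = (\<integral>\<^sup>+x. indicator (ball y r) x \<partial>\<mu>)"
        by (intro nn_integral_cong) (auto simp: indicator_def dist_commute)
      then show "(\<integral>\<^sup>+x. indicator {p. dist (fst p) (snd p) < r} (x,y) \<partial>\<mu>) = emeasure \<mu> (ball x0 r)"
        using const[OF \<mu> \<open>y \<in> S\<close>, of r] sets by simp
    qed
    also have "\<dots> = emeasure \<mu> (ball x0 r)" by (simp add: n.emeasure_space_1)
    finally show ?thesis .
  qed
  note eq = this
  \<comment> \<open>If one ball were null, all balls of that radius centred in \<open>S\<close>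
    would be. Finitely many of them cover the compact \<open>S\<close>, which has full mass.\<close>
  have pos: "0 < emeasure \<mu> (ball x0 r)" if r: "0 < r" for r
  proof (rule ccontr)
    assume "\<not> 0 < emeasure \<mu> (ball x0 r)"
    then have z: "ball x r \<in> null_sets \<mu>" if "x \<in> S" for x
      using const[OF \<mu> that, of r] sets by (auto simp: null_sets_def zero_less_iff_neq_zero)
    obtain C where C: "C \<subseteq> S" "finite C" "S \<subseteq> (\<Union>c\<in>C. ball c r)"
      using compactE_image[OF S, of S "\<lambda>c. ball c r"] r by (metis (no_types, lifting) UN_I centre_in_ball open_ball subsetI)
    have "(\<Union>c\<in>C. ball c r) \<in> null_sets \<mu>"
      using C z by (intro null_sets.finite_UN) auto
    then have "AE x in \<mu>. x \<notin> (\<Union>c\<in>C. ball c r)" by (rule AE_not_in)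
    with AES(1) have "AE x in \<mu>. x \<in> S \<and> x \<notin> (\<Union>c\<in>C. ball c r)" by (rule AE_conjI)
    then have "AE x in \<mu>. False" by (rule AE_mp, intro AE_I2) (use C(3) in blast)
    then show False by (simp add: m.AE_False)
  qed
  show ?thesis
  proof (rule uniformly_distributed_eq[OF sets _ _ AES, where h="\<lambda>r. emeasure \<mu> (ball x0 r)"])
    show "emeasure \<nu> (ball x r) = emeasure \<mu> (ball x0 r)" if "x \<in> S" for x r
      using const[OF \<nu> that, of r] eq[of r] by simp
    show "emeasure \<mu> (ball x r) = emeasure \<mu> (ball x0 r)" if "x \<in> S" for x r
      by (rule const[OF \<mu> that])
    show "0 < emeasure \<mu> (ball x0 r)" if "0 < r" for r by (rule pos[OF that])
    show "emeasure \<mu> (ball x0 r) < \<infinity>" for r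
      by (metis m.emeasure_finite infinity_ennreal_def top.not_eq_extremum)
    show "emeasure \<mu> (ball 0 n) < \<infinity>" "emeasure \<nu> (ball 0 n) < \<infinity>" for n
      by (metis m.emeasure_finite infinity_ennreal_def top.not_eq_extremum)
         (metis n.emeasure_finite infinity_ennreal_def top.not_eq_extremum)
  qed
qed

section \<open>The spheres carrying the frame measures\<close>

text \<open>\<open>perp y i\<close> is the orthogonal projection onto the complement of \<open>y 1, \<dots>, y i\<close>. The
  recursion makes it visibly measurable in \<open>y\<close>; if \<open>y (Suc i)\<close> depends on its predecessors,
  the division by zero leaves the projection unchanged.\<close>
fun perp :: "(nat \<Rightarrow> 'a::euclidean_space) \<Rightarrow> nat \<Rightarrow> 'a \<Rightarrow> 'a" where
  "perp y 0 x = x"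
| "perp y (Suc i) x = perp y i x - ((perp y i x \<bullet> perp y i (y (Suc i))) /
      (perp y i (y (Suc i)) \<bullet> perp y i (y (Suc i)))) *\<^sub>R perp y i (y (Suc i))"

lemma perp_linear: "linear (perp y i)"
proof (induction i)
  case 0
  have "perp y 0 = (\<lambda>x. x)" by auto
  then show ?case by (simp add: linear_iff)
next
  case (Suc i)
  then show ?case
    by (auto simp: linear_iff inner_add_left add_divide_distrib scaleR_add_left algebra_simps)
qed

text \<open>Symmetry and idempotence are proved together because the inductive step for idempotence
  needs both: the residual u of the next vector is fixed by the previous projection, and symmetry
  moves that projection across the inner product with u.\<close>

lemma perp_adjoint_idem: "(\<forall>x z. perp y i x \<bullet> z = x \<bullet> perp y i z) \<and> (\<forall>x. perp y i (perp y i x) = perp y i x)"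
proof (induction i)
  case (Suc i)
  define u where "u = perp y i (y (Suc i))"
  have A: "perp y i x \<bullet> z = x \<bullet> perp y i z" and I: "perp y i (perp y i x) = perp y i x" for x z
    using Suc by auto
  have u: "perp y i u = u" by (simp add: u_def I)
  have xu: "perp y i x \<bullet> u = x \<bullet> u" for x using A[of x u] u by simp
  have P: "perp y (Suc i) x = perp y i x - ((x \<bullet> u) / (u \<bullet> u)) *\<^sub>R u" for x
    by (simp add: u_def[symmetric] xu)
  have PP: "perp y i (perp y (Suc i) x) = perp y (Suc i) x" for x
    unfolding P by (simp add: linear_diff[OF perp_linear] linear_scale[OF perp_linear] I u)
  have "perp y (Suc i) x \<bullet> u = 0" for x
    by (cases "u = 0") (simp_all add: P inner_diff_left xu del: perp.simps)
  then have "perp y (Suc i) (perp y (Suc i) x) = perp y (Suc i) x" for x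
    by (subst P) (simp add: PP del: perp.simps)
  moreover have "perp y (Suc i) x \<bullet> z = x \<bullet> perp y (Suc i) z" for x z
    unfolding P by (simp add: inner_diff_left inner_diff_right A inner_commute[of u z])
  ultimately show ?case by blast
qed auto

lemma perp_adjoint: "perp y i x \<bullet> z = x \<bullet> perp y i z"
  and perp_idem: "perp y i (perp y i x) = perp y i x"
  using perp_adjoint_idem[of y i] by blast+

lemma perp_inner_perp: "perp y i x \<bullet> perp y i z = x \<bullet> perp y i z"
  by (simp add: perp_adjoint perp_idem)

text \<open>The degenerate case u = 0 also works: the inner product with the new vector equals the
  one with its residual u, so it already vanishes.\<close>

lemma perp_orth: "l \<in> {1..i} \<Longrightarrow> perp y i x \<bullet> y l = 0"
proof (induction i arbitrary: x)
  case (Suc i)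
  define u where "u = perp y i (y (Suc i))"
  show ?case
  proof (cases "l = Suc i")
    case True
    have "perp y i x \<bullet> y (Suc i) = perp y i x \<bullet> u" "u \<bullet> y (Suc i) = u \<bullet> u"
      by (simp_all add: u_def perp_inner_perp) (simp_all add: perp_adjoint)
    then show ?thesis using True
      by (cases "u = 0") (simp_all add: u_def[symmetric] inner_diff_left)
  next
    case False
    then show ?thesis using Suc by (simp add: inner_diff_left)
  qed
qed simp

lemma perp_span: "x - perp y i x \<in> span (y ` {1..i})"
proof (induction i arbitrary: x)
  case (Suc i)
  have sub: "span (y ` {1..i}) \<subseteq> span (y ` {1..Suc i})" by (intro span_mono) auto
  have "y (Suc i) - (y (Suc i) - perp y i (y (Suc i))) \<in> span (y ` {1..Suc i})"
    by (rule span_diff[OF span_base subsetD[OF sub Suc]]) auto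
  then have "perp y i (y (Suc i)) \<in> span (y ` {1..Suc i})" by simp
  moreover have "x - perp y i x \<in> span (y ` {1..Suc i})" using Suc[of x] sub by auto
  ultimately have "(x - perp y i x) + c *\<^sub>R perp y i (y (Suc i)) \<in> span (y ` {1..Suc i})" for c
    by (intro span_add span_scale)
  moreover have "x - perp y (Suc i) x = (x - perp y i x) + ((perp y i x \<bullet> perp y i (y (Suc i))) /
      (perp y i (y (Suc i)) \<bullet> perp y i (y (Suc i)))) *\<^sub>R perp y i (y (Suc i))" by simp
  ultimately show ?case by (simp only:)
qed (simp add: span_zero)

lemma orth_span: "(\<And>l. l \<in> I \<Longrightarrow> w \<bullet> y l = 0) \<Longrightarrow> z \<in> span (y ` I) \<Longrightarrow> w \<bullet> (z::'a::euclidean_space) = 0"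
  using orthogonal_to_span[of z "y ` I" w] by (auto simp: orthogonal_def)

text \<open>The difference lies in the span of the frame and is orthogonal to it, hence to
  itself.\<close>

lemma perp_fix:
  assumes "\<And>l. l \<in> {1..i} \<Longrightarrow> x \<bullet> y l = 0"
  shows "perp y i x = x"
proof -
  have "(x - perp y i x) \<bullet> (x - perp y i x) = 0"
    by (rule orth_span[OF _ perp_span]) (use assms perp_orth[of _ i y x] in \<open>auto simp: inner_diff_left\<close>)
  then show ?thesis by simp
qed

lemma perp_perp_le: "l \<le> m \<Longrightarrow> perp y l (perp y m x) = perp y m x"
  by (rule perp_fix) (auto intro: perp_orth)

lemma perp_cong: "(\<And>l. l \<in> {1..i} \<Longrightarrow> y l = y' l) \<Longrightarrow> perp y i x = perp y' i x"
proof (induction i arbitrary: x)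
  case (Suc i)
  have "y (Suc i) = y' (Suc i)" by (rule Suc.prems) simp
  moreover have "perp y i z = perp y' i z" for z by (rule Suc.IH) (rule Suc.prems, simp)
  ultimately show ?case by simp
qed simp

lemma perp_norm_le: "norm (perp y i x) \<le> norm x"
proof -
  have "(norm (perp y i x))\<^sup>2 = x \<bullet> perp y i x" by (simp add: power2_norm_eq_inner perp_inner_perp)
  also have "\<dots> \<le> norm x * norm (perp y i x)" by (rule norm_cauchy_schwarz)
  finally show ?thesis by (cases "norm (perp y i x) = 0") (auto simp: power2_eq_square)
qed

text \<open>The Gram-Schmidt expansion. With its coefficients computed from \<open>v\<close> instead
  of \<open>y\<close>, the sum becomes \<open>ctr\<close>.\<close>

lemma perp_eq_sum:
  "perp y i x = x - (\<Sum>l<i. ((x \<bullet> perp y l (y (Suc l))) / (perp y l (y (Suc l)) \<bullet> perp y l (y (Suc l)))) *\<^sub>R perp y l (y (Suc l)))"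
proof (induction i)
  case (Suc i)
  have "perp y (Suc i) x = perp y i x - ((x \<bullet> perp y i (y (Suc i))) /
      (perp y i (y (Suc i)) \<bullet> perp y i (y (Suc i)))) *\<^sub>R perp y i (y (Suc i))"
    using perp_inner_perp[of y i x "y (Suc i)"] by simp
  then show ?case by (simp only: Suc sum.lessThan_Suc diff_diff_eq)
qed simp

section \<open>Admissible frames and the geometry of their spheres\<close>

definition gram :: "(nat \<Rightarrow> 'a::euclidean_space) \<Rightarrow> nat \<Rightarrow> (nat \<Rightarrow> 'a) \<Rightarrow> bool" where
  "gram v n y \<longleftrightarrow> (\<forall>a\<in>{1..n}. \<forall>b\<in>{1..n}. y a \<bullet> y b = v a \<bullet> v b)"

text \<open>Each Gram-Schmidt step involves nothing but inner products already known, so every inner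
  product of residuals is a function of the Gram matrix and can be evaluated on
  \<open>v\<close>.\<close>

lemma perp_gram:
  assumes "gram v n y" "i \<le> n" "a \<in> {1..n}" "b \<in> {1..n}"
  shows "y a \<bullet> perp y i (y b) = v a \<bullet> perp v i (v b)"
  using assms(2-4)
proof (induction i arbitrary: a b)
  case 0
  then show ?case using assms(1) by (auto simp: gram_def)
next
  case (Suc i)
  have "Suc i \<in> {1..n}" "i \<le> n" using Suc by auto
  then show ?case
    using Suc.IH[of a b] Suc.IH[of a "Suc i"] Suc.IH[of b "Suc i"] Suc.IH[of "Suc i" "Suc i"] Suc.prems
    by (simp add: perp_inner_perp inner_diff_right)
qed

lemma perp_gram2:
  assumes "gram v n y" "i \<le> n" "l \<le> n" "a \<in> {1..n}" "b \<in> {1..n}"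
  shows "perp y l (y a) \<bullet> perp y i (y b) = perp v l (v a) \<bullet> perp v i (v b)"
proof -
  have *: "perp w l (w a) \<bullet> perp w i (w b) = (if l \<le> i then w a \<bullet> perp w i (w b) else w b \<bullet> perp w l (w a))" for w :: "nat \<Rightarrow> 'a"
  proof (cases "l \<le> i")
    case True
    then show ?thesis by (simp add: perp_adjoint perp_perp_le)
  next
    case False
    then show ?thesis
      using perp_adjoint[of w i "perp w l (w a)" "w b"] perp_perp_le[of i l w "w a"]
      by (simp add: inner_commute)
  qed
  show ?thesis
    using *[of y] *[of v] perp_gram[OF assms(1,2,4,5)] perp_gram[OF assms(1,3,5,4)] by presburger
qed

text \<open>\<open>rho v i\<close> and \<open>ctr v i y\<close> are radius and centre of the sphere of index \<open>Suc i\<close>.\<close>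
definition rho :: "(nat \<Rightarrow> 'a::euclidean_space) \<Rightarrow> nat \<Rightarrow> real" where
  "rho v i = norm (perp v i (v (Suc i)))"

definition ctr :: "(nat \<Rightarrow> 'a::euclidean_space) \<Rightarrow> nat \<Rightarrow> (nat \<Rightarrow> 'a) \<Rightarrow> 'a" where
  "ctr v i y = (\<Sum>l<i. ((v (Suc i) \<bullet> perp v l (v (Suc l))) / (rho v l)\<^sup>2) *\<^sub>R perp y l (y (Suc l)))"

definition Phi :: "(nat \<Rightarrow> 'a::euclidean_space) \<Rightarrow> nat \<Rightarrow> (nat \<Rightarrow> 'a) \<Rightarrow> 'a \<Rightarrow> 'a" where
  "Phi v i y g = ctr v i y + rho v i *\<^sub>R sgn (perp y i g)"

text \<open>With the lengths of x and of the frame vectors fixed, polarization turns each distance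
  constraint into a linear one. The sphere is thereby a centred sphere cut by an affine
  subspace.\<close>

lemma frame_sphere_iff_inner:
  assumes "gram v i y"
  shows "x \<in> frame_sphere v (Suc i) y \<longleftrightarrow> norm x = norm (v (Suc i)) \<and> (\<forall>l\<in>{1..i}. x \<bullet> y l = v (Suc i) \<bullet> v l)"
proof -
  have "(dist (y l) x = norm (v (Suc i) - v l)) = (x \<bullet> y l = v (Suc i) \<bullet> v l)"
    if l: "l \<in> {1..i}" and n: "norm x = norm (v (Suc i))" for l
  proof -
    have "y l \<bullet> y l = v l \<bullet> v l" using assms l by (auto simp: gram_def)
    moreover have "x \<bullet> x = v (Suc i) \<bullet> v (Suc i)" using n by (metis power2_norm_eq_inner)
    moreover have "(dist (y l) x = norm (v (Suc i) - v l)) = ((y l - x) \<bullet> (y l - x) = (v (Suc i) - v l) \<bullet> (v (Suc i) - v l))"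
      unfolding dist_norm by (rule norm_eq)
    ultimately show ?thesis
      by (simp add: inner_diff_left inner_diff_right inner_commute)
  qed
  moreover have "{1..<Suc i} = {1..i}" by auto
  ultimately show ?thesis unfolding frame_sphere_def by auto
qed

text \<open>This is what drives the inductions over iterated integrals: integrating one more vector
  over its sphere stays among admissible frames.\<close>

lemma frame_sphere_iff_gram:
  assumes "gram v i y"
  shows "x \<in> frame_sphere v (Suc i) y \<longleftrightarrow> gram v (Suc i) (y(Suc i := x))"
proof -
  have "norm x = norm (v (Suc i)) \<longleftrightarrow> x \<bullet> x = v (Suc i) \<bullet> v (Suc i)" by (rule norm_eq)
  moreover have "{1..Suc i} = insert (Suc i) {1..i}" by auto
  ultimately show ?thesis
    using assms unfolding frame_sphere_iff_inner[OF assms] gram_def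
    by (auto simp: inner_commute)
qed

text \<open>Adjoining x to the frame gives a frame with the Gram matrix of \<open>v\<close>, so the
  coefficients and the length of the residual in the expansion of x can be read off from
  \<open>v\<close>. All points of the sphere therefore share centre and radius.\<close>

lemma frame_sphere_decomp:
  assumes g: "gram v i y" and x: "x \<in> frame_sphere v (Suc i) y"
  shows "x = ctr v i y + perp y i x" and "norm (perp y i x) = rho v i"
proof -
  define z where "z = y(Suc i := x)"
  have z: "gram v (Suc i) z" using x frame_sphere_iff_gram[OF g] by (simp add: z_def)
  have pz: "perp z l w = perp y l w" if "l \<le> i" for l w
    by (rule perp_cong) (use that in \<open>auto simp: z_def\<close>)
  have "perp y i x = x - (\<Sum>l<i. ((x \<bullet> perp y l (y (Suc l))) / (perp y l (y (Suc l)) \<bullet> perp y l (y (Suc l)))) *\<^sub>R perp y l (y (Suc l)))"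
    by (rule perp_eq_sum)
  also have "(\<Sum>l<i. ((x \<bullet> perp y l (y (Suc l))) / (perp y l (y (Suc l)) \<bullet> perp y l (y (Suc l)))) *\<^sub>R perp y l (y (Suc l))) = ctr v i y"
    unfolding ctr_def
  proof (rule sum.cong[OF refl])
    fix l assume l: "l \<in> {..<i}"
    have "z (Suc i) \<bullet> perp z l (z (Suc l)) = v (Suc i) \<bullet> perp v l (v (Suc l))"
      by (rule perp_gram[OF z]) (use l in auto)
    moreover have "perp z l (z (Suc l)) \<bullet> perp z l (z (Suc l)) = perp v l (v (Suc l)) \<bullet> perp v l (v (Suc l))"
      by (rule perp_gram2[OF z]) (use l in auto)
    moreover have "z (Suc l) = y (Suc l)" "z (Suc i) = x" using l by (auto simp: z_def)
    ultimately show "((x \<bullet> perp y l (y (Suc l))) / (perp y l (y (Suc l)) \<bullet> perp y l (y (Suc l)))) *\<^sub>R perp y l (y (Suc l))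
       = ((v (Suc i) \<bullet> perp v l (v (Suc l))) / (rho v l)\<^sup>2) *\<^sub>R perp y l (y (Suc l))"
      using l by (simp add: pz rho_def power2_norm_eq_inner)
  qed
  finally show "x = ctr v i y + perp y i x" by simp
  have "perp z i (z (Suc i)) \<bullet> perp z i (z (Suc i)) = perp v i (v (Suc i)) \<bullet> perp v i (v (Suc i))"
    by (rule perp_gram2[OF z]) auto
  then show "norm (perp y i x) = rho v i"
    using pz[of i] by (simp add: rho_def z_def norm_eq)
qed

lemma ctr_self: "v (Suc i) = ctr v i v + perp v i (v (Suc i))"
  using perp_eq_sum[of v i "v (Suc i)"] by (simp add: ctr_def rho_def power2_norm_eq_inner)

lemma ctr_inner:
  assumes g: "gram v i y" and l: "l \<in> {1..i}"
  shows "ctr v i y \<bullet> y l = v (Suc i) \<bullet> v l"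
proof -
  have "ctr v i y \<bullet> y l = ctr v i v \<bullet> v l"
    unfolding ctr_def inner_sum_left
  proof (rule sum.cong[OF refl])
    fix m assume "m \<in> {..<i}"
    then have "y l \<bullet> perp y m (y (Suc m)) = v l \<bullet> perp v m (v (Suc m))"
      using l by (intro perp_gram[OF g]) auto
    then show "((v (Suc i) \<bullet> perp v m (v (Suc m))) / (rho v m)\<^sup>2) *\<^sub>R perp y m (y (Suc m)) \<bullet> y l =
      ((v (Suc i) \<bullet> perp v m (v (Suc m))) / (rho v m)\<^sup>2) *\<^sub>R perp v m (v (Suc m)) \<bullet> v l"
      by (simp add: inner_commute)
  qed
  also have "\<dots> = v (Suc i) \<bullet> v l"
    using perp_orth[OF l, of v "v (Suc i)"] arg_cong[OF ctr_self[of v i], of "\<lambda>w. w \<bullet> v l"]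
    by (simp add: inner_add_left)
  finally show ?thesis .
qed

text \<open>The Gram matrix allows replacing y by \<open>v\<close>, where the identity is Pythagoras
  for the decomposition \<open>ctr_self\<close>.\<close>

lemma ctr_inner_ctr:
  assumes g: "gram v i y"
  shows "ctr v i y \<bullet> ctr v i y = v (Suc i) \<bullet> v (Suc i) - (rho v i)\<^sup>2"
proof -
  have "ctr v i y \<bullet> ctr v i y = ctr v i v \<bullet> ctr v i v"
    unfolding ctr_def inner_sum_left inner_sum_right
    by (intro sum.cong refl) (use perp_gram2[OF g] in auto)
  also have "\<dots> = v (Suc i) \<bullet> v (Suc i) - (rho v i)\<^sup>2"
  proof -
    have c: "ctr v i v = v (Suc i) - perp v i (v (Suc i))" using ctr_self[of v i] by (simp add: algebra_simps)
    show ?thesis unfolding c rho_def power2_norm_eq_inner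
      by (simp add: inner_diff_left inner_diff_right perp_inner_perp inner_commute)
  qed
  finally show ?thesis .
qed

lemma ctr_orth:
  assumes "\<And>l. l \<in> {1..i} \<Longrightarrow> w \<bullet> y l = 0"
  shows "ctr v i y \<bullet> w = 0"
proof -
  have "perp y m (y (Suc m)) \<bullet> w = 0" if m: "m < i" for m
  proof -
    have "perp y m w = w" by (rule perp_fix) (use m assms in auto)
    then have "perp y m (y (Suc m)) \<bullet> w = y (Suc m) \<bullet> w" by (simp add: perp_adjoint)
    then show ?thesis using m assms[of "Suc m"] by (simp add: inner_commute)
  qed
  then show ?thesis by (simp add: ctr_def inner_sum_left)
qed

lemma Phi_in_frame_sphere:
  assumes g: "gram v i y" and nz: "perp y i g \<noteq> 0"
  shows "Phi v i y g \<in> frame_sphere v (Suc i) y"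
proof -
  have o: "sgn (perp y i g) \<bullet> y l = 0" if "l \<in> {1..i}" for l
    using perp_orth[OF that, of y g] by (simp add: sgn_div_norm)
  have "Phi v i y g \<bullet> Phi v i y g = v (Suc i) \<bullet> v (Suc i)"
  proof -
    have "ctr v i y \<bullet> sgn (perp y i g) = 0" by (rule ctr_orth) (rule o)
    moreover have "sgn (perp y i g) \<bullet> sgn (perp y i g) = 1"
      using nz by (simp add: dot_square_norm norm_sgn)
    ultimately show ?thesis
      by (simp add: Phi_def inner_add_left inner_add_right ctr_inner_ctr[OF g] inner_commute power2_eq_square)
  qed
  then have "norm (Phi v i y g) = norm (v (Suc i))" by (simp add: norm_eq)
  then show ?thesis unfolding frame_sphere_iff_inner[OF g]
    using o ctr_inner[OF g] by (auto simp: Phi_def inner_add_left)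
qed

text \<open>\<open>Phi v i y g\<close> is the point of the sphere closest to \<open>g\<close>; this is what makes the
  map commute with every isometry that preserves the sphere.\<close>
lemma Phi_maximal_unique:
  assumes g: "gram v i y" and nz: "perp y i g \<noteq> 0" and z: "z \<in> frame_sphere v (Suc i) y"
  shows "z \<bullet> g \<le> Phi v i y g \<bullet> g" and "Phi v i y g \<bullet> g \<le> z \<bullet> g \<Longrightarrow> z = Phi v i y g"
proof -
  note zd = frame_sphere_decomp[OF g z]
  have 1: "z \<bullet> g = ctr v i y \<bullet> g + perp y i z \<bullet> perp y i g"
    using arg_cong[OF zd(1), of "\<lambda>w. w \<bullet> g"] by (simp add: inner_add_left perp_adjoint perp_idem)
  have "sgn (perp y i g) \<bullet> g = norm (perp y i g)"
    using nz perp_inner_perp[of y i g g]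
    by (simp add: sgn_div_norm divide_simps inner_commute dot_square_norm power2_eq_square)
  then have 2: "Phi v i y g \<bullet> g = ctr v i y \<bullet> g + rho v i * norm (perp y i g)"
    by (simp add: Phi_def inner_add_left)
  have "perp y i z \<bullet> perp y i g \<le> rho v i * norm (perp y i g)"
    using norm_cauchy_schwarz[of "perp y i z" "perp y i g"] zd(2) by simp
  then show "z \<bullet> g \<le> Phi v i y g \<bullet> g" using 1 2 by simp
  assume "Phi v i y g \<bullet> g \<le> z \<bullet> g"
  then have "perp y i z \<bullet> perp y i g = norm (perp y i z) * norm (perp y i g)"
    using 1 2 zd(2) norm_cauchy_schwarz[of "perp y i z" "perp y i g"] by auto
  then have "norm (perp y i z) *\<^sub>R perp y i g = norm (perp y i g) *\<^sub>R perp y i z"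
    by (simp add: norm_cauchy_schwarz_eq)
  moreover have "rho v i *\<^sub>R sgn (perp y i g) = inverse (norm (perp y i g)) *\<^sub>R (rho v i *\<^sub>R perp y i g)"
    by (simp add: sgn_div_norm mult.commute)
  ultimately have "rho v i *\<^sub>R sgn (perp y i g) = inverse (norm (perp y i g)) *\<^sub>R (norm (perp y i g) *\<^sub>R perp y i z)"
    using zd(2) by simp
  then have "perp y i z = rho v i *\<^sub>R sgn (perp y i g)"
    using nz by simp
  then show "z = Phi v i y g" using zd(1) by (simp add: Phi_def)
qed

lemma frame_sphere_compact: "compact (frame_sphere v j y)"
proof -
  have "frame_sphere v j y = sphere 0 (norm (v j)) \<inter> (\<Inter>i\<in>{1..<j}. sphere (y i) (norm (v j - v i)))"
    by (auto simp: frame_sphere_def)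
  moreover have "closed (\<Inter>i\<in>{1..<j}. sphere (y i) (norm (v j - v i)))" by (intro closed_INT) auto
  ultimately show ?thesis by (simp add: compact_Int_closed)
qed

lemma orthogonal_image_frame_sphere:
  assumes T: "orthogonal_transformation T" and fix': "\<And>i. i \<in> {1..<j} \<Longrightarrow> T (y i) = y i"
  shows "T ` frame_sphere v j y = frame_sphere v j y"
proof -
  have lin: "linear T" using T by (rule orthogonal_transformation_linear)
  have d: "dist (T a) (T b) = dist a b" for a b
    using orthogonal_transformation_norm[OF T, of "a - b"] by (simp add: dist_norm linear_diff[OF lin])
  have d': "dist (y i) (T b) = dist (y i) b" if "i \<in> {1..<j}" for i b
    using d[of "y i" b] fix'[OF that] by simp
  have "T x \<in> frame_sphere v j y \<longleftrightarrow> x \<in> frame_sphere v j y" for x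
    using d' by (simp add: frame_sphere_def orthogonal_transformation_norm[OF T])
  moreover have "surj T" using T by (rule orthogonal_transformation_surj)
  ultimately show ?thesis by (auto simp: image_iff) (metis surjD)
qed

text \<open>The reflection that exchanges x and z fixes the hyperplane of points equidistant from
  both. The origin and every \<open>y i\<close> are equidistant from them, so the frame is fixed and
  the sphere is preserved.\<close>

lemma frame_sphere_transitive:
  assumes x: "x \<in> frame_sphere v j y" and z: "z \<in> frame_sphere v j y"
  shows "\<exists>T. orthogonal_transformation T \<and> T ` frame_sphere v j y = frame_sphere v j y \<and> T x = z"
proof (cases "x = z")
  case True
  then show ?thesis by (intro exI[of _ id]) (auto simp: orthogonal_transformation_def linear_id)
next
  case False
  define a where "a = x - z"
  define T where "T w = w - (2 * (a \<bullet> w) / (a \<bullet> a)) *\<^sub>R a" for w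
  have a: "a \<bullet> a \<noteq> 0" using False by (simp add: a_def)
  have nrm: "x \<bullet> x = z \<bullet> z" using x z by (simp add: frame_sphere_def flip: norm_eq)
  have T: "orthogonal_transformation T"
    unfolding orthogonal_transformation_def
  proof
    show "linear T" unfolding T_def linear_iff
      by (auto simp: inner_add_right add_divide_distrib scaleR_add_left algebra_simps)
    show "\<forall>v w. T v \<bullet> T w = v \<bullet> w"
    proof (intro allI)
      fix v w
      define p q s where "p = a \<bullet> v" "q = a \<bullet> w" "s = a \<bullet> a"
      have "T v \<bullet> T w = v \<bullet> w - (2 * q / s) * p - (2 * p / s) * (q - (2 * q / s) * s)"
        unfolding T_def p_q_s_def by (simp add: inner_diff_left inner_diff_right inner_commute[of v a])
      also have "\<dots> = v \<bullet> w" using a by (simp add: p_q_s_def(3)[symmetric])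
      finally show "T v \<bullet> T w = v \<bullet> w" .
    qed
  qed
  have "T (y i) = y i" if i: "i \<in> {1..<j}" for i
  proof -
    have "dist (y i) x = dist (y i) z" using x z i by (simp add: frame_sphere_def)
    then have "(y i - x) \<bullet> (y i - x) = (y i - z) \<bullet> (y i - z)" unfolding dist_norm by (simp add: norm_eq)
    then have "a \<bullet> y i = 0" using nrm by (simp add: a_def inner_diff_left inner_diff_right inner_commute)
    then show ?thesis by (simp add: T_def)
  qed
  moreover have "T x = z"
  proof -
    have "2 * (a \<bullet> x) = a \<bullet> a" using nrm by (simp add: a_def inner_diff_left inner_diff_right inner_commute)
    then show ?thesis using a by (simp add: T_def) (simp add: a_def)
  qed
  ultimately show ?thesis using T orthogonal_image_frame_sphere by blast
qed


section \<open>The frame measures as images of the uniform measure on the ball\<close>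

text \<open>What is used of this measure is its invariance under orthogonal maps and the nullity of
  hyperplanes; both are inherited from Lebesgue measure.\<close>

definition ball_measure :: "'a::euclidean_space measure" where
  "ball_measure = uniform_measure lborel (ball 0 1)"

lemma emeasure_unit_ball: "emeasure lborel (ball (0::'a::euclidean_space) 1) \<noteq> 0" "emeasure lborel (ball (0::'a::euclidean_space) 1) \<noteq> \<infinity>"
proof -
  have "\<not> negligible (ball (0::'a) 1)"
    using open_not_negligible[of "ball (0::'a) 1"] by simp
  then show "emeasure lborel (ball (0::'a) 1) \<noteq> 0"
    unfolding negligible_iff_null_sets by (auto simp: null_sets_def)
  show "emeasure lborel (ball (0::'a) 1) \<noteq> \<infinity>"
    using emeasure_lborel_ball_finite[of "0::'a" 1] by auto
qed

lemma prob_space_ball_measure: "prob_space ball_measure"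
  unfolding ball_measure_def using emeasure_unit_ball by (intro prob_space_uniform_measure) auto

lemma sets_ball_measure[simp, measurable_cong]: "sets ball_measure = sets borel"
  by (simp add: ball_measure_def)

lemma space_ball_measure[simp]: "space ball_measure = UNIV"
  by (simp add: ball_measure_def)

lemma distr_ball_measure_orthogonal:
  fixes T :: "'a::euclidean_space \<Rightarrow> 'a"
  assumes T: "orthogonal_transformation T"
  shows "distr ball_measure borel T = ball_measure"
proof (rule measure_eqI)
  fix A assume "A \<in> sets (distr ball_measure borel T)"
  then have [measurable]: "A \<in> sets borel" by simp
  have [measurable]: "T \<in> borel_measurable borel" by (rule orthogonal_transformation_measurable[OF T])
  have T0: "T 0 = 0" using T by (simp add: orthogonal_transformation_linear linear_0)
  have "T -` (ball 0 1 \<inter> A) = ball 0 1 \<inter> (T -` A)"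
    using vimage_ball_orthogonal_transformation[OF T, of 0 1] T0 by auto
  then have "emeasure lborel (ball 0 1 \<inter> (T -` A)) = emeasure (distr lborel borel T) (ball 0 1 \<inter> A)"
    by (subst emeasure_distr) auto
  also have "\<dots> = emeasure lborel (ball 0 1 \<inter> A)" by (simp add: distr_lborel_orthogonal[OF T])
  finally have "emeasure lborel (ball 0 1 \<inter> (T -` A)) = emeasure lborel (ball 0 1 \<inter> A)" .
  moreover have "T -` A \<in> sets borel" using measurable_sets[of T borel borel A] by simp
  ultimately show "emeasure (distr ball_measure borel T) A = emeasure ball_measure A"
    by (subst emeasure_distr) (auto simp: ball_measure_def)
qed simp

lemma AE_ball_measure_inner_nonzero:
  fixes w :: "'a::euclidean_space"
  assumes "w \<noteq> 0"
  shows "AE g in ball_measure. w \<bullet> g \<noteq> 0"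
proof -
  have "negligible {g. w \<bullet> g = 0}" using assms by (simp add: negligible_hyperplane)
  moreover have "{g. w \<bullet> g = 0} \<in> sets borel"
    by (intro borel_closed closed_hyperplane)
  ultimately have "{g. w \<bullet> g = 0} \<in> null_sets lborel"
    unfolding negligible_iff_null_sets by (auto simp: null_sets_def)
  then have "AE g in lborel. w \<bullet> g \<noteq> 0" by (rule AE_I') auto
  then show ?thesis unfolding ball_measure_def by (intro AE_uniform_measureI) auto
qed

lemma exists_orth_frame:
  fixes y :: "nat \<Rightarrow> 'a::euclidean_space"
  assumes "i < DIM('a)"
  obtains w where "w \<noteq> 0" "\<And>l. l \<in> {1..i} \<Longrightarrow> w \<bullet> y l = 0"
proof -
  have "dim (span (y ` {1..i})) \<le> card (y ` {1..i})" by (simp add: dim_le_card')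
  also have "\<dots> \<le> i" using card_image_le[of "{1..i}" y] by simp
  finally have "dim (span (y ` {1..i})) < DIM('a)" using assms by simp
  then obtain w where w: "w \<noteq> 0" "\<And>z. z \<in> span (y ` {1..i}) \<Longrightarrow> orthogonal w z"
    using orthogonal_to_subspace_exists[of "y ` {1..i}"] by auto
  show thesis by (rule that[OF w(1)]) (use w(2) in \<open>auto simp: orthogonal_def span_base\<close>)
qed

text \<open>For a fixed nonzero w orthogonal to the frame, a vanishing projection of g forces w and
  g to be orthogonal, which confines g to a hyperplane. The exceptional points, where
  \<open>Phi\<close> returns the centre because \<open>sgn 0 = 0\<close>, are thus
  negligible.\<close>

lemma AE_perp_nonzero:
  fixes y :: "nat \<Rightarrow> 'a::euclidean_space"
  assumes "i < DIM('a)"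
  shows "AE g in ball_measure. perp y i g \<noteq> 0"
proof -
  obtain w where w: "w \<noteq> 0" "\<And>l. l \<in> {1..i} \<Longrightarrow> w \<bullet> y l = 0"
    using exists_orth_frame[OF assms] by blast
  have "perp y i w = w" using w(2) by (rule perp_fix)
  then have "w \<bullet> g = w \<bullet> perp y i g" for g using perp_adjoint[of y i w g] by simp
  then have *: "perp y i g \<noteq> 0" if "w \<bullet> g \<noteq> 0" for g using that by (metis inner_zero_right)
  show ?thesis using AE_ball_measure_inner_nonzero[OF w(1)]
    by eventually_elim (rule *)
qed

lemma measurable_coord_fun: "(\<lambda>y. y i) \<in> borel_measurable (borel :: (nat \<Rightarrow> 'a::euclidean_space) measure)"
  by (intro borel_measurable_continuous_onI continuous_on_product_coordinates)

text \<open>Frames carry the Borel sets of the product topology, for which updating a coordinate is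
  jointly continuous in the frame and the new value.\<close>

lemma measurable_fun_upd_borel[measurable]:
  assumes [measurable]: "f \<in> M \<rightarrow>\<^sub>M (borel :: (nat \<Rightarrow> 'a::euclidean_space) measure)" "g \<in> M \<rightarrow>\<^sub>M borel"
  shows "(\<lambda>x. (f x)(i := g x)) \<in> M \<rightarrow>\<^sub>M borel"
proof -
  have "continuous_on UNIV (\<lambda>p :: (nat \<Rightarrow> 'a) \<times> 'a. (fst p)(i := snd p))"
  proof (rule continuous_on_coordinatewise_then_product)
    fix l
    have "continuous_on UNIV (\<lambda>p :: (nat \<Rightarrow> 'a) \<times> 'a. fst p l)"
      by (rule continuous_on_product_then_coordinatewise) (rule continuous_on_fst[OF continuous_on_id])
    then show "continuous_on UNIV (\<lambda>p :: (nat \<Rightarrow> 'a) \<times> 'a. ((fst p)(i := snd p)) l)"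
      by (cases "l = i") (auto intro: continuous_intros)
  qed
  then have "(\<lambda>p :: (nat \<Rightarrow> 'a) \<times> 'a. (fst p)(i := snd p)) \<in> borel_measurable (borel \<Otimes>\<^sub>M borel)"
    unfolding borel_prod by (rule borel_measurable_continuous_onI)
  from measurable_compose[OF measurable_Pair[OF assms] this] show ?thesis by simp
qed

lemma measurable_perp[measurable]:
  assumes [measurable]: "f \<in> M \<rightarrow>\<^sub>M (borel :: (nat \<Rightarrow> 'a::euclidean_space) measure)" "g \<in> M \<rightarrow>\<^sub>M borel"
  shows "(\<lambda>x. perp (f x) i (g x)) \<in> M \<rightarrow>\<^sub>M borel"
  using assms(2)
proof (induction i arbitrary: g)
  case (Suc i)
  have [measurable]: "(\<lambda>x. f x (Suc i)) \<in> M \<rightarrow>\<^sub>M borel"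
    by (rule measurable_compose[OF assms(1) measurable_coord_fun])
  have [measurable]: "(\<lambda>x. perp (f x) i (f x (Suc i))) \<in> M \<rightarrow>\<^sub>M borel" by (rule Suc.IH) measurable
  have [measurable]: "(\<lambda>x. perp (f x) i (g x)) \<in> M \<rightarrow>\<^sub>M borel" by (rule Suc.IH) fact
  show ?case by simp
qed simp

lemma measurable_Phi[measurable]:
  assumes [measurable]: "f \<in> M \<rightarrow>\<^sub>M (borel :: (nat \<Rightarrow> 'a::euclidean_space) measure)" "g \<in> M \<rightarrow>\<^sub>M borel"
  shows "(\<lambda>x. Phi v i (f x) (g x)) \<in> M \<rightarrow>\<^sub>M borel"
proof -
  have [measurable]: "(\<lambda>x. f x l) \<in> M \<rightarrow>\<^sub>M borel" for l
    by (rule measurable_compose[OF assms(1) measurable_coord_fun])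
  show ?thesis unfolding Phi_def ctr_def sgn_div_norm by measurable
qed

lemma measurable_Phi_ball_measure[measurable, simp]: "Phi v i y \<in> borel_measurable ball_measure"
  using measurable_Phi[of "\<lambda>_. y" ball_measure "\<lambda>x. x" v i] by simp

lemma measurable_Phi_borel[measurable, simp]: "Phi v i y \<in> borel_measurable borel"
  using measurable_Phi[of "\<lambda>_. y" borel "\<lambda>x. x" v i] by simp

text \<open>\<open>Phi v i y g\<close> is the unique maximizer of the inner product with g over the
  sphere. An isometry T preserving the sphere takes it to the maximizer for T g, so T commutes with
  \<open>Phi\<close> almost everywhere and the invariance of \<open>ball_measure\<close> passes to
  the image.\<close>

lemma invariant_prob_on_distr_Phi:
  fixes y :: "nat \<Rightarrow> real^'n"
  assumes g: "gram v i y" and i: "i < CARD('n)"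
  shows "invariant_prob_on (frame_sphere v (Suc i) y) (distr ball_measure borel (Phi v i y))"
  unfolding invariant_prob_on_def
proof (intro conjI allI impI)
  interpret prob_space "ball_measure :: (real^'n) measure" by (rule prob_space_ball_measure)
  interpret d: prob_space "distr ball_measure borel (Phi v i y)" by (rule prob_space_distr) simp
  have nz: "AE g in ball_measure. perp y i g \<noteq> 0" by (rule AE_perp_nonzero) (use i in simp)
  have cl: "closed (frame_sphere v (Suc i) y)" using frame_sphere_compact by (rule compact_imp_closed)
  show "emeasure (distr ball_measure borel (Phi v i y)) (space (distr ball_measure borel (Phi v i y))) = 1"
    by (rule d.emeasure_space_1)
  show "emeasure (distr ball_measure borel (Phi v i y)) (UNIV - frame_sphere v (Suc i) y) = 0"
  proof -
    have "emeasure (distr ball_measure borel (Phi v i y)) (UNIV - frame_sphere v (Suc i) y) =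
      emeasure ball_measure {g \<in> space ball_measure. \<not> Phi v i y g \<in> frame_sphere v (Suc i) y}"
      using cl by (subst emeasure_distr) (auto intro!: arg_cong[where f="emeasure ball_measure"])
    also have "\<dots> = 0"
      by (rule emeasure_eq_0_AE, rule AE_mp[OF nz]) (auto intro!: AE_I2 Phi_in_frame_sphere[OF g])
    finally show ?thesis .
  qed
  fix T :: "real^'n \<Rightarrow> real^'n"
  assume "orthogonal_transformation T \<and> T ` frame_sphere v (Suc i) y = frame_sphere v (Suc i) y"
  then have T: "orthogonal_transformation T" and TS: "T ` frame_sphere v (Suc i) y = frame_sphere v (Suc i) y"
    by auto
  have [measurable]: "T \<in> borel_measurable borel" by (rule orthogonal_transformation_measurable[OF T])
  have inn: "T a \<bullet> T b = a \<bullet> b" for a b using T by (simp add: orthogonal_transformation_def)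
  have "AE g in distr ball_measure borel T. perp y i g \<noteq> 0" using nz unfolding distr_ball_measure_orthogonal[OF T] .
  then have nzT: "AE g in ball_measure. perp y i (T g) \<noteq> 0"
    by (rule AE_distrD[rotated]) measurable
  have comm: "AE g in ball_measure. T (Phi v i y g) = Phi v i y (T g)"
    using nz nzT
  proof eventually_elim
    case (elim g)
    have a: "T (Phi v i y g) \<in> frame_sphere v (Suc i) y"
      using Phi_in_frame_sphere[OF g elim(1)] TS by blast
    obtain z where z: "z \<in> frame_sphere v (Suc i) y" "Phi v i y (T g) = T z"
      using Phi_in_frame_sphere[OF g elim(2)] TS by (metis imageE)
    have "Phi v i y (T g) \<bullet> T g = z \<bullet> g" using z inn by simp
    also have "\<dots> \<le> Phi v i y g \<bullet> g" by (rule Phi_maximal_unique(1)[OF g elim(1) z(1)])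
    also have "\<dots> = T (Phi v i y g) \<bullet> T g" by (simp add: inn)
    finally show ?case by (rule Phi_maximal_unique(2)[OF g elim(2) a])
  qed
  have "distr (distr ball_measure borel (Phi v i y)) borel T = distr ball_measure borel (\<lambda>g. T (Phi v i y g))"
    by (subst distr_distr) (auto simp: comp_def)
  also have "\<dots> = distr ball_measure borel (\<lambda>g. Phi v i y (T g))"
    using comm by (intro distr_cong_AE) auto
  also have "\<dots> = distr (distr ball_measure borel T) borel (Phi v i y)"
    by (subst distr_distr) (auto simp: comp_def)
  also have "\<dots> = distr ball_measure borel (Phi v i y)"
    unfolding distr_ball_measure_orthogonal[OF T] ..
  finally show "distr (distr ball_measure borel (Phi v i y)) borel T = distr ball_measure borel (Phi v i y)" .
qed simp

text \<open>The description is resolved here. From now on \<open>frame_sigma\<close> at an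
  admissible frame is an image under a map that is measurable jointly in the frame and in the point
  of the ball.\<close>

lemma frame_sigma_eq_distr:
  fixes y :: "nat \<Rightarrow> real^'n"
  assumes g: "gram v i y" and i: "i < CARD('n)"
  shows "frame_sigma v (Suc i) y = distr ball_measure borel (Phi v i y)"
proof -
  let ?S = "frame_sphere v (Suc i) y"
  have "sphere_measure ?S = (THE \<mu>. invariant_prob_on ?S \<mu>)"
    unfolding sphere_measure_def invariant_prob_on_def by simp
  also have "\<dots> = distr ball_measure borel (Phi v i y)"
  proof (rule the_equality)
    show "invariant_prob_on ?S (distr ball_measure borel (Phi v i y))"
      by (rule invariant_prob_on_distr_Phi[OF assms])
    then show "\<mu> = distr ball_measure borel (Phi v i y)" if "invariant_prob_on ?S \<mu>" for \<mu>
      using invariant_prob_on_unique[OF frame_sphere_compact frame_sphere_transitive that] by blast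
  qed
  finally show ?thesis by (simp add: frame_sigma_def)
qed

lemma invariant_prob_on_frame_sigma:
  fixes y :: "nat \<Rightarrow> real^'n"
  assumes "gram v i y" and "i < CARD('n)"
  shows "invariant_prob_on (frame_sphere v (Suc i) y) (frame_sigma v (Suc i) y)"
  by (simp add: frame_sigma_eq_distr[OF assms] invariant_prob_on_distr_Phi[OF assms])

section \<open>Rotations and Fourier decay\<close>

text \<open>Dominated convergence for the remainder of the difference quotient. The mean value
  inequality bounds the quotient by w x because the derivative bound holds at all parameters;
  subtracting the derivative itself accounts for the factor 2.\<close>

lemma has_vector_derivative_integral:
  fixes F :: "real \<Rightarrow> 'a \<Rightarrow> 'b::{banach, second_countable_topology}"
  assumes int: "\<And>t. integrable M (F t)"
    and der: "AE x in M. \<forall>t. ((\<lambda>t. F t x) has_vector_derivative F' t x) (at t) \<and> norm (F' t x) \<le> w x"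
    and meas: "F' t \<in> borel_measurable M" and w: "integrable M w"
  shows "((\<lambda>t. \<integral>x. F t x \<partial>M) has_vector_derivative (\<integral>x. F' t x \<partial>M)) (at t)"
proof -
  have intF': "integrable M (F' t)"
    by (rule Bochner_Integration.integrable_bound[OF w meas])
       (rule AE_mp[OF der], rule AE_I2, metis abs_ge_self order_trans real_norm_def)
  define G where "G u x = (F u x - F t x - (u - t) *\<^sub>R F' t x) /\<^sub>R norm (u - t)" for u x
  have Gint: "(\<integral>x. G u x \<partial>M) = ((\<integral>x. F u x \<partial>M) - (\<integral>x. F t x \<partial>M) - (u - t) *\<^sub>R (\<integral>x. F' t x \<partial>M)) /\<^sub>R norm (u - t)" for u
    unfolding G_def using int intF' by simp
  have "((\<lambda>u. \<integral>x. G u x \<partial>M) \<longlongrightarrow> 0) (at t)"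
    unfolding tendsto_at_iff_sequentially comp_def
  proof (intro allI impI)
    fix X :: "nat \<Rightarrow> real" assume X: "\<forall>i. X i \<in> UNIV - {t}" "X \<longlonglongrightarrow> t"
    have "(\<lambda>n. \<integral>x. G (X n) x \<partial>M) \<longlonglongrightarrow> (\<integral>x. 0 \<partial>M)"
    proof (rule integral_dominated_convergence[where w="\<lambda>x. 2 * w x"])
      show "G (X n) \<in> borel_measurable M" for n
        unfolding G_def using int intF' by (intro borel_measurable_scaleR borel_measurable_diff) auto
      show "AE x in M. (\<lambda>n. G (X n) x) \<longlonglongrightarrow> 0"
        using der
      proof eventually_elim
        case (elim x)
        then have "((\<lambda>t. F t x) has_derivative (\<lambda>h. h *\<^sub>R F' t x)) (at t)"
          by (simp add: has_vector_derivative_def)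
        then have "((\<lambda>u. G u x) \<longlongrightarrow> 0) (at t)"
          by (simp add: has_derivative_at_within G_def has_derivative_def divide_inverse_commute)
        then show ?case using X unfolding tendsto_at_iff_sequentially comp_def by blast
      qed
      show "AE x in M. norm (G (X n) x) \<le> 2 * w x" for n
        using der
      proof eventually_elim
        case (elim x)
        have "norm (F (X n) x - F t x) \<le> w x * norm (X n - t)"
        proof (rule differentiable_bound[of UNIV])
          show "((\<lambda>t. F t x) has_derivative (\<lambda>h. h *\<^sub>R F' u x)) (at u within UNIV)" for u
            using elim by (simp add: has_vector_derivative_def)
          show "onorm (\<lambda>h. h *\<^sub>R F' u x) \<le> w x" for u
            using elim by (intro onorm_le) (simp add: mult.commute mult_left_mono)
        qed auto
        moreover have "norm ((X n - t) *\<^sub>R F' t x) \<le> w x * norm (X n - t)"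
          using elim by (simp add: mult.commute[of "\<bar>X n - t\<bar>"] mult_right_mono)
        ultimately have "norm (F (X n) x - F t x - (X n - t) *\<^sub>R F' t x) \<le> 2 * w x * norm (X n - t)"
          by (intro order_trans[OF norm_triangle_ineq4]) simp
        moreover have "norm (X n - t) > 0" using X by auto
        moreover have "norm (G (X n) x) = norm (F (X n) x - F t x - (X n - t) *\<^sub>R F' t x) / norm (X n - t)"
          unfolding G_def norm_scaleR by (simp add: divide_inverse mult.commute)
        ultimately show ?case by (simp only: pos_divide_le_eq)
      qed
    qed (use w in auto)
    then show "(\<lambda>n. \<integral>x. G (X n) x \<partial>M) \<longlonglongrightarrow> 0" by simp
  qed
  then show ?thesis
    unfolding has_vector_derivative_def has_derivative_def Gint
    by (simp add: bounded_linear_scaleR_left divide_inverse_commute)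
qed

lemma (in prob_space) norm_integral_le_const:
  fixes f :: "'a \<Rightarrow> 'b::{banach, second_countable_topology}"
  assumes "integrable M f" "AE x in M. norm (f x) \<le> K"
  shows "norm (\<integral>x. f x \<partial>M) \<le> K"
  by (rule order_trans[OF integral_norm_bound integral_le_const]) (use assms in auto)

section \<open>Rotations and integration by parts on invariant sets\<close>

text \<open>For orthonormal e and a this is the rotation that takes e to cos \<theta> e + sin
  \<theta> a and is the identity on the orthogonal complement of their plane.\<close>

definition rot :: "'a::euclidean_space \<Rightarrow> 'a \<Rightarrow> real \<Rightarrow> 'a \<Rightarrow> 'a" where
  "rot e a \<theta> x = x + ((cos \<theta> - 1) * (x \<bullet> e) - sin \<theta> * (x \<bullet> a)) *\<^sub>R e
      + (sin \<theta> * (x \<bullet> e) + (cos \<theta> - 1) * (x \<bullet> a)) *\<^sub>R a"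

lemma
  assumes "norm e = 1" "norm a = 1" "e \<bullet> a = 0"
  shows rot_inner_e: "rot e a \<theta> x \<bullet> e = cos \<theta> * (x \<bullet> e) - sin \<theta> * (x \<bullet> a)"
    and rot_inner_a: "rot e a \<theta> x \<bullet> a = sin \<theta> * (x \<bullet> e) + cos \<theta> * (x \<bullet> a)"
    and rot_orthogonal: "orthogonal_transformation (rot e a \<theta>)"
proof -
  have n: "e \<bullet> e = 1" "a \<bullet> a = 1" "a \<bullet> e = 0" using assms by (auto simp: norm_eq_1 inner_commute)
  show 1: "rot e a \<theta> x \<bullet> e = cos \<theta> * (x \<bullet> e) - sin \<theta> * (x \<bullet> a)"
   and 2: "rot e a \<theta> x \<bullet> a = sin \<theta> * (x \<bullet> e) + cos \<theta> * (x \<bullet> a)" for x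
    using n assms by (auto simp: rot_def inner_add_left algebra_simps)
  have "norm (rot e a \<theta> x) = norm x" for x
  proof -
    define p q where "p = x \<bullet> e" "q = x \<bullet> a"
    have "rot e a \<theta> x \<bullet> rot e a \<theta> x = rot e a \<theta> x \<bullet> x + ((cos \<theta> - 1) * p - sin \<theta> * q) * (rot e a \<theta> x \<bullet> e)
      + (sin \<theta> * p + (cos \<theta> - 1) * q) * (rot e a \<theta> x \<bullet> a)"
      by (subst (2) rot_def) (simp add: inner_add_right p_q_def)
    also have "rot e a \<theta> x \<bullet> x = x \<bullet> x + ((cos \<theta> - 1) * p - sin \<theta> * q) * p
      + (sin \<theta> * p + (cos \<theta> - 1) * q) * q"
      by (subst rot_def) (simp add: inner_add_left p_q_def inner_commute[of e] inner_commute[of a])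
    also have "x \<bullet> x + ((cos \<theta> - 1) * p - sin \<theta> * q) * p
      + (sin \<theta> * p + (cos \<theta> - 1) * q) * q + ((cos \<theta> - 1) * p - sin \<theta> * q) * (rot e a \<theta> x \<bullet> e)
      + (sin \<theta> * p + (cos \<theta> - 1) * q) * (rot e a \<theta> x \<bullet> a)
      = x \<bullet> x + ((sin \<theta>)\<^sup>2 + (cos \<theta>)\<^sup>2 - 1) * (p * p + q * q)"
    proof -
      have "X + ((c - 1) * p - s * q) * p + (s * p + (c - 1) * q) * q + ((c - 1) * p - s * q) * (c * p - s * q)
        + (s * p + (c - 1) * q) * (s * p + c * q) = X + (s\<^sup>2 + c\<^sup>2 - 1) * (p * p + q * q)" for X c s :: real
        by (simp add: algebra_simps power2_eq_square)
      then show ?thesis unfolding 1 2 p_q_def[symmetric] .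
    qed
    finally show ?thesis by (simp add: norm_eq)
  qed
  moreover have "linear (rot e a \<theta>)"
    unfolding linear_iff rot_def by (auto simp: inner_add_left algebra_simps)
  ultimately show "orthogonal_transformation (rot e a \<theta>)" by (simp add: orthogonal_transformation)
qed

lemma rot_0: "rot e a 0 x = x"
  by (simp add: rot_def)

lemma rot_fix: "x \<bullet> e = 0 \<Longrightarrow> x \<bullet> a = 0 \<Longrightarrow> rot e a \<theta> x = x"
  by (simp add: rot_def)

text \<open>The integral of G along the rotated point does not depend on the angle, so its
  derivative at angle 0 vanishes. \<open>G'\<close> is the derivative of G along the infinitesimal
  rotation; the identity acts as integration by parts without boundary terms.\<close>

lemma invariant_rot_integral:
  fixes G G' :: "'a::euclidean_space \<Rightarrow> real"
  assumes inv: "invariant_prob_on S \<mu>" and S: "closed S"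
    and ea: "norm e = 1" "norm a = 1" "e \<bullet> a = 0"
    and rot_image_S: "\<And>\<theta>. rot e a \<theta> ` S = S"
    and meas: "G \<in> borel_measurable borel" "G' \<in> borel_measurable borel"
    and bnd: "\<And>x. x \<in> S \<Longrightarrow> \<bar>G x\<bar> \<le> K" "\<And>x. x \<in> S \<Longrightarrow> \<bar>G' x\<bar> \<le> K"
    and der: "\<And>x \<theta>. x \<in> S \<Longrightarrow> ((\<lambda>\<theta>. G (rot e a \<theta> x)) has_real_derivative G' (rot e a \<theta> x)) (at \<theta>)"
  shows "(\<integral>x. G' x \<partial>\<mu>) = 0"
proof -
  interpret prob_space \<mu> using inv by (rule invariant_prob_on_prob)
  have sets[measurable_cong]: "sets \<mu> = sets borel" using inv by (rule invariant_prob_on_sets)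
  have AE: "AE x in \<mu>. x \<in> S" using inv S by (rule invariant_prob_on_AE)
  have [measurable]: "rot e a \<theta> \<in> borel_measurable borel" for \<theta>
    by (rule orthogonal_transformation_measurable[OF rot_orthogonal[OF ea]])
  note meas[measurable]
  have inS: "rot e a \<theta> x \<in> S" if "x \<in> S" for x \<theta> using rot_image_S that by blast
  have "((\<lambda>\<theta>. \<integral>x. G (rot e a \<theta> x) \<partial>\<mu>) has_vector_derivative (\<integral>x. G' (rot e a 0 x) \<partial>\<mu>)) (at 0)"
  proof (rule has_vector_derivative_integral[where w="\<lambda>_. K"])
    show "integrable \<mu> (\<lambda>x. G (rot e a t x))" for t
      by (rule integrable_const_bound[where B=K])
         (rule AE_mp[OF AE], rule AE_I2, use bnd inS in auto)
    show "AE x in \<mu>. \<forall>t. ((\<lambda>t. G (rot e a t x)) has_vector_derivative G' (rot e a t x)) (at t) \<and> norm (G' (rot e a t x)) \<le> K"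
      using AE by eventually_elim (use der bnd inS in \<open>auto simp: has_real_derivative_iff_has_vector_derivative[symmetric]\<close>)
  qed auto
  moreover have "(\<integral>x. G (rot e a \<theta> x) \<partial>\<mu>) = (\<integral>x. G x \<partial>\<mu>)" for \<theta>
  proof -
    have "(\<integral>x. G x \<partial>\<mu>) = (\<integral>x. G x \<partial>distr \<mu> borel (rot e a \<theta>))"
      using invariant_prob_on_distr[OF inv rot_orthogonal[OF ea] rot_image_S] by simp
    also have "\<dots> = (\<integral>x. G (rot e a \<theta> x) \<partial>\<mu>)" by (rule integral_distr) auto
    finally show ?thesis by simp
  qed
  ultimately have "((\<lambda>\<theta>. \<integral>x. G x \<partial>\<mu>) has_vector_derivative (\<integral>x. G' x \<partial>\<mu>)) (at 0)" by (simp add: rot_0)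
  then show ?thesis
    using vector_derivative_unique_at has_vector_derivative_const by blast
qed

text \<open>B is an orthonormal basis of the complement of e inside W, and the last clause is
  Parseval there. The lower bound on its size is only an inequality because the vectors of y may be
  dependent.\<close>

lemma orthonormal_complement_basis:
  fixes y :: "nat \<Rightarrow> 'a::euclidean_space"
  assumes e: "norm e = 1" "\<And>l. l \<in> {1..i} \<Longrightarrow> e \<bullet> y l = 0"
  obtains B where "finite B" "DIM('a) \<le> card B + i + 1" "card B \<le> DIM('a)"
    "\<And>a. a \<in> B \<Longrightarrow> norm a = 1" "\<And>a. a \<in> B \<Longrightarrow> e \<bullet> a = 0"
    "\<And>a l. a \<in> B \<Longrightarrow> l \<in> {1..i} \<Longrightarrow> a \<bullet> y l = 0"
    "\<And>x. (\<Sum>a\<in>B. (x \<bullet> a)\<^sup>2) = (norm (perp y i x))\<^sup>2 - (x \<bullet> e)\<^sup>2"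
proof -
  define A where "A = insert e (y ` {1..i})"
  define W where "W = {w. \<forall>x\<in>span A. orthogonal x w}"
  have "dim {w \<in> UNIV. \<forall>x\<in>span A. orthogonal x w} + dim (span A) = dim (UNIV :: 'a set)"
    by (rule dim_subspace_orthogonal_to_vectors) auto
  then have dimW: "dim W + dim A = DIM('a)" by (simp add: W_def)
  have "dim A \<le> card A" unfolding A_def by (simp add: dim_le_card')
  also have "\<dots> \<le> Suc (card (y ` {1..i}))" unfolding A_def by (simp add: card_insert_if)
  also have "\<dots> \<le> Suc i" using card_image_le[of "{1..i}" y] by simp
  finally have dA: "dim A \<le> Suc i" .
  have sW: "subspace W" unfolding W_def by (simp add: subspace_orthogonal_to_vectors)
  obtain B where B: "B \<subseteq> W" "pairwise orthogonal B" "\<And>x. x \<in> B \<Longrightarrow> norm x = 1"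
    "independent B" "card B = dim W" "span B = W" using orthonormal_basis_subspace[OF sW] by blast
  have fin: "finite B" using B(4) by (rule independent_imp_finite)
  have memW: "w \<in> W \<longleftrightarrow> e \<bullet> w = 0 \<and> (\<forall>l\<in>{1..i}. w \<bullet> y l = 0)" for w
  proof
    assume "w \<in> W" then show "e \<bullet> w = 0 \<and> (\<forall>l\<in>{1..i}. w \<bullet> y l = 0)"
      unfolding W_def A_def orthogonal_def by (auto simp: span_base inner_commute[of w])
  next
    assume *: "e \<bullet> w = 0 \<and> (\<forall>l\<in>{1..i}. w \<bullet> y l = 0)"
    have "orthogonal w x" if "x \<in> span A" for x
      by (rule orthogonal_to_span[OF that]) (use * in \<open>auto simp: A_def orthogonal_def inner_commute\<close>)
    then show "w \<in> W" unfolding W_def by (auto simp: orthogonal_commute)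
  qed
  have par: "(\<Sum>a\<in>B. (x \<bullet> a)\<^sup>2) = (norm (perp y i x))\<^sup>2 - (x \<bullet> e)\<^sup>2" for x
  proof -
    have pe: "perp y i e = e" using e(2) by (rule perp_fix)
    have xe: "perp y i x \<bullet> e = x \<bullet> e" by (simp add: perp_adjoint pe)
    define z where "z = perp y i x - (x \<bullet> e) *\<^sub>R e"
    have ee: "e \<bullet> e = 1" using e(1) by (simp add: norm_eq_1)
    have z: "z \<in> W" unfolding memW z_def
      using e(2) perp_orth[of _ i y x] xe by (auto simp: inner_diff_left inner_diff_right ee inner_commute)
    have za: "z \<bullet> a = x \<bullet> a" if "a \<in> B" for a
    proof -
      have "a \<in> W" using that B by auto
      then have "e \<bullet> a = 0" "perp y i a = a" using memW perp_fix[of i a y] by auto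
      then show ?thesis by (simp add: z_def inner_diff_left perp_adjoint)
    qed
    have "z \<bullet> z = z \<bullet> (\<Sum>a\<in>B. (z \<bullet> a) *\<^sub>R a)"
      using orthonormal_basis_expand[OF B(2,3) _ fin, of z] z B(6) by simp
    also have "\<dots> = (\<Sum>a\<in>B. (x \<bullet> a)\<^sup>2)"
      by (simp add: inner_sum_right za power2_eq_square)
    also have "z \<bullet> z = (norm (perp y i x))\<^sup>2 - (x \<bullet> e)\<^sup>2"
      unfolding z_def power2_norm_eq_inner
      by (simp add: inner_diff_left inner_diff_right xe ee inner_commute[of e "perp y i x"] power2_eq_square)
    finally show ?thesis by simp
  qed
  show thesis
  proof (rule that[OF fin])
    show "DIM('a) \<le> card B + i + 1" "card B \<le> DIM('a)" using dimW dA B(5) by auto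
  qed (use B memW par in auto)
qed

lemma rot_image_frame_sphere:
  assumes ea: "norm e = 1" "norm a = 1" "e \<bullet> a = 0"
    and o: "\<And>l. l \<in> {1..i} \<Longrightarrow> e \<bullet> y l = 0" "\<And>l. l \<in> {1..i} \<Longrightarrow> a \<bullet> y l = 0"
  shows "rot e a \<theta> ` frame_sphere v (Suc i) y = frame_sphere v (Suc i) y"
  by (rule orthogonal_image_frame_sphere[OF rot_orthogonal[OF ea]])
     (rule rot_fix, use o in \<open>auto simp: inner_commute\<close>)


lemma rot_deriv:
  assumes ea: "norm e = 1" "norm a = 1" "e \<bullet> a = 0"
  shows "((\<lambda>\<theta>. rot e a \<theta> x \<bullet> e) has_real_derivative - (rot e a \<theta> x \<bullet> a)) (at \<theta>)"
    and "((\<lambda>\<theta>. rot e a \<theta> x \<bullet> a) has_real_derivative (rot e a \<theta> x \<bullet> e)) (at \<theta>)"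
  unfolding rot_inner_e[OF ea] rot_inner_a[OF ea]
  by (auto intro!: derivative_eq_intros)

text \<open>One admissible frame, with e the unit vector along the component of the frequency in W
  and B completing it to an orthonormal basis of W. The rotations in the planes of e and each a in B
  preserve the sphere.\<close>

locale frame_measure =
  fixes v y :: "nat \<Rightarrow> real^'n" and i :: nat and \<mu> :: "(real^'n) measure" and S :: "(real^'n) set"
    and r :: real and e :: "real^'n" and B :: "(real^'n) set"
  assumes g: "gram v i y" and i: "i < CARD('n)"
  defines "\<mu> \<equiv> frame_sigma v (Suc i) y" and "S \<equiv> frame_sphere v (Suc i) y" and "r \<equiv> rho v i"
  assumes r: "r > 0" and e: "norm e = 1" "\<And>l. l \<in> {1..i} \<Longrightarrow> e \<bullet> y l = 0"
    and B: "finite B" "\<And>a. a \<in> B \<Longrightarrow> norm a = 1" "\<And>a. a \<in> B \<Longrightarrow> e \<bullet> a = 0"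
    "\<And>a l. a \<in> B \<Longrightarrow> l \<in> {1..i} \<Longrightarrow> a \<bullet> y l = 0"
    "\<And>x. (\<Sum>a\<in>B. (x \<bullet> a)\<^sup>2) = (norm (perp y i x))\<^sup>2 - (x \<bullet> e)\<^sup>2"
begin

lemma inv: "invariant_prob_on S \<mu>"
  unfolding \<mu>_def S_def by (rule invariant_prob_on_frame_sigma[OF g i])

lemma closedS: "closed S"
  unfolding S_def using frame_sphere_compact by (rule compact_imp_closed)

sublocale prob_space \<mu>
  using inv by (rule invariant_prob_on_prob)

lemma sets_mu[measurable_cong, simp]: "sets \<mu> = sets borel"
  using inv by (rule invariant_prob_on_sets)

lemma AE_S: "AE x in \<mu>. x \<in> S"
  using inv closedS by (rule invariant_prob_on_AE)

lemma sum_inner_square: "x \<in> S \<Longrightarrow> (\<Sum>a\<in>B. (x \<bullet> a)\<^sup>2) = r\<^sup>2 - (x \<bullet> e)\<^sup>2"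
  unfolding B(5) S_def r_def using frame_sphere_decomp(2)[OF g] by simp

lemma abs_inner_le_radius:
  assumes x: "x \<in> S"
  shows "\<bar>x \<bullet> e\<bar> \<le> r" and "a \<in> B \<Longrightarrow> \<bar>x \<bullet> a\<bar> \<le> r"
proof -
  have "0 \<le> (\<Sum>a\<in>B. (x \<bullet> a)\<^sup>2)" by (intro sum_nonneg) auto
  then have "(x \<bullet> e)\<^sup>2 \<le> r\<^sup>2" using sum_inner_square[OF x] by simp
  then show "\<bar>x \<bullet> e\<bar> \<le> r" using r by (simp add: power2_le_iff_abs_le)
  assume "a \<in> B"
  then have "(x \<bullet> a)\<^sup>2 \<le> (\<Sum>a\<in>B. (x \<bullet> a)\<^sup>2)"
    using B(1) by (intro member_le_sum) auto
  then have "(x \<bullet> a)\<^sup>2 \<le> r\<^sup>2" using sum_inner_square[OF x] zero_le_power2[of "x \<bullet> e"] by linarith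
  then show "\<bar>x \<bullet> a\<bar> \<le> r" using r by (simp add: power2_le_iff_abs_le)
qed

lemma rot_image_S: "a \<in> B \<Longrightarrow> rot e a \<theta> ` S = S"
  unfolding S_def by (rule rot_image_frame_sphere) (use e B in auto)

lemma integrable_S:
  fixes f :: "real^'n \<Rightarrow> 'b::{banach, second_countable_topology}"
  assumes "f \<in> borel_measurable borel" "\<And>x. x \<in> S \<Longrightarrow> norm (f x) \<le> K"
  shows "integrable \<mu> f"
  by (rule integrable_const_bound[where B=K]) (use assms AE_S in auto)

text \<open>The reflection that negates e fixes the frame, so it preserves the measure. This removes
  the odd parts of the transform and makes it real apart from the phase of the centre.\<close>

lemma reflect_integral:
  fixes f :: "real \<Rightarrow> real"
  assumes [measurable]: "f \<in> borel_measurable borel" and odd: "\<And>p. f (- p) = - f p"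
  shows "(\<integral>x. f (x \<bullet> e) \<partial>\<mu>) = 0"
proof -
  define T where "T x = x - (2 * (x \<bullet> e)) *\<^sub>R e" for x
  have ee: "e \<bullet> e = 1" using e by (simp add: norm_eq_1)
  have T: "orthogonal_transformation T"
    unfolding orthogonal_transformation_def
  proof
    show "linear T" unfolding T_def linear_iff by (auto simp: inner_add_left algebra_simps)
    show "\<forall>v w. T v \<bullet> T w = v \<bullet> w"
    proof (intro allI)
      fix v w show "T v \<bullet> T w = v \<bullet> w"
        by (simp add: T_def inner_diff_left inner_diff_right ee inner_commute[of e w])
    qed
  qed
  have TS: "T ` S = S" unfolding S_def
    by (rule orthogonal_image_frame_sphere[OF T]) (use e in \<open>auto simp: T_def inner_commute\<close>)
  have [measurable]: "T \<in> borel_measurable borel" by (rule orthogonal_transformation_measurable[OF T])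
  have "(\<integral>x. f (x \<bullet> e) \<partial>\<mu>) = (\<integral>x. f (x \<bullet> e) \<partial>distr \<mu> borel T)"
    using invariant_prob_on_distr[OF inv T TS] by simp
  also have "\<dots> = (\<integral>x. f (T x \<bullet> e) \<partial>\<mu>)" by (rule integral_distr) auto
  also have "\<dots> = - (\<integral>x. f (x \<bullet> e) \<partial>\<mu>)"
    using odd by (simp add: T_def inner_diff_left ee)
  finally show ?thesis by simp
qed

text \<open>The Fourier transform in the direction e, with the vanishing sine part dropped. The
  centre does not enter because e is orthogonal to the frame. \<open>\<phi>1\<close> and
  \<open>\<phi>2\<close> are its first two derivatives.\<close>

definition "\<phi> s = (\<integral>x. cos (s * (x \<bullet> e)) \<partial>\<mu>)"
definition "\<phi>1 s = (\<integral>x. - (x \<bullet> e) * sin (s * (x \<bullet> e)) \<partial>\<mu>)"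
definition "\<phi>2 s = (\<integral>x. - (x \<bullet> e)\<^sup>2 * cos (s * (x \<bullet> e)) \<partial>\<mu>)"

lemma integrable_cos: "integrable \<mu> (\<lambda>x. cos (s * (x \<bullet> e)))"
  by (rule integrable_S[where K=1]) auto

lemma integrable_inner_sin: "integrable \<mu> (\<lambda>x. - (x \<bullet> e) * sin (s * (x \<bullet> e)))"
proof (rule integrable_S[where K=r])
  fix x assume "x \<in> S"
  then show "norm (- (x \<bullet> e) * sin (s * (x \<bullet> e))) \<le> r"
    using mult_mono[OF abs_inner_le_radius(1) abs_sin_le_one, of x "s * (x \<bullet> e)"] r by (simp add: abs_mult)
qed auto

lemma abs_inner_square_cos_le: "x \<in> S \<Longrightarrow> \<bar>- (x \<bullet> e)\<^sup>2 * cos (s * (x \<bullet> e))\<bar> \<le> r\<^sup>2"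
  using mult_mono[OF power_mono[OF abs_inner_le_radius(1), of x 2] abs_cos_le_one, of "s * (x \<bullet> e)"] by (simp add: abs_mult)

lemma integrable_inner_square_cos: "integrable \<mu> (\<lambda>x. - (x \<bullet> e)\<^sup>2 * cos (s * (x \<bullet> e)))"
  by (rule integrable_S[where K="r\<^sup>2"]) (use abs_inner_square_cos_le in auto)

lemma phi_deriv: "(\<phi> has_real_derivative \<phi>1 s) (at s)"
  unfolding \<phi>_def[abs_def] \<phi>1_def has_real_derivative_iff_has_vector_derivative
proof (rule has_vector_derivative_integral[where w="\<lambda>_. r"])
  show "AE x in \<mu>. \<forall>t. ((\<lambda>t. cos (t * (x \<bullet> e))) has_vector_derivative - (x \<bullet> e) * sin (t * (x \<bullet> e))) (at t)
      \<and> norm (- (x \<bullet> e) * sin (t * (x \<bullet> e))) \<le> r"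
    using AE_S
  proof eventually_elim
    case (elim x)
    have "\<bar>x \<bullet> e\<bar> * \<bar>sin (t * (x \<bullet> e))\<bar> \<le> r * 1" for t
      using abs_inner_le_radius(1)[OF elim] r by (intro mult_mono) auto
    then show ?case
      by (auto simp: abs_mult has_real_derivative_iff_has_vector_derivative[symmetric] intro!: derivative_eq_intros)
  qed
qed (use integrable_cos in auto)

lemma phi1_deriv: "(\<phi>1 has_real_derivative \<phi>2 s) (at s)"
  unfolding \<phi>1_def[abs_def] \<phi>2_def has_real_derivative_iff_has_vector_derivative
proof (rule has_vector_derivative_integral[where w="\<lambda>_. r\<^sup>2"])
  show "AE x in \<mu>. \<forall>t. ((\<lambda>t. - (x \<bullet> e) * sin (t * (x \<bullet> e))) has_vector_derivative - (x \<bullet> e)\<^sup>2 * cos (t * (x \<bullet> e))) (at t)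
      \<and> norm (- (x \<bullet> e)\<^sup>2 * cos (t * (x \<bullet> e))) \<le> r\<^sup>2"
    using AE_S
    by eventually_elim (use abs_inner_square_cos_le in \<open>auto simp: power2_eq_square has_real_derivative_iff_has_vector_derivative[symmetric] intro!: derivative_eq_intros\<close>)
qed (use integrable_inner_sin in auto)

text \<open>The Bessel equation of the sphere: the rotation derivatives of \<open>(x \<bullet> a) sin (s (x \<bullet> e))\<close> integrate to zero.\<close>
lemma phi_ode: "s * \<phi>2 s + real (card B) * \<phi>1 s + r\<^sup>2 * s * \<phi> s = 0"
proof -
  define G' where "G' a x = - s * ((x \<bullet> a)\<^sup>2 * cos (s * (x \<bullet> e))) + (x \<bullet> e) * sin (s * (x \<bullet> e))" for a x :: "real^'n"
  have [measurable]: "G' a \<in> borel_measurable borel" for a unfolding G'_def[abs_def] by measurable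
  have bG': "\<bar>G' a x\<bar> \<le> \<bar>s\<bar> * r\<^sup>2 + r" if "x \<in> S" "a \<in> B" for x a
  proof -
    have "\<bar>s\<bar> * (\<bar>x \<bullet> a\<bar>\<^sup>2 * \<bar>cos (s * (x \<bullet> e))\<bar>) \<le> \<bar>s\<bar> * (r\<^sup>2 * 1)"
      using abs_inner_le_radius(2)[OF that] by (intro mult_left_mono mult_mono power_mono) auto
    moreover have "\<bar>x \<bullet> e\<bar> * \<bar>sin (s * (x \<bullet> e))\<bar> \<le> r * 1"
      using abs_inner_le_radius(1)[OF that(1)] r by (intro mult_mono) auto
    ultimately show ?thesis unfolding G'_def
      by (intro order_trans[OF abs_triangle_ineq]) (simp add: abs_mult)
  qed
  have z: "(\<integral>x. G' a x \<partial>\<mu>) = 0" if a: "a \<in> B" for a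
  proof (rule invariant_rot_integral[OF inv closedS, where G="\<lambda>x. (x \<bullet> a) * sin (s * (x \<bullet> e))" and e=e and a=a and K="\<bar>s\<bar> * r\<^sup>2 + r"])
    show "\<bar>(x \<bullet> a) * sin (s * (x \<bullet> e))\<bar> \<le> \<bar>s\<bar> * r\<^sup>2 + r" if "x \<in> S" for x
    proof -
      have "\<bar>x \<bullet> a\<bar> * \<bar>sin (s * (x \<bullet> e))\<bar> \<le> r * 1"
        using abs_inner_le_radius(2)[OF that a] r by (intro mult_mono) auto
      moreover have "0 \<le> \<bar>s\<bar> * r\<^sup>2" by simp
      ultimately show ?thesis unfolding abs_mult by linarith
    qed
    note d = rot_deriv[OF e(1) B(2,3)[OF a]]
    show "((\<lambda>\<theta>. (rot e a \<theta> x \<bullet> a) * sin (s * (rot e a \<theta> x \<bullet> e))) has_real_derivative G' a (rot e a \<theta> x)) (at \<theta>)" for x \<theta>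
      unfolding G'_def by (rule derivative_eq_intros d refl)+ (simp add: power2_eq_square algebra_simps)
  qed (use e B a rot_image_S bG' in auto)
  have ig: "integrable \<mu> (G' a)" if "a \<in> B" for a
    by (rule integrable_S[where K="\<bar>s\<bar> * r\<^sup>2 + r"]) (use bG' that in auto)
  \<comment> \<open>A single direction a leaves an integral of its own. Summing over B replaces the
    squares of all x.a by r^2 - (x.e)^2, and only \<phi> and its derivatives remain.\<close>
  have "0 = (\<integral>x. (\<Sum>a\<in>B. G' a x) \<partial>\<mu>)" using z ig by simp
  also have "\<dots> = (\<integral>x. - s * r\<^sup>2 * cos (s * (x \<bullet> e)) - s * (- (x \<bullet> e)\<^sup>2 * cos (s * (x \<bullet> e))) - real (card B) * (- (x \<bullet> e) * sin (s * (x \<bullet> e))) \<partial>\<mu>)"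
  proof (rule integral_cong_AE)
    show "AE x in \<mu>. (\<Sum>a\<in>B. G' a x) = - s * r\<^sup>2 * cos (s * (x \<bullet> e)) - s * (- (x \<bullet> e)\<^sup>2 * cos (s * (x \<bullet> e))) - real (card B) * (- (x \<bullet> e) * sin (s * (x \<bullet> e)))"
      using AE_S
    proof eventually_elim
      case (elim x)
      have "(\<Sum>a\<in>B. G' a x) = - s * (\<Sum>a\<in>B. (x \<bullet> a)\<^sup>2) * cos (s * (x \<bullet> e)) + real (card B) * ((x \<bullet> e) * sin (s * (x \<bullet> e)))"
        unfolding G'_def sum.distrib sum_distrib_left sum_distrib_right by (simp add: algebra_simps)
      then show ?case unfolding sum_inner_square[OF elim] by (simp add: algebra_simps)
    qed
  qed auto
  also have "\<dots> = - s * r\<^sup>2 * \<phi> s - s * \<phi>2 s - real (card B) * \<phi>1 s"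
    unfolding \<phi>_def \<phi>1_def \<phi>2_def using integrable_cos[of s] integrable_inner_sin[of s] integrable_inner_square_cos[of s] by simp
  finally show ?thesis by (simp add: algebra_simps)
qed

text \<open>With N = card B, the function w = s \<phi> satisfies the oscillator equation w'' + r^2 w
  = -(N - 2) \<phi>'. The energy w'^2 + r^2 w^2 then has derivative -(N - 2) (\<phi>^2)' - 2 (N - 2)
  s \<phi>'^2. Adding (N - 2) \<phi>^2 cancels the part without a sign, so the total decreases from
  its value N - 1 at 0.\<close>

lemma phi_energy:
  assumes s: "0 \<le> s" and N: "2 \<le> card B"
  shows "(\<phi> s + s * \<phi>1 s)\<^sup>2 + r\<^sup>2 * s\<^sup>2 * (\<phi> s)\<^sup>2 \<le> real (card B) - 1"
proof -
  define N where "N = real (card B)"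
  define E where "E s = (\<phi> s + s * \<phi>1 s)\<^sup>2 + r\<^sup>2 * s\<^sup>2 * (\<phi> s)\<^sup>2 + (N - 2) * (\<phi> s)\<^sup>2" for s
  have N2: "N \<ge> 2" using N by (simp add: N_def)
  have dE: "(E has_real_derivative - (2 * ((N - 2) * t * (\<phi>1 t)\<^sup>2))) (at t)" for t
  proof -
    have "(E has_real_derivative (2 * (\<phi> t + t * \<phi>1 t) * (2 * \<phi>1 t + t * \<phi>2 t) + (r\<^sup>2 * (2 * t) * (\<phi> t)\<^sup>2 + r\<^sup>2 * t\<^sup>2 * (2 * \<phi> t * \<phi>1 t)) + (N - 2) * (2 * \<phi> t * \<phi>1 t))) (at t)"
      unfolding E_def[abs_def]
      by (rule derivative_eq_intros phi_deriv phi1_deriv refl)+ (simp add: power2_eq_square algebra_simps)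
    also have "2 * (\<phi> t + t * \<phi>1 t) * (2 * \<phi>1 t + t * \<phi>2 t) + (r\<^sup>2 * (2 * t) * (\<phi> t)\<^sup>2 + r\<^sup>2 * t\<^sup>2 * (2 * \<phi> t * \<phi>1 t)) + (N - 2) * (2 * \<phi> t * \<phi>1 t)
      = - (2 * ((N - 2) * t * (\<phi>1 t)\<^sup>2)) + 2 * (\<phi> t + t * \<phi>1 t) * (t * \<phi>2 t + N * \<phi>1 t + r\<^sup>2 * t * \<phi> t)"
      by (simp add: power2_eq_square algebra_simps)
    also have "\<dots> = - (2 * ((N - 2) * t * (\<phi>1 t)\<^sup>2))"
      using phi_ode[of t] by (simp add: N_def)
    finally show ?thesis .
  qed
  have "E s \<le> E 0"
    using s by (rule DERIV_nonpos_imp_nonincreasing)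
       (rule exI, rule conjI, rule dE, use N2 in auto)
  also have "E 0 = N - 1" by (simp add: E_def \<phi>_def prob_space)
  finally have "E s \<le> N - 1" .
  moreover have "0 \<le> (N - 2) * (\<phi> s)\<^sup>2" using N2 by simp
  ultimately show ?thesis by (simp add: E_def N_def)
qed

lemma abs_phi_le: "\<bar>\<phi> s\<bar> \<le> 1" and abs_phi1_le: "\<bar>\<phi>1 s\<bar> \<le> r"
proof -
  have "norm (\<phi> s) \<le> 1"
    unfolding \<phi>_def by (rule norm_integral_le_const[OF integrable_cos]) auto
  then show "\<bar>\<phi> s\<bar> \<le> 1" by simp
  have "norm (\<phi>1 s) \<le> r"
    unfolding \<phi>1_def
  proof (rule norm_integral_le_const[OF integrable_inner_sin])
    show "AE x in \<mu>. norm (- (x \<bullet> e) * sin (s * (x \<bullet> e))) \<le> r"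
      using AE_S
    proof eventually_elim
      case (elim x)
      have "\<bar>x \<bullet> e\<bar> * \<bar>sin (s * (x \<bullet> e))\<bar> \<le> r * 1"
        using abs_inner_le_radius(1)[OF elim] r by (intro mult_mono) auto
      then show ?case by (simp add: abs_mult)
    qed
  qed
  then show "\<bar>\<phi>1 s\<bar> \<le> r" by simp
qed

text \<open>The trivial bounds handle the summand 1 and the energy handles the summand
  \<open>s\<^sup>2\<close>; for the derivative, s \<phi>' is the difference of w' and
  \<phi>.\<close>

lemma phi_decay:
  assumes s: "0 \<le> s" and N: "2 \<le> card B"
  shows "(1 + s\<^sup>2) * (\<phi> s)\<^sup>2 \<le> 1 + real (card B) / r\<^sup>2"
    and "(1 + s\<^sup>2) * (\<phi>1 s)\<^sup>2 \<le> r\<^sup>2 + 4 * real (card B)"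
proof -
  have E: "(\<phi> s + s * \<phi>1 s)\<^sup>2 + r\<^sup>2 * s\<^sup>2 * (\<phi> s)\<^sup>2 \<le> real (card B) - 1" by (rule phi_energy[OF assms])
  have p1: "(\<phi> s)\<^sup>2 \<le> 1" using abs_phi_le by (simp add: abs_square_le_1)
  have p2: "(\<phi>1 s)\<^sup>2 \<le> r\<^sup>2" using power_mono[OF abs_phi1_le, of s 2] by simp
  have "r\<^sup>2 * s\<^sup>2 * (\<phi> s)\<^sup>2 \<le> real (card B)" using E zero_le_power2[of "\<phi> s + s * \<phi>1 s"] by linarith
  then have "s\<^sup>2 * (\<phi> s)\<^sup>2 \<le> real (card B) / r\<^sup>2" using r by (simp add: field_simps)
  with p1 show "(1 + s\<^sup>2) * (\<phi> s)\<^sup>2 \<le> 1 + real (card B) / r\<^sup>2" by (simp add: algebra_simps)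
  \<comment> \<open>The difference of the two sides is the square of 2 \<phi> + s \<phi>'.\<close>
  have "(s * \<phi>1 s)\<^sup>2 \<le> 2 * (\<phi> s + s * \<phi>1 s)\<^sup>2 + 2 * (\<phi> s)\<^sup>2"
    using zero_le_power2[of "2 * \<phi> s + s * \<phi>1 s"] by (simp add: power2_eq_square algebra_simps)
  moreover have "(\<phi> s + s * \<phi>1 s)\<^sup>2 \<le> real (card B) - 1" using E by (smt (verit) mult_nonneg_nonneg zero_le_power2)
  ultimately have "s\<^sup>2 * (\<phi>1 s)\<^sup>2 \<le> 4 * real (card B)" using p1 N by (simp add: power_mult_distrib)
  with p2 show "(1 + s\<^sup>2) * (\<phi>1 s)\<^sup>2 \<le> r\<^sup>2 + 4 * real (card B)" by (simp add: algebra_simps)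
qed

text \<open>Rotation derivatives of \<open>(x \<bullet> e) (x \<bullet> a) / (\<epsilon> + r\<^sup>2 - (x \<bullet> e)\<^sup>2)\<close> integrate to zero; for at least three
  directions \<open>a\<close> this controls the singularity of \<open>1 / (r\<^sup>2 - (x \<bullet> e)\<^sup>2)\<close>.\<close>
lemma integral_inverse_gap:
  assumes eps: "0 < \<epsilon>" and N: "3 \<le> card B"
  shows "(\<integral>x. 1 / (\<epsilon> + r\<^sup>2 - (x \<bullet> e)\<^sup>2) \<partial>\<mu>) \<le> 2 / (r\<^sup>2 + \<epsilon>)"
proof -
  define D where "D x = \<epsilon> + r\<^sup>2 - (x \<bullet> e)\<^sup>2" for x
  have D: "\<epsilon> \<le> D x" if "x \<in> S" for x
    using abs_inner_le_radius(1)[OF that] r abs_le_square_iff[of "x \<bullet> e" r] by (simp add: D_def)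
  have Dpos: "0 < D x" if "x \<in> S" for x using D[OF that] eps by linarith
  define G' where "G' a x = ((x \<bullet> e)\<^sup>2 - (x \<bullet> a)\<^sup>2) / D x - 2 * (x \<bullet> e)\<^sup>2 * (x \<bullet> a)\<^sup>2 / (D x)\<^sup>2" for a x :: "real^'n"
  define K where "K = r\<^sup>2 / \<epsilon> + 2 * r\<^sup>2 * r\<^sup>2 / \<epsilon>\<^sup>2"
  have sq: "(x \<bullet> e)\<^sup>2 \<le> r\<^sup>2" "a \<in> B \<Longrightarrow> (x \<bullet> a)\<^sup>2 \<le> r\<^sup>2" if "x \<in> S" for x a
    using abs_inner_le_radius[OF that] r by (auto simp: abs_le_square_iff[symmetric])
  have [measurable]: "D \<in> borel_measurable borel" unfolding D_def[abs_def] by measurable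
  have [measurable]: "G' a \<in> borel_measurable borel" for a unfolding G'_def[abs_def] by measurable
  have bG': "\<bar>G' a x\<bar> \<le> K" if "x \<in> S" "a \<in> B" for x a
  proof -
    have "\<bar>((x \<bullet> e)\<^sup>2 - (x \<bullet> a)\<^sup>2) / D x\<bar> \<le> r\<^sup>2 / \<epsilon>"
      unfolding abs_divide
    proof (rule frac_le)
      show "\<bar>(x \<bullet> e)\<^sup>2 - (x \<bullet> a)\<^sup>2\<bar> \<le> r\<^sup>2"
        using sq[OF that(1)] that(2) zero_le_power2[of "x \<bullet> e"] zero_le_power2[of "x \<bullet> a"] by (smt (verit))
    qed (use D[OF that(1)] eps in auto)
    moreover have "\<bar>2 * (x \<bullet> e)\<^sup>2 * (x \<bullet> a)\<^sup>2 / (D x)\<^sup>2\<bar> \<le> 2 * r\<^sup>2 * r\<^sup>2 / \<epsilon>\<^sup>2"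
      unfolding abs_divide
    proof (rule frac_le)
      show "\<bar>2 * (x \<bullet> e)\<^sup>2 * (x \<bullet> a)\<^sup>2\<bar> \<le> 2 * r\<^sup>2 * r\<^sup>2"
        using mult_mono[OF sq(1)[OF that(1)] sq(2)[OF that]] by (simp add: abs_mult)
      show "\<epsilon>\<^sup>2 \<le> \<bar>(D x)\<^sup>2\<bar>" using D[OF that(1)] eps by (simp add: power_mono)
    qed (use eps in auto)
    ultimately show ?thesis unfolding G'_def K_def by linarith
  qed
  have z: "(\<integral>x. G' a x \<partial>\<mu>) = 0" if a: "a \<in> B" for a
  proof (rule invariant_rot_integral[OF inv closedS, where G="\<lambda>x. (x \<bullet> e) * (x \<bullet> a) / D x" and e=e and a=a and K=K])
    show "\<bar>(x \<bullet> e) * (x \<bullet> a) / D x\<bar> \<le> K" if x: "x \<in> S" for x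
    proof -
      have "\<bar>(x \<bullet> e) * (x \<bullet> a) / D x\<bar> \<le> r\<^sup>2 / \<epsilon>"
        unfolding abs_divide
      proof (rule frac_le)
        show "\<bar>(x \<bullet> e) * (x \<bullet> a)\<bar> \<le> r\<^sup>2"
          unfolding abs_mult power2_eq_square using abs_inner_le_radius[OF x] a r by (intro mult_mono) auto
      qed (use D[OF x] eps in auto)
      moreover have "0 \<le> 2 * r\<^sup>2 * r\<^sup>2 / \<epsilon>\<^sup>2" by simp
      ultimately show ?thesis unfolding K_def by linarith
    qed
    note d = rot_deriv[OF e(1) B(2,3)[OF a]]
    show "((\<lambda>\<theta>. (rot e a \<theta> x \<bullet> e) * (rot e a \<theta> x \<bullet> a) / D (rot e a \<theta> x)) has_real_derivative G' a (rot e a \<theta> x)) (at \<theta>)"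
      if x: "x \<in> S" for x \<theta>
    proof -
      define p q where "p = (\<lambda>\<theta>. rot e a \<theta> x \<bullet> e)" and "q = (\<lambda>\<theta>. rot e a \<theta> x \<bullet> a)"
      have "rot e a \<theta> x \<in> S" using rot_image_S[OF a, of \<theta>] x by blast
      then have nz: "\<epsilon> + r\<^sup>2 - (p \<theta>)\<^sup>2 \<noteq> 0" using Dpos by (force simp: D_def p_def)
      have d': "(p has_real_derivative - q \<theta>) (at \<theta>)" "(q has_real_derivative p \<theta>) (at \<theta>)"
        unfolding p_def q_def by (rule d)+
      have "((\<lambda>\<theta>. p \<theta> * q \<theta> / (\<epsilon> + r\<^sup>2 - (p \<theta>)\<^sup>2)) has_real_derivative
          (((p \<theta>)\<^sup>2 - (q \<theta>)\<^sup>2) / (\<epsilon> + r\<^sup>2 - (p \<theta>)\<^sup>2) - 2 * (p \<theta>)\<^sup>2 * (q \<theta>)\<^sup>2 / (\<epsilon> + r\<^sup>2 - (p \<theta>)\<^sup>2)\<^sup>2)) (at \<theta>)"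
        using nz by (auto intro!: derivative_eq_intros d' simp: power2_eq_square divide_simps)
      then show ?thesis by (simp add: G'_def D_def p_def q_def)
    qed
  qed (use e B a rot_image_S bG' in auto)
  have ig: "integrable \<mu> (G' a)" if "a \<in> B" for a
    by (rule integrable_S[where K=K]) (use bG' that in auto)
  have iD: "integrable \<mu> (\<lambda>x. 1 / D x)"
    by (rule integrable_S[where K="1/\<epsilon>"]) (use D Dpos eps in \<open>auto simp: frac_le abs_of_pos\<close>)
  have "(r\<^sup>2 + \<epsilon>) * (\<integral>x. 1 / D x \<partial>\<mu>) - 2 = (\<integral>x. (r\<^sup>2 + \<epsilon>) * (1 / D x) - 2 \<partial>\<mu>)"
  proof -
    have "integrable \<mu> (\<lambda>x. (r\<^sup>2 + \<epsilon>) * (1 / D x))" by (rule integrable_mult_right[OF iD])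
    then have "(\<integral>x. (r\<^sup>2 + \<epsilon>) * (1 / D x) - 2 \<partial>\<mu>) = (\<integral>x. (r\<^sup>2 + \<epsilon>) * (1 / D x) \<partial>\<mu>) - (\<integral>x. 2 \<partial>\<mu>)"
      by (rule Bochner_Integration.integral_diff) simp
    then show ?thesis by (simp only: integral_mult_right_zero) (simp add: prob_space)
  qed
  also have "\<dots> \<le> (\<integral>x. (\<Sum>a\<in>B. G' a x) \<partial>\<mu>)"
  proof (rule integral_mono_AE)
    show "AE x in \<mu>. (r\<^sup>2 + \<epsilon>) * (1 / D x) - 2 \<le> (\<Sum>a\<in>B. G' a x)"
      using AE_S
    proof eventually_elim
      case (elim x)
      define p2 where "p2 = (x \<bullet> e)\<^sup>2"
      define gap where "gap = r\<^sup>2 - p2"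
      have gap: "0 \<le> gap" "gap \<le> D x" "D x = \<epsilon> + gap" "0 \<le> p2" using sq(1)[OF elim] eps by (auto simp: gap_def p2_def D_def)
      note Dp = Dpos[OF elim]
      have "(\<Sum>a\<in>B. G' a x) = (\<Sum>a\<in>B. p2 / D x - (x \<bullet> a)\<^sup>2 * (1 / D x + 2 * p2 / (D x)\<^sup>2))"
        unfolding G'_def p2_def by (intro sum.cong refl) (simp add: diff_divide_distrib algebra_simps)
      also have "\<dots> = real (card B) * (p2 / D x) - gap * (1 / D x + 2 * p2 / (D x)\<^sup>2)"
        unfolding sum_subtractf sum_distrib_right[symmetric] sum_inner_square[OF elim] by (simp add: gap_def p2_def)
      also have "gap * (1 / D x + 2 * p2 / (D x)\<^sup>2) = gap / D x + 2 * (p2 / D x) * (gap / D x)"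
        by (simp add: algebra_simps power2_eq_square)
      finally have eq: "(\<Sum>a\<in>B. G' a x) = real (card B) * (p2 / D x) - (gap / D x + 2 * (p2 / D x) * (gap / D x))" .
      \<comment> \<open>With P = p2 / D, the sum is at least N P - 1 - 2 P, so N at least 3 leaves P
        - 1. Since p2 = r^2 + \<epsilon> - D, this is (r^2 + \<epsilon>) / D - 2, and its integral
        is at most 0. The positive \<epsilon> keeps all integrands bounded.\<close>
      have g1: "gap / D x \<le> 1" "0 \<le> p2 / D x" using gap Dp by auto
      have "2 * (p2 / D x) * (gap / D x) \<le> 2 * (p2 / D x) * 1"
        using g1 by (intro mult_left_mono) auto
      moreover have "3 * (p2 / D x) \<le> real (card B) * (p2 / D x)" using g1 N by (intro mult_right_mono) auto
      ultimately have "p2 / D x - 1 \<le> (\<Sum>a\<in>B. G' a x)" unfolding eq using g1(1) by linarith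
      moreover have "p2 / D x - 1 = (r\<^sup>2 + \<epsilon>) * (1 / D x) - 2"
        using Dp by (simp add: divide_simps) (simp add: D_def p2_def)
      ultimately show ?case by simp
    qed
    show "integrable \<mu> (\<lambda>x. (r\<^sup>2 + \<epsilon>) * (1 / D x) - 2)"
      by (intro Bochner_Integration.integrable_diff integrable_mult_right iD integrable_const)
  qed (use ig in auto)
  also have "\<dots> = 0" using z ig by simp
  finally have "(r\<^sup>2 + \<epsilon>) * (\<integral>x. 1 / D x \<partial>\<mu>) \<le> 2" by simp
  then show ?thesis using eps r unfolding D_def by (simp add: field_simps add_pos_pos)
qed

end

section \<open>Decay of the frame measures and averages over the last vector\<close>

lemma borel_measurable_cis[measurable]: "f \<in> borel_measurable M \<Longrightarrow> (\<lambda>x. cis (f x)) \<in> borel_measurable M"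
  by (rule borel_measurable_continuous_on[OF continuous_on_cis[OF continuous_on_id]])

text \<open>The derivative in t of the transform at \<open>t *\<^sub>R \<xi>\<close>, taken under
  the integral sign.\<close>

definition dfourier :: "(real^'n) measure \<Rightarrow> real \<Rightarrow> real^'n \<Rightarrow> complex" where
  "dfourier \<mu> t \<xi> = (\<integral>x. - (\<i> * of_real (2 * pi * (x \<bullet> \<xi>))) * cis (- (2 * pi * (x \<bullet> (t *\<^sub>R \<xi>)))) \<partial>\<mu>)"

text \<open>\<open>A\<close> is the bound of \<open>phi_decay\<close> for the transform with
  \<open>card B\<close> replaced by the dimension, and \<open>V\<close> bounds the squares of both
  the radius and the norm of the centre. The last summand serves the derivative; its 4 pi^2 is the
  square of the 2 pi in the exponent. Only \<open>v\<close> enters, never the frame.\<close>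

definition decay_const :: "(nat \<Rightarrow> real^'n) \<Rightarrow> nat \<Rightarrow> real" where
  "decay_const v i = (let A = 1 + real CARD('n) / (rho v i)\<^sup>2; V = (norm (v (Suc i)))\<^sup>2 in
     A + 4 * pi\<^sup>2 * (V * A + (V + 4 * real CARD('n))))"

lemma rho_le: "rho v i \<le> norm (v (Suc i))"
  unfolding rho_def by (rule perp_norm_le)

lemma norm_ctr_le:
  assumes "gram v i y"
  shows "norm (ctr v i y) \<le> norm (v (Suc i))"
  using ctr_inner_ctr[OF assms] by (simp add: norm_le)

context frame_measure
begin

lemma integral_cis: "(\<integral>x. cis (- (s * (x \<bullet> e))) \<partial>\<mu>) = of_real (\<phi> s)"
proof -
  have "(\<integral>x. cis (- (s * (x \<bullet> e))) \<partial>\<mu>) = (\<integral>x. complex_of_real (cos (s * (x \<bullet> e))) - \<i> * complex_of_real (sin (s * (x \<bullet> e))) \<partial>\<mu>)"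
    by (intro Bochner_Integration.integral_cong refl) (simp add: complex_eq_iff)
  also have "\<dots> = of_real (\<integral>x. cos (s * (x \<bullet> e)) \<partial>\<mu>) - \<i> * of_real (\<integral>x. sin (s * (x \<bullet> e)) \<partial>\<mu>)"
    by (subst Bochner_Integration.integral_diff)
       (auto intro!: integrable_S[where K=1] simp: norm_mult)
  also have "(\<integral>x. sin (s * (x \<bullet> e)) \<partial>\<mu>) = 0" by (rule reflect_integral[of "\<lambda>p. sin (s * p)"]) auto
  finally show ?thesis by (simp add: \<phi>_def)
qed

lemma integral_inner_cis: "(\<integral>x. of_real (x \<bullet> e) * cis (- (s * (x \<bullet> e))) \<partial>\<mu>) = \<i> * of_real (\<phi>1 s)"
proof -
  have b: "\<bar>x \<bullet> e\<bar> * \<bar>c\<bar> \<le> r" if "x \<in> S" "\<bar>c\<bar> \<le> 1" for x c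
    using mult_mono[OF abs_inner_le_radius(1)[OF that(1)] that(2)] r by simp
  have "(\<integral>x. of_real (x \<bullet> e) * cis (- (s * (x \<bullet> e))) \<partial>\<mu>) = (\<integral>x. complex_of_real ((x \<bullet> e) * cos (s * (x \<bullet> e))) + \<i> * complex_of_real (- (x \<bullet> e) * sin (s * (x \<bullet> e))) \<partial>\<mu>)"
    by (intro Bochner_Integration.integral_cong refl) (simp add: complex_eq_iff)
  also have "\<dots> = of_real (\<integral>x. (x \<bullet> e) * cos (s * (x \<bullet> e)) \<partial>\<mu>) + \<i> * of_real (\<integral>x. - (x \<bullet> e) * sin (s * (x \<bullet> e)) \<partial>\<mu>)"
  proof (subst Bochner_Integration.integral_add)
    show "integrable \<mu> (\<lambda>x. complex_of_real ((x \<bullet> e) * cos (s * (x \<bullet> e))))"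
      by (rule integrable_S[where K=r]) (use b in \<open>auto simp: norm_mult abs_mult simp del: of_real_mult\<close>)
    show "integrable \<mu> (\<lambda>x. \<i> * complex_of_real (- (x \<bullet> e) * sin (s * (x \<bullet> e))))"
      using integrable_inner_sin[of s] by (intro integrable_mult_right integrable_of_real)
  qed (simp only: integral_mult_right_zero integral_complex_of_real)
  also have "(\<integral>x. (x \<bullet> e) * cos (s * (x \<bullet> e)) \<partial>\<mu>) = 0" by (rule reflect_integral[of "\<lambda>p. p * cos (s * p)"]) auto
  finally show ?thesis by (simp add: \<phi>1_def)
qed

end

lemma frame_measure_exists:
  fixes v y :: "nat \<Rightarrow> real^'n"
  assumes g: "gram v i y" and i: "i < CARD('n)" and r: "rho v i > 0" and eta: "perp y i \<xi> \<noteq> 0"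
  obtains B where "frame_measure v y i (sgn (perp y i \<xi>)) B"
    "CARD('n) \<le> card B + i + 1" "card B \<le> CARD('n)"
proof -
  have e: "norm (sgn (perp y i \<xi>)) = 1" "\<And>l. l \<in> {1..i} \<Longrightarrow> sgn (perp y i \<xi>) \<bullet> y l = 0"
    using eta perp_orth[of _ i y \<xi>] by (auto simp: norm_sgn sgn_div_norm)
  show thesis
  proof (rule orthonormal_complement_basis[OF e])
    fix B
    assume B: "finite B" "DIM(real^'n) \<le> card B + i + 1" "card B \<le> DIM(real^'n)"
      "\<And>a. a \<in> B \<Longrightarrow> norm a = 1" "\<And>a. a \<in> B \<Longrightarrow> sgn (perp y i \<xi>) \<bullet> a = 0"
      "\<And>a l. a \<in> B \<Longrightarrow> l \<in> {1..i} \<Longrightarrow> a \<bullet> y l = 0"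
      "\<And>x. (\<Sum>a\<in>B. (x \<bullet> a)\<^sup>2) = (norm (perp y i x))\<^sup>2 - (x \<bullet> sgn (perp y i \<xi>))\<^sup>2"
    show thesis
    proof (rule that)
      show "frame_measure v y i (sgn (perp y i \<xi>)) B"
        by (rule frame_measure.intro[OF g i r e B(1,4-7)])
    qed (use B in auto)
  qed
qed

text \<open>On the sphere x.\<xi> is a constant \<kappa> from the centre plus |\<eta>| times x.e.
  The constant contributes a phase, so the transform has modulus |\<phi>(s)| with s = 2 pi t
  |\<eta>|. In the derivative it contributes a term \<kappa> \<phi> next to |\<eta>| \<phi>', and
  \<kappa> is at most |v(i+1)| |\<xi>|. The dimension hypothesis gives \<open>card B\<close> at
  least 2.\<close>

lemma frame_sigma_decay:
  fixes v y :: "nat \<Rightarrow> real^'n"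
  assumes g: "gram v i y" and i: "i + 3 \<le> CARD('n)" and r: "rho v i > 0" and t: "0 \<le> t"
  shows "(1 + t\<^sup>2 * (norm (perp y i \<xi>))\<^sup>2) * (cmod (fourier_measure (frame_sigma v (Suc i) y) (t *\<^sub>R \<xi>)))\<^sup>2 \<le> decay_const v i"
    and "(1 + t\<^sup>2 * (norm (perp y i \<xi>))\<^sup>2) * (cmod (dfourier (frame_sigma v (Suc i) y) t \<xi>))\<^sup>2 \<le> decay_const v i * (norm \<xi>)\<^sup>2"
proof -
  let ?S = "frame_sphere v (Suc i) y"
  define \<mu> where "\<mu> = frame_sigma v (Suc i) y"
  define A where "A = 1 + real CARD('n) / (rho v i)\<^sup>2"
  define V where "V = (norm (v (Suc i)))\<^sup>2"
  define D where "D = 4 * real CARD('n)"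
  have nn: "A \<ge> 1" "V \<ge> 0" "D \<ge> 0" by (auto simp: A_def V_def D_def)
  have dc: "decay_const v i = A + 4 * pi\<^sup>2 * (V * A + (V + D))"
    by (simp add: decay_const_def A_def V_def D_def Let_def)
  have i': "i < CARD('n)" using i by simp
  have inv: "invariant_prob_on (?S) \<mu>"
    unfolding \<mu>_def by (rule invariant_prob_on_frame_sigma[OF g i'])
  interpret prob_space \<mu> using inv by (rule invariant_prob_on_prob)
  have [measurable_cong]: "sets \<mu> = sets borel" using inv by (rule invariant_prob_on_sets)
  have AES: "AE x in \<mu>. x \<in> ?S"
    using inv compact_imp_closed[OF frame_sphere_compact] by (rule invariant_prob_on_AE)
  define \<kappa> where "\<kappa> = ctr v i y \<bullet> \<xi>"
  define \<eta> where "\<eta> = perp y i \<xi>"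
  define e where "e = sgn \<eta>"
  have \<kappa>: "\<kappa>\<^sup>2 \<le> V * (norm \<xi>)\<^sup>2"
  proof -
    have "\<bar>\<kappa>\<bar> \<le> norm (v (Suc i)) * norm \<xi>"
      unfolding \<kappa>_def by (rule order_trans[OF Cauchy_Schwarz_ineq2]) (intro mult_right_mono norm_ctr_le[OF g], simp)
    then show ?thesis unfolding V_def power_mult_distrib[symmetric] by (simp add: abs_le_square_iff[symmetric])
  qed
  have split: "x \<bullet> \<xi> = \<kappa> + norm \<eta> * (x \<bullet> e)" if "x \<in> ?S" for x
  proof -
    have "x \<bullet> \<xi> = ctr v i y \<bullet> \<xi> + perp y i x \<bullet> \<xi>"
      using arg_cong[OF frame_sphere_decomp(1)[OF g that], of "\<lambda>w. w \<bullet> \<xi>"] by (simp add: inner_add_left)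
    also have "perp y i x \<bullet> \<xi> = norm \<eta> * (x \<bullet> e)"
      by (cases "\<eta> = 0") (simp_all add: perp_adjoint e_def sgn_div_norm \<eta>_def)
    finally show ?thesis by (simp add: \<kappa>_def)
  qed
  define s where "s = 2 * pi * t * norm \<eta>"
  let ?c = "\<lambda>x. cis (- (s * (x \<bullet> e)))"
  define c where "c = cis (- (2 * pi * t * \<kappa>))"
  have c: "cmod c = 1" by (simp add: c_def)
  have ts: "t\<^sup>2 * (norm \<eta>)\<^sup>2 \<le> s\<^sup>2"
  proof -
    have "t * norm \<eta> * 1 \<le> t * norm \<eta> * (2 * pi)"
      using t pi_gt3 by (intro mult_left_mono) auto
    then have "t * norm \<eta> \<le> s" by (simp add: s_def algebra_simps)
    then show ?thesis using t unfolding power_mult_distrib[symmetric] by (intro power_mono) auto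
  qed
  have f: "cis (- (2 * pi * (x \<bullet> (t *\<^sub>R \<xi>)))) = c * ?c x" if "x \<in> ?S" for x
    unfolding c_def cis_mult inner_scaleR_right split[OF that] s_def by (simp add: algebra_simps)
  have F0: "fourier_measure \<mu> (t *\<^sub>R \<xi>) = c * (\<integral>x. ?c x \<partial>\<mu>)"
  proof -
    have "fourier_measure \<mu> (t *\<^sub>R \<xi>) = (\<integral>x. c * ?c x \<partial>\<mu>)"
      unfolding fourier_measure_def
      by (rule integral_cong_AE) (use AES f in auto)
    then show ?thesis by simp
  qed
  have icis: "integrable \<mu> (\<lambda>x. ?c x)"
    by (rule integrable_const_bound[where B=1]) auto
  have ixcis: "integrable \<mu> (\<lambda>x. of_real (x \<bullet> e) * ?c x)"
  proof (rule integrable_const_bound[where B="norm (v (Suc i)) * norm e"])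
    show "AE x in \<mu>. norm (of_real (x \<bullet> e) * ?c x) \<le> norm (v (Suc i)) * norm e"
      using AES
    proof eventually_elim
      case (elim x)
      then have "norm x = norm (v (Suc i))" by (simp add: frame_sphere_def)
      then show ?case using Cauchy_Schwarz_ineq2[of x e] by (simp add: norm_mult)
    qed
  qed auto
  have F1: "dfourier \<mu> t \<xi> = - (\<i> * of_real (2 * pi)) * c * (of_real \<kappa> * (\<integral>x. ?c x \<partial>\<mu>)
      + of_real (norm \<eta>) * (\<integral>x. of_real (x \<bullet> e) * ?c x \<partial>\<mu>))"
  proof -
    have "dfourier \<mu> t \<xi> = (\<integral>x. - (\<i> * of_real (2 * pi)) * c * (of_real \<kappa> * ?c x
      + of_real (norm \<eta>) * (of_real (x \<bullet> e) * ?c x)) \<partial>\<mu>)"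
      unfolding dfourier_def
    proof (rule integral_cong_AE)
      show "AE x in \<mu>. - (\<i> * of_real (2 * pi * (x \<bullet> \<xi>))) * cis (- (2 * pi * (x \<bullet> (t *\<^sub>R \<xi>)))) =
        - (\<i> * of_real (2 * pi)) * c * (of_real \<kappa> * ?c x
        + of_real (norm \<eta>) * (of_real (x \<bullet> e) * ?c x))"
        using AES
      proof eventually_elim
        case (elim x)
        show ?case unfolding f[OF elim] split[OF elim] by (simp add: algebra_simps)
      qed
    qed auto
    also have "\<dots> = - (\<i> * of_real (2 * pi)) * c * (\<integral>x. of_real \<kappa> * ?c x
        + of_real (norm \<eta>) * (of_real (x \<bullet> e) * ?c x) \<partial>\<mu>)"
      by (rule integral_mult_right_zero)
    also have "(\<integral>x. of_real \<kappa> * ?c x + of_real (norm \<eta>) * (of_real (x \<bullet> e) * ?c x) \<partial>\<mu>)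
      = of_real \<kappa> * (\<integral>x. ?c x \<partial>\<mu>) + of_real (norm \<eta>) * (\<integral>x. of_real (x \<bullet> e) * ?c x \<partial>\<mu>)"
      by (subst Bochner_Integration.integral_add)
         (simp_all only: integral_mult_right_zero integrable_mult_right icis ixcis)
    finally show ?thesis .
  qed
  show "(1 + t\<^sup>2 * (norm (perp y i \<xi>))\<^sup>2) * (cmod (fourier_measure (frame_sigma v (Suc i) y) (t *\<^sub>R \<xi>)))\<^sup>2 \<le> decay_const v i"
    and "(1 + t\<^sup>2 * (norm (perp y i \<xi>))\<^sup>2) * (cmod (dfourier (frame_sigma v (Suc i) y) t \<xi>))\<^sup>2 \<le> decay_const v i * (norm \<xi>)\<^sup>2"
  proof -
    \<comment> \<open>These stand for \<phi>(s) and \<phi>'(s). If \<eta> = 0 there is no direction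
      e; then s = 0, and the values 1 and 0 serve.\<close>
    obtain a b :: real where ab: "(\<integral>x. ?c x \<partial>\<mu>) = of_real a"
      "of_real (norm \<eta>) * (\<integral>x. of_real (x \<bullet> e) * ?c x \<partial>\<mu>) = \<i> * of_real (norm \<eta> * b)"
      "(1 + s\<^sup>2) * a\<^sup>2 \<le> A" "(1 + s\<^sup>2) * b\<^sup>2 \<le> V + D"
    proof (cases "\<eta> = 0")
      case True
      have "(\<integral>x. ?c x \<partial>\<mu>) = of_real 1"
        using True by (simp add: s_def prob_space flip: cis_zero)
      then show ?thesis by (rule that[of 1 0]) (use True nn in \<open>auto simp: s_def\<close>)
    next
      case False
      obtain B where B: "frame_measure v y i e B" "CARD('n) \<le> card B + i + 1" "card B \<le> CARD('n)"
        using frame_measure_exists[OF g i' r False[unfolded \<eta>_def]] by (auto simp: e_def \<eta>_def)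
      interpret fm: frame_measure v y i "frame_sigma v (Suc i) y" "?S" "rho v i" e B
        using B(1) by simp_all
      have s0: "0 \<le> s" and N: "2 \<le> card B" using t B i by (auto simp: s_def)
      show ?thesis
      proof (rule that)
        show "(\<integral>x. ?c x \<partial>\<mu>) = of_real (fm.\<phi> s)"
          unfolding \<mu>_def by (rule fm.integral_cis)
        show "of_real (norm \<eta>) * (\<integral>x. of_real (x \<bullet> e) * ?c x \<partial>\<mu>) = \<i> * of_real (norm \<eta> * fm.\<phi>1 s)"
          unfolding \<mu>_def fm.integral_inner_cis by simp
        have "(1 + s\<^sup>2) * (fm.\<phi> s)\<^sup>2 \<le> 1 + real (card B) / (rho v i)\<^sup>2" by (rule fm.phi_decay(1)[OF s0 N])
        also have "\<dots> \<le> A" unfolding A_def using B by (auto intro: divide_right_mono)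
        finally show "(1 + s\<^sup>2) * (fm.\<phi> s)\<^sup>2 \<le> A" .
        have "(1 + s\<^sup>2) * (fm.\<phi>1 s)\<^sup>2 \<le> (rho v i)\<^sup>2 + 4 * real (card B)" by (rule fm.phi_decay(2)[OF s0 N])
        also have "\<dots> \<le> V + D" unfolding V_def D_def using B rho_le[of v i] r by (intro add_mono power_mono) auto
        finally show "(1 + s\<^sup>2) * (fm.\<phi>1 s)\<^sup>2 \<le> V + D" .
      qed
    qed
    define T where "T = 1 + t\<^sup>2 * (norm \<eta>)\<^sup>2"
    have T: "0 \<le> T" "T \<le> 1 + s\<^sup>2" using ts by (auto simp: T_def)
    have Ta: "T * a\<^sup>2 \<le> A" by (rule order_trans[OF mult_right_mono[OF T(2)] ab(3)]) simp
    have Tb: "T * b\<^sup>2 \<le> V + D" by (rule order_trans[OF mult_right_mono[OF T(2)] ab(4)]) simp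
    have "T * (cmod (fourier_measure \<mu> (t *\<^sub>R \<xi>)))\<^sup>2 \<le> A"
      unfolding F0 ab(1) norm_mult c using Ta by simp
    also have "A \<le> decay_const v i" unfolding dc using nn by simp
    finally show "(1 + t\<^sup>2 * (norm (perp y i \<xi>))\<^sup>2) * (cmod (fourier_measure (frame_sigma v (Suc i) y) (t *\<^sub>R \<xi>)))\<^sup>2 \<le> decay_const v i"
      by (simp add: T_def \<eta>_def \<mu>_def)
    \<comment> \<open>Up to a common unimodular factor the two contributions are real and purely
      imaginary, so their squares add without a cross term.\<close>
    have "cmod (dfourier \<mu> t \<xi>) = 2 * pi * cmod (Complex (\<kappa> * a) (norm \<eta> * b))"
      unfolding F1 ab(1,2) norm_mult c
      by (simp add: norm_mult c Complex_eq)
    then have "(cmod (dfourier \<mu> t \<xi>))\<^sup>2 = 4 * pi\<^sup>2 * (\<kappa>\<^sup>2 * a\<^sup>2 + (norm \<eta>)\<^sup>2 * b\<^sup>2)"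
      by (simp add: power_mult_distrib cmod_power2)
    then have "T * (cmod (dfourier \<mu> t \<xi>))\<^sup>2 = 4 * pi\<^sup>2 * (\<kappa>\<^sup>2 * (T * a\<^sup>2) + (norm \<eta>)\<^sup>2 * (T * b\<^sup>2))"
      by (simp add: algebra_simps)
    also have "\<dots> \<le> 4 * pi\<^sup>2 * ((V * (norm \<xi>)\<^sup>2) * A + (norm \<xi>)\<^sup>2 * (V + D))"
      using \<kappa> Ta Tb nn perp_norm_le[of y i \<xi>] mult_nonneg_nonneg[OF T(1) zero_le_power2]
      by (intro mult_left_mono add_mono mult_mono power_mono) (auto simp: \<eta>_def)
    also have "\<dots> \<le> decay_const v i * (norm \<xi>)\<^sup>2"
      unfolding dc using nn by (simp add: algebra_simps)
    finally show "(1 + t\<^sup>2 * (norm (perp y i \<xi>))\<^sup>2) * (cmod (dfourier (frame_sigma v (Suc i) y) t \<xi>))\<^sup>2 \<le> decay_const v i * (norm \<xi>)\<^sup>2"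
      by (simp add: T_def \<eta>_def \<mu>_def)
  qed
qed

lemma decay_const_nonneg: "0 \<le> decay_const v i"
  by (simp add: decay_const_def Let_def)

text \<open>One Gram-Schmidt step shortens the projection to |\<eta>|^2 (1 - (x.e)^2 / \<rho>^2),
  where \<rho> is the radius. The integrand is thus a multiple of the one in
  \<open>integral_inverse_gap\<close>. The hypothesis on the dimension is one stronger than for the
  decay because three directions orthogonal to e are required.\<close>

lemma frame_sigma_average:
  fixes v y :: "nat \<Rightarrow> real^'n"
  assumes g: "gram v i y" and i: "i + 4 \<le> CARD('n)" and r: "rho v i > 0" and \<delta>: "0 < \<delta>"
  shows "(\<integral>\<^sup>+x. ennreal (1 / (\<delta> + (norm (perp (y(Suc i := x)) (Suc i) \<xi>))\<^sup>2)) \<partial>frame_sigma v (Suc i) y)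
    \<le> ennreal (2 / (\<delta> + (norm (perp y i \<xi>))\<^sup>2))"
proof -
  let ?S = "frame_sphere v (Suc i) y"
  define \<mu> where "\<mu> = frame_sigma v (Suc i) y"
  define \<rho> where "\<rho> = rho v i"
  have i': "i < CARD('n)" using i by simp
  have inv: "invariant_prob_on (?S) \<mu>"
    unfolding \<mu>_def by (rule invariant_prob_on_frame_sigma[OF g i'])
  interpret prob_space \<mu> using inv by (rule invariant_prob_on_prob)
  have [measurable_cong]: "sets \<mu> = sets borel" using inv by (rule invariant_prob_on_sets)
  have AES: "AE x in \<mu>. x \<in> ?S"
    using inv compact_imp_closed[OF frame_sphere_compact] by (rule invariant_prob_on_AE)
  define \<eta> where "\<eta> = perp y i \<xi>"
  define e where "e = sgn \<eta>"
  define Q where "Q = (norm \<eta>)\<^sup>2"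
  have \<rho>: "0 < \<rho>" using r by (simp add: \<rho>_def)
  have step: "(norm (perp (y(Suc i := x)) (Suc i) \<xi>))\<^sup>2 = Q * (\<rho>\<^sup>2 - (x \<bullet> e)\<^sup>2) / \<rho>\<^sup>2"
    if x: "x \<in> ?S" for x
  proof -
    define u where "u = perp y i x"
    have pz: "perp (y(Suc i := x)) i w = perp y i w" for w by (rule perp_cong) auto
    have uu: "u \<bullet> u = \<rho>\<^sup>2" using frame_sphere_decomp(2)[OF g x] by (simp add: u_def \<rho>_def power2_norm_eq_inner[symmetric])
    have \<eta>u: "\<eta> \<bullet> u = norm \<eta> * (x \<bullet> e)"
    proof -
      have "\<eta> \<bullet> u = x \<bullet> \<eta>" unfolding \<eta>_def u_def by (simp add: inner_commute[of _ "perp y i x"] perp_inner_perp)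
      also have "x \<bullet> \<eta> = norm \<eta> * (x \<bullet> e)"
        by (cases "\<eta> = 0") (simp_all add: e_def sgn_div_norm)
      finally show ?thesis .
    qed
    have "perp (y(Suc i := x)) (Suc i) \<xi> = \<eta> - ((\<eta> \<bullet> u) / \<rho>\<^sup>2) *\<^sub>R u"
      unfolding perp.simps pz by (simp add: u_def[symmetric] \<eta>_def[symmetric] uu)
    then have "(norm (perp (y(Suc i := x)) (Suc i) \<xi>))\<^sup>2 = (\<eta> - ((\<eta> \<bullet> u) / \<rho>\<^sup>2) *\<^sub>R u) \<bullet> (\<eta> - ((\<eta> \<bullet> u) / \<rho>\<^sup>2) *\<^sub>R u)"
      by (simp add: power2_norm_eq_inner)
    also have "\<dots> = \<eta> \<bullet> \<eta> - (\<eta> \<bullet> u) / \<rho>\<^sup>2 * (\<eta> \<bullet> u) - (\<eta> \<bullet> u) / \<rho>\<^sup>2 * (\<eta> \<bullet> u - (\<eta> \<bullet> u) / \<rho>\<^sup>2 * \<rho>\<^sup>2)"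
      unfolding inner_diff_left inner_diff_right inner_scaleR_left inner_scaleR_right inner_commute[of u \<eta>] uu
      by (simp add: algebra_simps)
    also have "\<dots> = Q - (\<eta> \<bullet> u)\<^sup>2 / \<rho>\<^sup>2"
      using \<rho> by (simp add: Q_def power2_norm_eq_inner power2_eq_square[of "\<eta> \<bullet> u"])
    also have "\<dots> = Q * (\<rho>\<^sup>2 - (x \<bullet> e)\<^sup>2) / \<rho>\<^sup>2"
      unfolding \<eta>u Q_def using \<rho> by (simp add: power_mult_distrib field_simps)
    finally show ?thesis .
  qed
  have "(\<integral>\<^sup>+x. ennreal (1 / (\<delta> + (norm (perp (y(Suc i := x)) (Suc i) \<xi>))\<^sup>2)) \<partial>\<mu>)
      = (\<integral>\<^sup>+x. ennreal (1 / (\<delta> + Q * (\<rho>\<^sup>2 - (x \<bullet> e)\<^sup>2) / \<rho>\<^sup>2)) \<partial>\<mu>)"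
    by (rule nn_integral_cong_AE) (use AES step in auto)
  also have "\<dots> \<le> ennreal (2 / (\<delta> + Q))"
  proof (cases "\<eta> = 0")
    case True
    then show ?thesis using \<delta> by (simp add: Q_def emeasure_space_1 divide_right_mono)
  next
    case False
    obtain B where B: "frame_measure v y i e B" "CARD('n) \<le> card B + i + 1" "card B \<le> CARD('n)"
      using frame_measure_exists[OF g i' r False[unfolded \<eta>_def]] by (auto simp: e_def \<eta>_def)
    interpret fm: frame_measure v y i "frame_sigma v (Suc i) y" "?S" "rho v i" e B
      using B(1) by simp_all
    have Q: "0 < Q" using False by (simp add: Q_def)
    \<comment> \<open>Chosen so that \<delta> + Q (\<rho>^2 - p) / \<rho>^2 equals Q / \<rho>^2
      times \<epsilon> + \<rho>^2 - p.\<close>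
    define \<epsilon> where "\<epsilon> = \<delta> * \<rho>\<^sup>2 / Q"
    let ?g = "\<lambda>x. 1 / (\<epsilon> + \<rho>\<^sup>2 - (x \<bullet> e)\<^sup>2)"
    have \<epsilon>: "0 < \<epsilon>" using \<delta> \<rho> Q by (simp add: \<epsilon>_def)
    have sq: "(x \<bullet> e)\<^sup>2 \<le> \<rho>\<^sup>2" if "x \<in> ?S" for x
      using fm.abs_inner_le_radius(1)[OF that] \<rho> by (simp add: \<rho>_def power2_le_iff_abs_le)
    have rw: "1 / (\<delta> + Q * (\<rho>\<^sup>2 - p) / \<rho>\<^sup>2) = \<rho>\<^sup>2 / Q * (1 / (\<epsilon> + \<rho>\<^sup>2 - p))" if "p \<le> \<rho>\<^sup>2" for p
    proof -
      have "\<delta> + Q * (\<rho>\<^sup>2 - p) / \<rho>\<^sup>2 = Q / \<rho>\<^sup>2 * (\<epsilon> + \<rho>\<^sup>2 - p)"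
        using Q \<rho> by (simp add: \<epsilon>_def field_simps)
      then show ?thesis by simp
    qed
    have int: "integrable \<mu> (\<lambda>x. ?g x)"
      unfolding \<mu>_def
    proof (rule fm.integrable_S[where K="1/\<epsilon>"])
      show "norm (?g x) \<le> 1 / \<epsilon>" if "x \<in> ?S" for x
        using sq[OF that] \<epsilon> by (simp add: frac_le abs_of_pos)
    qed auto
    have "(\<integral>\<^sup>+x. ennreal (1 / (\<delta> + Q * (\<rho>\<^sup>2 - (x \<bullet> e)\<^sup>2) / \<rho>\<^sup>2)) \<partial>\<mu>)
      = (\<integral>\<^sup>+x. ennreal (\<rho>\<^sup>2 / Q * (?g x)) \<partial>\<mu>)"
      by (rule nn_integral_cong_AE) (use AES rw sq in auto)
    also have "\<dots> = ennreal (\<integral>x. \<rho>\<^sup>2 / Q * (?g x) \<partial>\<mu>)"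
    proof (rule nn_integral_eq_integral[OF integrable_mult_right[OF int]])
      show "AE x in \<mu>. 0 \<le> \<rho>\<^sup>2 / Q * (?g x)"
        using AES
      proof eventually_elim
        case (elim x)
        then show ?case using sq[OF elim] Q \<epsilon> by simp
      qed
    qed
    also have "(\<integral>x. \<rho>\<^sup>2 / Q * (?g x) \<partial>\<mu>) = \<rho>\<^sup>2 / Q * (\<integral>x. ?g x \<partial>\<mu>)"
      by (rule integral_mult_right_zero)
    also have "\<dots> \<le> \<rho>\<^sup>2 / Q * (2 / (\<rho>\<^sup>2 + \<epsilon>))"
      using fm.integral_inverse_gap[OF \<epsilon>] B i Q by (intro mult_left_mono) (auto simp: \<mu>_def \<rho>_def)
    also have "\<rho>\<^sup>2 / Q * (2 / (\<rho>\<^sup>2 + \<epsilon>)) = 2 / (\<delta> + Q)"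
    proof -
      have "\<rho>\<^sup>2 + \<epsilon> = \<rho>\<^sup>2 / Q * (\<delta> + Q)" using Q by (simp add: \<epsilon>_def field_simps)
      then show ?thesis using Q \<rho> by simp
    qed
    finally show ?thesis by (simp add: ennreal_leI)
  qed
  finally show ?thesis by (simp add: \<mu>_def Q_def \<eta>_def)
qed

text \<open>A zero residual would place \<open>v (Suc i)\<close> in the span of its predecessors.
  Injectivity ensures that these remain when this vector is removed from the image set, so
  independence is contradicted.\<close>

lemma rho_pos:
  assumes ind: "independent (v ` {1..k})" and inj: "inj_on v {1..k}" and i: "i < k"
  shows "0 < rho v i"
proof (rule ccontr)
  assume "\<not> 0 < rho v i"
  then have "perp v i (v (Suc i)) = 0" by (simp add: rho_def)
  then have "v (Suc i) \<in> span (v ` {1..i})" using perp_span[of "v (Suc i)" v i] by simp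
  moreover have "v ` {1..i} \<subseteq> v ` {1..k} - {v (Suc i)}"
  proof -
    have "v l \<noteq> v (Suc i)" if "l \<in> {1..i}" for l
      using inj_onD[OF inj, of l "Suc i"] that i by auto
    then show ?thesis using i by auto
  qed
  ultimately have "v (Suc i) \<in> span (v ` {1..k} - {v (Suc i)})" using span_mono by blast
  moreover have "v (Suc i) \<in> v ` {1..k}" using i by auto
  ultimately show False using ind unfolding dependent_def by blast
qed

section \<open>Integration over frames\<close>

text \<open>The proof goes through simple functions below \<open>h\<close>, because the integrands of \<open>frame_int\<close>
  are not known to be measurable.\<close>
lemma nn_integral_power2_le:
  assumes "prob_space M"
  shows "(\<integral>\<^sup>+x. h x \<partial>M)\<^sup>2 \<le> (\<integral>\<^sup>+x. (h x)\<^sup>2 \<partial>M)"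
proof -
  interpret prob_space M by fact
  let ?A = "{g. simple_function M g \<and> g \<le> h}"
  have sq: "(integral\<^sup>S M g)\<^sup>2 \<le> (\<integral>\<^sup>+x. (h x)\<^sup>2 \<partial>M)" if "g \<in> ?A" for g
  proof -
    have [measurable]: "g \<in> borel_measurable M" using that by (auto intro: borel_measurable_simple_function)
    have "(integral\<^sup>S M g)\<^sup>2 = (\<integral>\<^sup>+x. g x * 1 \<partial>M)\<^sup>2"
      using that by (simp add: nn_integral_eq_simple_integral)
    also have "\<dots> \<le> (\<integral>\<^sup>+x. (g x)\<^sup>2 \<partial>M) * (\<integral>\<^sup>+x. 1\<^sup>2 \<partial>M)"
      by (rule Cauchy_Schwarz_nn_integral) auto
    also have "\<dots> = (\<integral>\<^sup>+x. (g x)\<^sup>2 \<partial>M)" by (simp add: emeasure_space_1)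
    also have "\<dots> \<le> (\<integral>\<^sup>+x. (h x)\<^sup>2 \<partial>M)"
      using that by (intro nn_integral_mono power_mono) (auto simp: le_fun_def)
    finally show ?thesis .
  qed
  \<comment> \<open>The square of a supremum becomes a double supremum, in which each product is at
    most the larger of the two squares.\<close>
  have "(SUP g\<in>?A. integral\<^sup>S M g) * (SUP g\<in>?A. integral\<^sup>S M g) = (SUP g'\<in>?A. SUP g\<in>?A. integral\<^sup>S M g * integral\<^sup>S M g')"
    by (simp add: SUP_mult_left_ennreal SUP_mult_right_ennreal)
  also have "\<dots> \<le> (\<integral>\<^sup>+x. (h x)\<^sup>2 \<partial>M)"
  proof (intro SUP_least)
    fix g g' assume "g \<in> ?A" "g' \<in> ?A"
    then have "(max (integral\<^sup>S M g) (integral\<^sup>S M g'))\<^sup>2 \<le> (\<integral>\<^sup>+x. (h x)\<^sup>2 \<partial>M)"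
      using sq by (auto simp: max_def)
    moreover have "integral\<^sup>S M g * integral\<^sup>S M g' \<le> (max (integral\<^sup>S M g) (integral\<^sup>S M g'))\<^sup>2"
      unfolding power2_eq_square by (intro mult_mono) auto
    ultimately show "integral\<^sup>S M g * integral\<^sup>S M g' \<le> (\<integral>\<^sup>+x. (h x)\<^sup>2 \<partial>M)" by simp
  qed
  finally show ?thesis unfolding nn_integral_def power2_eq_square .
qed

lemma AE_frame_sigma_gram:
  fixes v y :: "nat \<Rightarrow> real^'n"
  assumes g: "gram v i y" and i: "i < CARD('n)"
  shows "AE z in frame_sigma v (Suc i) y. gram v (Suc i) (y(Suc i := z))"
  using invariant_prob_on_AE[OF invariant_prob_on_frame_sigma[OF assms] compact_imp_closed[OF frame_sphere_compact]]
  by eventually_elim (simp add: frame_sphere_iff_gram[OF g])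

text \<open>Almost every vector drawn keeps the frame admissible, so comparing the integrands on
  admissible frames suffices. Monotonicity of the nonnegative integral asks for no
  measurability.\<close>

lemma frame_int_mono_gram:
  fixes v y :: "nat \<Rightarrow> real^'n"
  assumes "gram v i y" "i + r \<le> CARD('n)" "\<And>y'. gram v (i + r) y' \<Longrightarrow> F y' \<le> G y'"
  shows "frame_int v r (Suc i) y F \<le> frame_int v r (Suc i) y G"
  using assms
proof (induction r arbitrary: i y)
  case (Suc r)
  have "AE z in frame_sigma v (Suc i) y. frame_int v r (Suc (Suc i)) (y(Suc i := z)) F \<le> frame_int v r (Suc (Suc i)) (y(Suc i := z)) G"
    using AE_frame_sigma_gram[OF Suc.prems(1)] Suc.prems by (auto intro!: Suc.IH)
  then show ?case by (auto intro!: nn_integral_mono_AE)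
qed simp

text \<open>Cauchy-Schwarz at every level, each measure being a probability measure.\<close>

lemma frame_int_power2_le:
  fixes v y :: "nat \<Rightarrow> real^'n"
  assumes "gram v i y" "i + r \<le> CARD('n)"
  shows "(frame_int v r (Suc i) y F)\<^sup>2 \<le> frame_int v r (Suc i) y (\<lambda>y. (F y)\<^sup>2)"
  using assms
proof (induction r arbitrary: i y)
  case (Suc r)
  have i: "i < CARD('n)" using Suc.prems by simp
  have "prob_space (frame_sigma v (Suc i) y)"
    by (rule invariant_prob_on_prob[OF invariant_prob_on_frame_sigma[OF Suc.prems(1) i]])
  then have "(frame_int v (Suc r) (Suc i) y F)\<^sup>2 \<le> (\<integral>\<^sup>+z. (frame_int v r (Suc (Suc i)) (y(Suc i := z)) F)\<^sup>2 \<partial>frame_sigma v (Suc i) y)"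
    by (simp add: nn_integral_power2_le)
  also have "\<dots> \<le> frame_int v (Suc r) (Suc i) y (\<lambda>y. (F y)\<^sup>2)"
    unfolding frame_int.simps
  proof (rule nn_integral_mono_AE)
    show "AE z in frame_sigma v (Suc i) y. (frame_int v r (Suc (Suc i)) (y(Suc i := z)) F)\<^sup>2 \<le> frame_int v r (Suc (Suc i)) (y(Suc i := z)) (\<lambda>y. (F y)\<^sup>2)"
      using AE_frame_sigma_gram[OF Suc.prems(1) i] Suc.prems by (auto intro!: Suc.IH)
  qed
  finally show ?case .
qed simp

text \<open>The measures \<open>frame_sigma\<close> are unspecified off admissible frames. Replacing them by the
  images of \<open>ball_measure\<close> makes the iterated integral measurable in all parameters, so that Tonelli applies.\<close>
fun ball_frame_int :: "(nat \<Rightarrow> real^'n) \<Rightarrow> nat \<Rightarrow> nat \<Rightarrow> (nat \<Rightarrow> real^'n) \<Rightarrow> ((nat \<Rightarrow> real^'n) \<Rightarrow> ennreal) \<Rightarrow> ennreal" where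
  "ball_frame_int v 0 i y F = F y"
| "ball_frame_int v (Suc r) i y F = (\<integral>\<^sup>+g. ball_frame_int v r (Suc i) (y(Suc i := Phi v i y g)) F \<partial>ball_measure)"

lemma sigma_finite_ball_measure: "sigma_finite_measure ball_measure"
  using prob_space_ball_measure by (intro prob_space_imp_sigma_finite)

text \<open>The frame is carried as a variable beside the parameter, so that the induction can
  substitute the frame extended by \<open>Phi\<close>. Joint measurability in both is what the
  exchange of integrals needs.\<close>

lemma measurable_ball_frame_int_pair:
  assumes "(\<lambda>p. F (fst p) (snd p)) \<in> borel_measurable (M \<Otimes>\<^sub>M borel)"
  shows "(\<lambda>p. ball_frame_int v r i (snd p) (F (fst p))) \<in> borel_measurable (M \<Otimes>\<^sub>M borel)"
proof (induction r arbitrary: i)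
  case (Suc r)
  have m: "(\<lambda>q. (fst (fst q), (snd (fst q))(Suc i := Phi v i (snd (fst q)) (snd q)))) \<in> (M \<Otimes>\<^sub>M borel) \<Otimes>\<^sub>M ball_measure \<rightarrow>\<^sub>M M \<Otimes>\<^sub>M borel"
    by measurable
  show ?case
    unfolding ball_frame_int.simps
    by (rule sigma_finite_measure.borel_measurable_nn_integral[OF sigma_finite_ball_measure])
       (use measurable_compose[OF m Suc.IH[of "Suc i"]] in \<open>simp only: case_prod_unfold fst_conv snd_conv\<close>)
qed (use assms in simp)

lemma measurable_ball_frame_int:
  assumes "F \<in> borel_measurable borel"
  shows "(\<lambda>y. ball_frame_int v r i y F) \<in> borel_measurable borel"
proof -
  \<comment> \<open>The parameter space is a dummy: F does not depend on it, and the real number 0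
    is inserted at the end.\<close>
  have "(\<lambda>p. ball_frame_int v r i (snd p) ((\<lambda>_. F) (fst p))) \<in> borel_measurable ((borel :: real measure) \<Otimes>\<^sub>M borel)"
    by (rule measurable_ball_frame_int_pair) (rule measurable_compose[OF measurable_snd assms])
  from measurable_compose[OF measurable_Pair1'[of 0 "borel :: real measure" borel] this] show ?thesis by simp
qed

lemma measurable_ball_frame_int_step:
  assumes "F \<in> borel_measurable borel"
  shows "(\<lambda>g. ball_frame_int v r (Suc i) (y(Suc i := Phi v i y g)) F) \<in> borel_measurable ball_measure"
proof -
  have "(\<lambda>g. y(Suc i := Phi v i y g)) \<in> ball_measure \<rightarrow>\<^sub>M borel" by measurable
  from measurable_compose[OF this measurable_ball_frame_int[OF assms]] show ?thesis .
qed

text \<open>The index shift is intended: \<open>ball_frame_int\<close> counts the vectors already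
  fixed, whereas \<open>frame_int\<close> names the next one to be integrated.\<close>

lemma frame_int_eq_ball_frame_int:
  fixes v y :: "nat \<Rightarrow> real^'n"
  assumes F: "F \<in> borel_measurable borel" and "gram v i y" "i + r \<le> CARD('n)"
  shows "frame_int v r (Suc i) y F = ball_frame_int v r i y F"
  using assms(2,3)
proof (induction r arbitrary: i y)
  case (Suc r)
  have i: "i < CARD('n)" using Suc.prems by simp
  have m: "(\<lambda>z. y(Suc i := z)) \<in> borel \<rightarrow>\<^sub>M borel" by measurable
  have "frame_int v (Suc r) (Suc i) y F = (\<integral>\<^sup>+z. ball_frame_int v r (Suc i) (y(Suc i := z)) F \<partial>frame_sigma v (Suc i) y)"
    unfolding frame_int.simps
  proof (rule nn_integral_cong_AE)
    show "AE z in frame_sigma v (Suc i) y. frame_int v r (Suc (Suc i)) (y(Suc i := z)) F = ball_frame_int v r (Suc i) (y(Suc i := z)) F"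
      using AE_frame_sigma_gram[OF Suc.prems(1) i]
    proof eventually_elim
      case (elim z)
      show ?case by (rule Suc.IH[OF elim]) (use Suc.prems in simp)
    qed
  qed
  also have "\<dots> = ball_frame_int v (Suc r) i y F"
    unfolding frame_sigma_eq_distr[OF Suc.prems(1) i] ball_frame_int.simps
    by (rule nn_integral_distr[OF measurable_Phi_ball_measure])
       (simp only: measurable_distr_eq1 measurable_compose[OF m measurable_ball_frame_int[OF F]])
  finally show ?case .
qed simp

lemma ball_frame_int_swap:
  assumes M: "sigma_finite_measure M"
    and H: "(\<lambda>p. H (fst p) (snd p)) \<in> borel_measurable (M \<Otimes>\<^sub>M borel)"
  shows "ball_frame_int v r i y (\<lambda>y. \<integral>\<^sup>+x. H x y \<partial>M) = (\<integral>\<^sup>+x. ball_frame_int v r i y (H x) \<partial>M)"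
proof (induction r arbitrary: i y)
  case (Suc r)
  interpret u: sigma_finite_measure ball_measure by (rule sigma_finite_ball_measure)
  interpret M: sigma_finite_measure M by fact
  interpret pair_sigma_finite M ball_measure ..
  have m: "(\<lambda>q. (fst q, y(Suc i := Phi v i y (snd q)))) \<in> M \<Otimes>\<^sub>M ball_measure \<rightarrow>\<^sub>M M \<Otimes>\<^sub>M borel" by measurable
  have "ball_frame_int v (Suc r) i y (\<lambda>y. \<integral>\<^sup>+x. H x y \<partial>M) = (\<integral>\<^sup>+g. (\<integral>\<^sup>+x. ball_frame_int v r (Suc i) (y(Suc i := Phi v i y g)) (H x) \<partial>M) \<partial>ball_measure)"
    by (simp only: ball_frame_int.simps Suc.IH)
  also have "\<dots> = (\<integral>\<^sup>+x. (\<integral>\<^sup>+g. ball_frame_int v r (Suc i) (y(Suc i := Phi v i y g)) (H x) \<partial>ball_measure) \<partial>M)"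
    using measurable_compose[OF m measurable_ball_frame_int_pair[OF H, of v r "Suc i"]]
    by (intro Fubini') (simp only: case_prod_unfold fst_conv snd_conv)
  finally show ?case by (simp only: ball_frame_int.simps)
qed simp

lemma ball_frame_int_add:
  assumes F: "F \<in> borel_measurable borel" "G \<in> borel_measurable borel"
  shows "ball_frame_int v r i y (\<lambda>y. F y + G y) = ball_frame_int v r i y F + ball_frame_int v r i y G"
proof (induction r arbitrary: i y)
  case (Suc r)
  show ?case unfolding ball_frame_int.simps Suc.IH
    by (rule nn_integral_add) (rule measurable_ball_frame_int_step, rule F)+
qed simp

lemma ball_frame_int_cmult:
  assumes F: "F \<in> borel_measurable borel"
  shows "ball_frame_int v r i y (\<lambda>y. c * F y) = c * ball_frame_int v r i y F"
proof (induction r arbitrary: i y)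
  case (Suc r)
  show ?case unfolding ball_frame_int.simps Suc.IH
    by (rule nn_integral_cmult) (rule measurable_ball_frame_int_step, rule F)
qed simp

text \<open>Each integration frees one vector and costs a factor 2. Started from the empty frame,
  the recursion ends at \<open>perp y 0\<close>, the identity, so the full norm of \<xi>
  appears.\<close>

lemma frame_int_average:
  fixes v y :: "nat \<Rightarrow> real^'n"
  assumes "gram v i y" "i + r + 3 \<le> CARD('n)" "\<And>l. l < i + r \<Longrightarrow> 0 < rho v l" and \<delta>: "0 < \<delta>"
  shows "frame_int v r (Suc i) y (\<lambda>y. ennreal (1 / (\<delta> + (norm (perp y (i + r) \<xi>))\<^sup>2)))
    \<le> ennreal (2 ^ r / (\<delta> + (norm (perp y i \<xi>))\<^sup>2))"
  using assms(1-3)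
proof (induction r arbitrary: i y)
  case (Suc r)
  have i: "i < CARD('n)" using Suc.prems by simp
  let ?\<sigma> = "frame_sigma v (Suc i) y"
  have [measurable_cong]: "sets ?\<sigma> = sets borel"
    by (rule invariant_prob_on_sets[OF invariant_prob_on_frame_sigma[OF Suc.prems(1) i]])
  have "frame_int v (Suc r) (Suc i) y (\<lambda>y. ennreal (1 / (\<delta> + (norm (perp y (i + Suc r) \<xi>))\<^sup>2)))
    \<le> (\<integral>\<^sup>+z. ennreal (2 ^ r) * ennreal (1 / (\<delta> + (norm (perp (y(Suc i := z)) (Suc i) \<xi>))\<^sup>2)) \<partial>?\<sigma>)"
    unfolding frame_int.simps
  proof (rule nn_integral_mono_AE)
    show "AE z in ?\<sigma>. frame_int v r (Suc (Suc i)) (y(Suc i := z)) (\<lambda>y. ennreal (1 / (\<delta> + (norm (perp y (i + Suc r) \<xi>))\<^sup>2)))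
       \<le> ennreal (2 ^ r) * ennreal (1 / (\<delta> + (norm (perp (y(Suc i := z)) (Suc i) \<xi>))\<^sup>2))"
      using AE_frame_sigma_gram[OF Suc.prems(1) i]
    proof eventually_elim
      case (elim z)
      have "frame_int v r (Suc (Suc i)) (y(Suc i := z)) (\<lambda>y. ennreal (1 / (\<delta> + (norm (perp y (Suc i + r) \<xi>))\<^sup>2)))
        \<le> ennreal (2 ^ r / (\<delta> + (norm (perp (y(Suc i := z)) (Suc i) \<xi>))\<^sup>2))"
        by (rule Suc.IH[OF elim]) (use Suc.prems in auto)
      also have "\<dots> = ennreal (2 ^ r) * ennreal (1 / (\<delta> + (norm (perp (y(Suc i := z)) (Suc i) \<xi>))\<^sup>2))"
        by (subst ennreal_mult[symmetric]) (use \<delta> in auto)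
      finally show ?case by simp
    qed
  qed
  also have "\<dots> = ennreal (2 ^ r) * (\<integral>\<^sup>+z. ennreal (1 / (\<delta> + (norm (perp (y(Suc i := z)) (Suc i) \<xi>))\<^sup>2)) \<partial>?\<sigma>)"
    by (rule nn_integral_cmult) (simp del: perp.simps)
  also have "\<dots> \<le> ennreal (2 ^ r) * ennreal (2 / (\<delta> + (norm (perp y i \<xi>))\<^sup>2))"
    using Suc.prems by (intro mult_left_mono frame_sigma_average \<delta>) auto
  also have "\<dots> = ennreal (2 ^ Suc r / (\<delta> + (norm (perp y i \<xi>))\<^sup>2))"
    by (subst ennreal_mult[symmetric]) (use \<delta> in auto)
  finally show ?case .
qed simp

section \<open>Plancherel inequality and Schwartz functions\<close>

lemma
  fixes g :: "'a::euclidean_space \<Rightarrow> real \<Rightarrow> 'b::{real_normed_field, banach, second_countable_topology}"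
  assumes g: "\<And>b. b \<in> Basis \<Longrightarrow> integrable lborel (g b)"
  shows integrable_lborel_prod: "integrable lborel (\<lambda>x. \<Prod>b\<in>Basis. g b (x \<bullet> b))"
    and integral_lborel_prod: "(\<integral>x. (\<Prod>b\<in>Basis. g b (x \<bullet> b)) \<partial>lborel) = (\<Prod>b\<in>Basis. \<integral>t. g b t \<partial>lborel)"
proof -
  interpret product_sigma_finite "\<lambda>_::'a. lborel :: real measure" ..
  have [measurable]: "\<And>b. b \<in> Basis \<Longrightarrow> g b \<in> borel_measurable borel"
    using g by (auto dest: borel_measurable_integrable)
  have eq: "(\<Prod>b\<in>Basis. g b ((\<Sum>c\<in>Basis. f c *\<^sub>R c) \<bullet> b)) = (\<Prod>b\<in>Basis. g b (f b))" for f :: "'a \<Rightarrow> real"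
    by (intro prod.cong refl) simp
  have m: "(\<lambda>x::'a. \<Prod>b\<in>Basis. g b (x \<bullet> b)) \<in> borel_measurable borel" by measurable
  have T: "(\<lambda>f. \<Sum>b\<in>Basis. f b *\<^sub>R b) \<in> (\<Pi>\<^sub>M b\<in>(Basis::'a set). (lborel::real measure)) \<rightarrow>\<^sub>M (borel::'a measure)"
    by measurable
  show "integrable lborel (\<lambda>x. \<Prod>b\<in>Basis. g b (x \<bullet> b))"
    by (subst lborel_eq, subst integrable_distr_eq[OF T m], subst eq)
       (rule product_integrable_prod[OF finite_Basis g])
  show "(\<integral>x. (\<Prod>b\<in>Basis. g b (x \<bullet> b)) \<partial>lborel) = (\<Prod>b\<in>Basis. \<integral>t. g b t \<partial>lborel)"
    by (subst lborel_eq, subst integral_distr[OF T m], subst eq)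
       (rule product_integral_prod[OF finite_Basis g])
qed

section \<open>Gaussian regularization and the Plancherel inequality\<close>

definition gauss_weight :: "real \<Rightarrow> 'a::euclidean_space \<Rightarrow> real" where
  "gauss_weight \<epsilon> x = (\<Prod>b\<in>Basis. exp (- (\<epsilon> * (x \<bullet> b))\<^sup>2 / 2))"

text \<open>The Fourier transform of \<open>gauss_weight\<close>. Both are products over
  coordinates, which reduces their integrals to dimension one, and this one is a probability
  density.\<close>

definition gauss_kernel :: "real \<Rightarrow> 'a::euclidean_space \<Rightarrow> real" where
  "gauss_kernel \<epsilon> x = (\<Prod>b\<in>Basis. normal_density 0 (\<epsilon> / (2 * pi)) (x \<bullet> b))"

lemma gauss_1d_integrable:
  assumes "\<epsilon> > 0"
  shows "integrable lborel (\<lambda>x. complex_of_real (exp (- (\<epsilon> * x)\<^sup>2 / 2)) * cis (t * x))"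
proof -
  have "integrable lborel (\<lambda>x. sqrt (2 * pi * (1 / \<epsilon>)\<^sup>2) * normal_density 0 (1 / \<epsilon>) x)"
    using assms by (intro integrable_mult_right integrable_normal_density) auto
  also have "(\<lambda>x. sqrt (2 * pi * (1 / \<epsilon>)\<^sup>2) * normal_density 0 (1 / \<epsilon>) x) = (\<lambda>x. exp (- (\<epsilon> * x)\<^sup>2 / 2))"
    using assms by (auto simp: normal_density_def field_simps power2_eq_square)
  finally have "integrable lborel (\<lambda>x. exp (- (\<epsilon> * x)\<^sup>2 / 2))" .
  then show ?thesis
    by (rule Bochner_Integration.integrable_bound) (auto simp: norm_mult)
qed

text \<open>The characteristic function of the standard normal law at s = 2 pi u / \<epsilon>, after
  the substitution of \<epsilon> x for x.\<close>

lemma gauss_1d_fourier: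
  assumes eps: "\<epsilon> > 0"
  shows "(\<integral>x. complex_of_real (exp (- (\<epsilon> * x)\<^sup>2 / 2)) * cis (2 * pi * u * x) \<partial>lborel)
     = complex_of_real (normal_density 0 (\<epsilon> / (2 * pi)) u)"
proof -
  let ?g = "\<lambda>x. complex_of_real (exp (- (\<epsilon> * x)\<^sup>2 / 2)) * cis (2 * pi * u * x)"
  define s where "s = 2 * pi * u / \<epsilon>"
  let ?n = "\<lambda>x. complex_of_real (exp (- x\<^sup>2 / 2)) * cis (s * x)"
  have "char std_normal_distribution s = complex_of_real (exp (- (s\<^sup>2) / 2))"
    using char_std_normal_distribution by (simp add: fun_eq_iff)
  moreover have "char std_normal_distribution s = (\<integral>x. std_normal_density x *\<^sub>R iexp (s * x) \<partial>lborel)"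
    unfolding char_def by (subst integral_density) (auto simp: normal_density_nonneg)
  moreover have "(\<integral>x. std_normal_density x *\<^sub>R iexp (s * x) \<partial>lborel) = (\<integral>x. complex_of_real (1 / sqrt (2 * pi)) * (?n x) \<partial>lborel)"
    by (intro Bochner_Integration.integral_cong refl) (simp add: std_normal_density_def cis_conv_exp scaleR_conv_of_real)
  moreover have "\<dots> = complex_of_real (1 / sqrt (2 * pi)) * (\<integral>x. ?n x \<partial>lborel)"
    by (rule integral_mult_right_zero)
  moreover have "(\<integral>x. ?n x \<partial>lborel)
     = \<bar>\<epsilon>\<bar> *\<^sub>R (\<integral>x. ?n (0 + \<epsilon> * x) \<partial>lborel)"
    using eps by (intro lborel_integral_real_affine) auto
  moreover have "(\<integral>x. ?n (0 + \<epsilon> * x) \<partial>lborel)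
     = (\<integral>x. ?g x \<partial>lborel)"
    using eps by (simp add: s_def mult.assoc)
  ultimately have "complex_of_real (1 / sqrt (2 * pi)) * (complex_of_real \<epsilon> * (\<integral>x. ?g x \<partial>lborel))
     = complex_of_real (exp (- (s\<^sup>2) / 2))"
    using eps by (simp add: scaleR_conv_of_real)
  then have "(\<integral>x. ?g x \<partial>lborel)
     = complex_of_real (sqrt (2 * pi) / \<epsilon> * exp (- (s\<^sup>2) / 2))"
    using eps by (simp add: field_simps)
  also have "sqrt (2 * pi) / \<epsilon> * exp (- (s\<^sup>2) / 2) = normal_density 0 (\<epsilon> / (2 * pi)) u"
  proof -
    define X where "X = sqrt (2 * pi)"
    have X: "0 < X" "X * X = 2 * pi" by (auto simp: X_def)
    have "sqrt (2 * pi * (\<epsilon> / (2 * pi))\<^sup>2) = X * (\<epsilon> / (2 * pi))"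
      using eps by (simp add: X_def real_sqrt_mult)
    also have "\<dots> = X * (\<epsilon> / (X * X))" by (simp only: X(2))
    also have "\<dots> = \<epsilon> / X" using X(1) by simp
    finally have "1 / sqrt (2 * pi * (\<epsilon> / (2 * pi))\<^sup>2) = sqrt (2 * pi) / \<epsilon>"
      by (simp add: X_def)
    moreover have "- (u - 0)\<^sup>2 / (2 * (\<epsilon> / (2 * pi))\<^sup>2) = - (s\<^sup>2) / 2"
      using eps by (simp add: s_def power2_eq_square field_simps)
    ultimately show ?thesis unfolding normal_density_def by simp
  qed
  finally show ?thesis .
qed

lemma gauss_weight_bounds: "0 \<le> gauss_weight \<epsilon> x" "gauss_weight \<epsilon> x \<le> 1"
  unfolding gauss_weight_def by (auto intro!: prod_nonneg prod_le_1)

lemma gauss_kernel_nonneg: "0 \<le> gauss_kernel \<epsilon> x"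
  unfolding gauss_kernel_def by (auto intro!: prod_nonneg normal_density_nonneg)

lemma borel_measurable_gauss[measurable]:
  "gauss_weight \<epsilon> \<in> borel_measurable borel" "gauss_kernel \<epsilon> \<in> borel_measurable borel"
  unfolding gauss_weight_def[abs_def] gauss_kernel_def[abs_def] by measurable

lemma gauss_weight_integrable:
  assumes "\<epsilon> > 0"
  shows "integrable lborel (gauss_weight \<epsilon> :: 'a::euclidean_space \<Rightarrow> real)"
proof -
  have "integrable lborel (\<lambda>x. exp (- (\<epsilon> * x)\<^sup>2 / 2))"
    using integrable_norm[OF gauss_1d_integrable[OF assms, of 0]] by (simp add: norm_mult)
  then show ?thesis unfolding gauss_weight_def[abs_def] by (rule integrable_lborel_prod)
qed

lemma gauss_weight_fourier:
  fixes \<zeta> :: "'a::euclidean_space"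
  assumes "\<epsilon> > 0"
  shows "(\<integral>x. complex_of_real (gauss_weight \<epsilon> x) * cis (2 * pi * (x \<bullet> \<zeta>)) \<partial>lborel) = complex_of_real (gauss_kernel \<epsilon> \<zeta>)"
proof -
  have "cis (2 * pi * (x \<bullet> \<zeta>)) = (\<Prod>b\<in>Basis. cis (2 * pi * (\<zeta> \<bullet> b) * (x \<bullet> b)))" for x :: 'a
  proof -
    have "2 * pi * (x \<bullet> \<zeta>) = (\<Sum>b\<in>Basis. 2 * pi * (\<zeta> \<bullet> b) * (x \<bullet> b))"
      by (simp add: euclidean_inner[of x \<zeta>] sum_distrib_left mult_ac)
    then show ?thesis by (simp add: cis_conv_exp exp_sum sum_distrib_left)
  qed
  then have "(\<integral>x. complex_of_real (gauss_weight \<epsilon> x) * cis (2 * pi * (x \<bullet> \<zeta>)) \<partial>lborel)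
    = (\<integral>x. (\<Prod>b\<in>Basis. complex_of_real (exp (- (\<epsilon> * (x \<bullet> b))\<^sup>2 / 2)) * cis (2 * pi * (\<zeta> \<bullet> b) * (x \<bullet> b))) \<partial>lborel)"
    by (simp add: gauss_weight_def prod.distrib)
  also have "\<dots> = (\<Prod>b\<in>Basis. \<integral>t. complex_of_real (exp (- (\<epsilon> * t)\<^sup>2 / 2)) * cis (2 * pi * (\<zeta> \<bullet> b) * t) \<partial>lborel)"
    by (rule integral_lborel_prod) (rule gauss_1d_integrable[OF assms])
  also have "\<dots> = complex_of_real (gauss_kernel \<epsilon> \<zeta>)"
    unfolding gauss_1d_fourier[OF assms] gauss_kernel_def by simp
  finally show ?thesis .
qed

lemma gauss_kernel_nn_integral:
  assumes "\<epsilon> > 0"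
  shows "(\<integral>\<^sup>+x. ennreal (gauss_kernel \<epsilon> (x::'a::euclidean_space)) \<partial>lborel) = 1"
proof -
  have "(\<integral>\<^sup>+x. ennreal (gauss_kernel \<epsilon> (x::'a)) \<partial>lborel) = (\<integral>\<^sup>+x. (\<Prod>b\<in>Basis. ennreal (normal_density 0 (\<epsilon> / (2 * pi)) ((x::'a) \<bullet> b))) \<partial>lborel)"
    unfolding gauss_kernel_def by (simp add: prod_ennreal)
  also have "\<dots> = (\<Prod>b\<in>(Basis::'a set). \<integral>\<^sup>+t. ennreal (normal_density 0 (\<epsilon> / (2 * pi)) t) \<partial>lborel)"
    by (rule nn_integral_lborel_prod) auto
  also have "(\<integral>\<^sup>+t. ennreal (normal_density 0 (\<epsilon> / (2 * pi)) t) \<partial>lborel) = 1"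
  proof -
    have "(\<integral>\<^sup>+t. ennreal (normal_density 0 (\<epsilon> / (2 * pi)) t) \<partial>lborel) = ennreal (\<integral>t. normal_density 0 (\<epsilon> / (2 * pi)) t \<partial>lborel)"
      using assms by (intro nn_integral_eq_integral integrable_normal_density) auto
    then show ?thesis using assms by simp
  qed
  finally show ?thesis by simp
qed

lemma gauss_kernel_translate:
  fixes \<xi> :: "'a::euclidean_space"
  assumes "\<epsilon> > 0"
  shows "(\<integral>\<^sup>+\<eta>. ennreal (gauss_kernel \<epsilon> (\<eta> - \<xi>)) \<partial>lborel) = 1"
proof -
  have "1 = (\<integral>\<^sup>+x. ennreal (gauss_kernel \<epsilon> (x::'a)) \<partial>distr lborel borel ((+) (- \<xi>)))"
    unfolding lborel_distr_plus using gauss_kernel_nn_integral[OF assms] by simp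
  also have "\<dots> = (\<integral>\<^sup>+x. ennreal (gauss_kernel \<epsilon> (- \<xi> + x)) \<partial>lborel)"
    by (rule nn_integral_distr) auto
  finally show ?thesis by (simp add: algebra_simps)
qed

lemma gauss_kernel_even: "gauss_kernel \<epsilon> (- x) = gauss_kernel \<epsilon> x"
  unfolding gauss_kernel_def by (intro prod.cong refl) (simp add: normal_density_def)

lemma ennreal_norm_integral_le:
  fixes f :: "'a \<Rightarrow> 'b::{banach, second_countable_topology}"
  shows "ennreal (norm (\<integral>x. f x \<partial>M)) \<le> (\<integral>\<^sup>+x. ennreal (norm (f x)) \<partial>M)"
proof (cases "integrable M f")
  case True
  then show ?thesis by (rule integral_norm_bound_ennreal)
next
  case False
  then show ?thesis by (simp add: not_integrable_integral_eq)
qed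

lemma borel_measurable_cnj[measurable]:
  "f \<in> borel_measurable M \<Longrightarrow> (\<lambda>x. cnj (f x)) \<in> borel_measurable M"
  by (rule borel_measurable_continuous_on[OF continuous_on_cnj[OF continuous_on_id]])

lemma (in pair_sigma_finite) integrable_pair_mult:
  fixes f g :: "_ \<Rightarrow> 'c::{real_normed_field, banach, second_countable_topology}"
  assumes f: "integrable M1 f" and g: "integrable M2 g"
  shows "integrable (M1 \<Otimes>\<^sub>M M2) (\<lambda>p. f (fst p) * g (snd p))"
proof -
  have [measurable]: "f \<in> borel_measurable M1" "g \<in> borel_measurable M2" using f g by auto
  show ?thesis
    by (rule Fubini_integrable) (use f g in \<open>auto simp: norm_mult\<close>)
qed

definition ift :: "('a::euclidean_space \<Rightarrow> complex) \<Rightarrow> 'a \<Rightarrow> complex" where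
  "ift h x = (\<integral>\<xi>. h \<xi> * cis (2 * pi * (x \<bullet> \<xi>)) \<partial>lborel)"

lemma measurable_ift[measurable]:
  assumes [measurable]: "h \<in> borel_measurable borel"
  shows "ift h \<in> borel_measurable borel"
  unfolding ift_def[abs_def] by measurable

text \<open>Integrating \<open>|ift h|\<^sup>2\<close> against a Gaussian turns it into a quadratic form of \<open>h\<close> with a
  positive kernel of total mass one, which is bounded by \<open>\<integral>|h|\<^sup>2\<close> by Schur's test.\<close>
lemma plancherel_weighted_le:
  fixes h :: "'a::euclidean_space \<Rightarrow> complex"
  assumes h: "integrable lborel h" and eps: "\<epsilon> > 0"
  shows "(\<integral>\<^sup>+x. ennreal ((cmod (ift h x))\<^sup>2 * gauss_weight \<epsilon> x) \<partial>lborel) \<le> (\<integral>\<^sup>+\<xi>. ennreal ((cmod (h \<xi>))\<^sup>2) \<partial>lborel)"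
proof -
  let ?e = "\<lambda>x \<xi>. cis (2 * pi * (x \<bullet> \<xi>))"
  let ?W = "\<lambda>x. complex_of_real (gauss_weight \<epsilon> (x::'a))"
  let ?k = "\<lambda>\<xi> \<eta>. complex_of_real (gauss_kernel \<epsilon> (\<xi> - \<eta> :: 'a))"
  let ?h2 = "\<lambda>\<xi>. ennreal ((cmod (h \<xi>))\<^sup>2)"
  have [measurable]: "h \<in> borel_measurable borel" using h by (auto dest: borel_measurable_integrable)
  let ?w = "gauss_weight \<epsilon> :: 'a \<Rightarrow> real"
  let ?K = "gauss_kernel \<epsilon> :: 'a \<Rightarrow> real"
  have wi: "integrable lborel ?w" by (rule gauss_weight_integrable[OF eps])
  define N where "N = (\<integral>\<xi>. cmod (h \<xi>) \<partial>lborel)"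
  have bG: "cmod (ift h x) \<le> N" for x
    unfolding ift_def N_def by (rule order_trans[OF integral_norm_bound]) (simp add: norm_mult)
  \<comment> \<open>\<open>ift h\<close> is merely bounded; the Gaussian factor makes q integrable,
    so that Fubini applies and the integral over x can be carried out first.\<close>
  define q where "q x = ?W x * cnj (ift h x)" for x
  have [measurable]: "q \<in> borel_measurable borel" unfolding q_def[abs_def] by measurable
  have qi: "integrable lborel q"
    by (rule Bochner_Integration.integrable_bound[OF integrable_mult_right[OF wi, of N]])
       (auto simp: q_def norm_mult abs_mult gauss_weight_bounds mult.commute[of _ "gauss_weight \<epsilon> _"]
          intro!: mult_left_mono order_trans[OF bG abs_ge_self])
  define A where "A = (\<integral>x. (cmod (ift h x))\<^sup>2 * ?w x \<partial>lborel)"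
  have wnn: "0 \<le> ?w x" for x by (rule gauss_weight_bounds)
  have Ai: "integrable lborel (\<lambda>x. (cmod (ift h x))\<^sup>2 * ?w x)"
    by (rule Bochner_Integration.integrable_bound[OF integrable_mult_right[OF wi, of "N\<^sup>2"]])
       (auto simp: abs_mult wnn intro!: mult_right_mono power_mono bG)
  have A0: "0 \<le> A" unfolding A_def by (intro integral_nonneg_AE AE_I2 mult_nonneg_nonneg wnn) auto
  have "complex_of_real A = (\<integral>x. complex_of_real ((cmod (ift h x))\<^sup>2 * ?w x) \<partial>lborel)"
    by (simp only: A_def integral_complex_of_real)
  also have "\<dots> = (\<integral>x. (\<integral>\<xi>. q x * (h \<xi> * ?e x \<xi>) \<partial>lborel) \<partial>lborel)"
  proof (rule Bochner_Integration.integral_cong[OF refl])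
    fix x
    have "(\<integral>\<xi>. q x * (h \<xi> * ?e x \<xi>) \<partial>lborel) = q x * ift h x"
      unfolding ift_def by (rule integral_mult_right_zero)
    also have "\<dots> = complex_of_real ((cmod (ift h x))\<^sup>2 * ?w x)"
      unfolding q_def using complex_norm_square[of "ift h x"] by (simp add: mult_ac)
    finally show "complex_of_real ((cmod (ift h x))\<^sup>2 * ?w x) = (\<integral>\<xi>. q x * (h \<xi> * ?e x \<xi>) \<partial>lborel)" ..
  qed
  also have "\<dots> = (\<integral>\<xi>. (\<integral>x. q x * (h \<xi> * ?e x \<xi>) \<partial>lborel) \<partial>lborel)"
  proof (rule lborel_pair.Fubini_integral[symmetric])
    show "integrable (lborel \<Otimes>\<^sub>M lborel) (\<lambda>(x, \<xi>). q x * (h \<xi> * ?e x \<xi>))"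
      by (rule Bochner_Integration.integrable_bound[OF lborel_pair.integrable_pair_mult[OF qi h]])
         (auto simp: norm_mult)
  qed
  also have "\<dots> = (\<integral>\<xi>. h \<xi> * (\<integral>\<eta>. cnj (h \<eta>) * ?k \<xi> \<eta> \<partial>lborel) \<partial>lborel)"
  proof (rule Bochner_Integration.integral_cong[OF refl])
    fix \<xi>
    have "(\<integral>x. q x * (h \<xi> * ?e x \<xi>) \<partial>lborel) = h \<xi> * (\<integral>x. q x * ?e x \<xi> \<partial>lborel)"
      by (subst integral_mult_right_zero[symmetric]) (simp add: mult_ac)
    also have "(\<integral>x. q x * ?e x \<xi> \<partial>lborel)
      = (\<integral>x. (\<integral>\<eta>. (?W x * cnj (h \<eta>)) * ?e x (\<xi> - \<eta>) \<partial>lborel) \<partial>lborel)"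
    proof (rule Bochner_Integration.integral_cong[OF refl])
      fix x
      have "cnj (ift h x) = (\<integral>\<eta>. cnj (h \<eta>) * cis (- (2 * pi * (x \<bullet> \<eta>))) \<partial>lborel)"
        unfolding ift_def by (subst Bochner_Integration.integral_cnj[symmetric]) (simp add: cis_cnj)
      then have "q x * ?e x \<xi> = (?W x * ?e x \<xi>) * (\<integral>\<eta>. cnj (h \<eta>) * cis (- (2 * pi * (x \<bullet> \<eta>))) \<partial>lborel)"
        by (simp add: q_def mult_ac)
      also have "\<dots> = (\<integral>\<eta>. (?W x * ?e x \<xi>) * (cnj (h \<eta>) * cis (- (2 * pi * (x \<bullet> \<eta>)))) \<partial>lborel)"
        by (rule integral_mult_right_zero[symmetric])
      also have "\<dots> = (\<integral>\<eta>. (?W x * cnj (h \<eta>)) * ?e x (\<xi> - \<eta>) \<partial>lborel)"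
      proof (rule Bochner_Integration.integral_cong[OF refl])
        fix \<eta>
        have "?e x (\<xi> - \<eta>) = ?e x \<xi> * cis (- (2 * pi * (x \<bullet> \<eta>)))"
          unfolding cis_mult by (simp add: inner_diff_right algebra_simps)
        then show "(?W x * ?e x \<xi>) * (cnj (h \<eta>) * cis (- (2 * pi * (x \<bullet> \<eta>)))) = (?W x * cnj (h \<eta>)) * ?e x (\<xi> - \<eta>)"
          by (simp only: mult_ac)
      qed
      finally show "q x * ?e x \<xi> = (\<integral>\<eta>. (?W x * cnj (h \<eta>)) * ?e x (\<xi> - \<eta>) \<partial>lborel)" .
    qed
    also have "\<dots> = (\<integral>\<eta>. (\<integral>x. (?W x * cnj (h \<eta>)) * ?e x (\<xi> - \<eta>) \<partial>lborel) \<partial>lborel)"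
    proof (rule lborel_pair.Fubini_integral[symmetric])
      have 1: "integrable lborel (\<lambda>x. ?W x)" using wi by (rule integrable_of_real)
      have 2: "integrable lborel (\<lambda>\<eta>. cnj (h \<eta>))" using h by simp
      show "integrable (lborel \<Otimes>\<^sub>M lborel) (\<lambda>(x, \<eta>). (?W x * cnj (h \<eta>)) * ?e x (\<xi> - \<eta>))"
        by (rule Bochner_Integration.integrable_bound[OF lborel_pair.integrable_pair_mult[OF 1 2]])
           (auto simp: norm_mult)
    qed
    also have "\<dots> = (\<integral>\<eta>. cnj (h \<eta>) * ?k \<xi> \<eta> \<partial>lborel)"
    proof (rule Bochner_Integration.integral_cong[OF refl])
      fix \<eta>
      have "(\<integral>x. (?W x * cnj (h \<eta>)) * ?e x (\<xi> - \<eta>) \<partial>lborel)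
        = cnj (h \<eta>) * (\<integral>x. ?W x * ?e x (\<xi> - \<eta>) \<partial>lborel)"
        by (subst integral_mult_right_zero[symmetric]) (simp add: mult_ac)
      then show "(\<integral>x. (?W x * cnj (h \<eta>)) * ?e x (\<xi> - \<eta>) \<partial>lborel) = cnj (h \<eta>) * ?k \<xi> \<eta>"
        by (simp add: gauss_weight_fourier[OF eps])
    qed
    finally show "(\<integral>x. q x * (h \<xi> * ?e x \<xi>) \<partial>lborel) = h \<xi> * (\<integral>\<eta>. cnj (h \<eta>) * ?k \<xi> \<eta> \<partial>lborel)" .
  qed
  finally have Aeq: "complex_of_real A = (\<integral>\<xi>. h \<xi> * (\<integral>\<eta>. cnj (h \<eta>) * ?k \<xi> \<eta> \<partial>lborel) \<partial>lborel)" .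
  define T where "T = (\<integral>\<^sup>+\<xi>. ?h2 \<xi> \<partial>lborel)"
  have "(\<integral>\<^sup>+x. ennreal ((cmod (ift h x))\<^sup>2 * ?w x) \<partial>lborel) = ennreal A"
    unfolding A_def by (rule nn_integral_eq_integral[OF Ai]) (auto intro!: mult_nonneg_nonneg wnn)
  also have "ennreal A = ennreal (cmod (complex_of_real A))" using A0 by simp
  also have "\<dots> \<le> (\<integral>\<^sup>+\<xi>. ennreal (cmod (h \<xi> * (\<integral>\<eta>. cnj (h \<eta>) * ?k \<xi> \<eta> \<partial>lborel))) \<partial>lborel)"
    unfolding Aeq by (rule ennreal_norm_integral_le)
  also have "\<dots> \<le> (\<integral>\<^sup>+\<xi>. (\<integral>\<^sup>+\<eta>. ennreal (1/2) * (?h2 \<xi> * ennreal (?K (\<eta> - \<xi>)))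
       + ennreal (1/2) * (?h2 \<eta> * ennreal (?K (\<xi> - \<eta>))) \<partial>lborel) \<partial>lborel)"
  proof (rule nn_integral_mono)
    fix \<xi>
    have "ennreal (cmod (h \<xi> * (\<integral>\<eta>. cnj (h \<eta>) * ?k \<xi> \<eta> \<partial>lborel)))
      = ennreal (cmod (\<integral>\<eta>. h \<xi> * (cnj (h \<eta>) * ?k \<xi> \<eta>) \<partial>lborel))"
      by simp
    also have "\<dots> \<le> (\<integral>\<^sup>+\<eta>. ennreal (cmod (h \<xi> * (cnj (h \<eta>) * ?k \<xi> \<eta>))) \<partial>lborel)"
      by (rule ennreal_norm_integral_le)
    also have "\<dots> \<le> (\<integral>\<^sup>+\<eta>. ennreal (1/2) * (?h2 \<xi> * ennreal (?K (\<eta> - \<xi>)))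
       + ennreal (1/2) * (?h2 \<eta> * ennreal (?K (\<xi> - \<eta>))) \<partial>lborel)"
    proof (rule nn_integral_mono)
      fix \<eta>
      define a b k where "a = cmod (h \<xi>)" "b = cmod (h \<eta>)" "k = ?K (\<xi> - \<eta>)"
      have k: "0 \<le> k" "?K (\<eta> - \<xi>) = k"
        using gauss_kernel_nonneg gauss_kernel_even[of \<epsilon> "\<xi> - \<eta>"] by (auto simp: a_b_k_def)
      \<comment> \<open>The product a b k is split symmetrically, so that in each half one variable
        occurs only in the kernel and integrates to 1.\<close>
      have "0 \<le> (a - b)\<^sup>2 * k" using k by simp
      then have "a * (b * k) \<le> 1/2 * (a\<^sup>2 * k) + 1/2 * (b\<^sup>2 * k)"
        by (simp add: power2_eq_square algebra_simps)
      then have "ennreal (a * (b * k)) \<le> ennreal (1/2 * (a\<^sup>2 * k) + 1/2 * (b\<^sup>2 * k))" by (rule ennreal_leI)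
      also have "\<dots> = ennreal (1/2) * (ennreal (a\<^sup>2) * ennreal k) + ennreal (1/2) * (ennreal (b\<^sup>2) * ennreal k)"
      proof -
        have "ennreal (1/2 * (c * k)) = ennreal (1/2) * (ennreal c * ennreal k)" if "0 \<le> c" for c
        proof -
          have 1: "ennreal (1/2 * (c * k)) = ennreal (1/2) * ennreal (c * k)" by (rule ennreal_mult) (use that k in auto)
          have 2: "ennreal (c * k) = ennreal c * ennreal k" by (rule ennreal_mult) (use that k in auto)
          show ?thesis by (simp only: 1 2)
        qed
        then show ?thesis using k(1) by (subst ennreal_plus) auto
      qed
      finally show "ennreal (cmod (h \<xi> * (cnj (h \<eta>) * ?k \<xi> \<eta>))) \<le> ennreal (1/2) * (?h2 \<xi> * ennreal (?K (\<eta> - \<xi>)))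
       + ennreal (1/2) * (?h2 \<eta> * ennreal (?K (\<xi> - \<eta>)))"
        unfolding k(2) using k(1) by (simp only: a_b_k_def norm_mult complex_mod_cnj norm_of_real abs_of_nonneg)
    qed
    finally show "ennreal (cmod (h \<xi> * (\<integral>\<eta>. cnj (h \<eta>) * ?k \<xi> \<eta> \<partial>lborel))) \<le> (\<integral>\<^sup>+\<eta>. ennreal (1/2) * (?h2 \<xi> * ennreal (?K (\<eta> - \<xi>)))
       + ennreal (1/2) * (?h2 \<eta> * ennreal (?K (\<xi> - \<eta>))) \<partial>lborel)" .
  qed
  also have "\<dots> = (\<integral>\<^sup>+\<xi>. (\<integral>\<^sup>+\<eta>. ennreal (1/2) * (?h2 \<xi> * ennreal (?K (\<eta> - \<xi>))) \<partial>lborel) \<partial>lborel)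
       + (\<integral>\<^sup>+\<xi>. (\<integral>\<^sup>+\<eta>. ennreal (1/2) * (?h2 \<eta> * ennreal (?K (\<xi> - \<eta>))) \<partial>lborel) \<partial>lborel)"
    by (subst nn_integral_add[symmetric]) (auto intro!: nn_integral_cong nn_integral_add)
  also have "(\<integral>\<^sup>+\<xi>. (\<integral>\<^sup>+\<eta>. ennreal (1/2) * (?h2 \<eta> * ennreal (?K (\<xi> - \<eta>))) \<partial>lborel) \<partial>lborel)
     = (\<integral>\<^sup>+\<xi>. (\<integral>\<^sup>+\<eta>. ennreal (1/2) * (?h2 \<xi> * ennreal (?K (\<eta> - \<xi>))) \<partial>lborel) \<partial>lborel)"
    by (rule lborel_pair.Fubini'[symmetric]) measurable
  also have "(\<integral>\<^sup>+\<xi>. (\<integral>\<^sup>+\<eta>. ennreal (1/2) * (?h2 \<xi> * ennreal (?K (\<eta> - \<xi>))) \<partial>lborel) \<partial>lborel)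
     = ennreal (1/2) * T"
    unfolding T_def by (simp add: nn_integral_cmult gauss_kernel_translate[OF eps] del: ennreal_half)
  also have "ennreal (1/2) * T + ennreal (1/2) * T = T"
    by (simp add: distrib_right[symmetric] ennreal_plus[symmetric] del: ennreal_plus ennreal_half)
  finally show ?thesis by (simp add: T_def)
qed

text \<open>The Gaussian weights tend to 1 pointwise and the bound does not depend on their width,
  so Fatou's lemma removes them.\<close>

lemma plancherel_ift_le:
  fixes h :: "'a::euclidean_space \<Rightarrow> complex"
  assumes h: "integrable lborel h"
  shows "(\<integral>\<^sup>+x. ennreal ((cmod (ift h x))\<^sup>2) \<partial>lborel) \<le> (\<integral>\<^sup>+\<xi>. ennreal ((cmod (h \<xi>))\<^sup>2) \<partial>lborel)"
proof -
  have [measurable]: "h \<in> borel_measurable borel" using h by (auto dest: borel_measurable_integrable)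
  define W where "W n x = ennreal ((cmod (ift h x))\<^sup>2 * gauss_weight (1 / real (Suc n)) x)" for n x
  have [measurable]: "W n \<in> borel_measurable borel" for n unfolding W_def[abs_def] by measurable
  have lim: "(\<lambda>n. W n x) \<longlonglongrightarrow> ennreal ((cmod (ift h x))\<^sup>2)" for x
  proof -
    have "(\<lambda>n. gauss_weight (1 / real (Suc n)) x) \<longlonglongrightarrow> (\<Prod>b\<in>(Basis::'a set). exp (- (0 * (x \<bullet> b))\<^sup>2 / 2))"
      unfolding gauss_weight_def
      by (intro tendsto_prod tendsto_exp tendsto_divide tendsto_minus tendsto_power tendsto_mult
          tendsto_const LIMSEQ_Suc[OF lim_1_over_n]) auto
    then have "(\<lambda>n. (cmod (ift h x))\<^sup>2 * gauss_weight (1 / real (Suc n)) x) \<longlonglongrightarrow> (cmod (ift h x))\<^sup>2 * 1"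
      by (intro tendsto_mult tendsto_const) simp
    then show ?thesis unfolding W_def by (intro tendsto_ennrealI) simp
  qed
  have "(\<integral>\<^sup>+x. ennreal ((cmod (ift h x))\<^sup>2) \<partial>lborel) = (\<integral>\<^sup>+x. liminf (\<lambda>n. W n x) \<partial>lborel)"
    using lim_imp_Liminf[OF _ lim] by simp
  also have "\<dots> \<le> liminf (\<lambda>n. \<integral>\<^sup>+x. W n x \<partial>lborel)" by (rule nn_integral_liminf) simp
  also have "\<dots> \<le> liminf (\<lambda>n::nat. \<integral>\<^sup>+\<xi>. ennreal ((cmod (h \<xi>))\<^sup>2) \<partial>lborel)"
    unfolding W_def by (intro Liminf_mono always_eventually allI plancherel_weighted_le[OF h]) simp
  also have "\<dots> = (\<integral>\<^sup>+\<xi>. ennreal ((cmod (h \<xi>))\<^sup>2) \<partial>lborel)" by (simp add: Liminf_const)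
  finally show ?thesis .
qed

text \<open>Conjugation turns the forward transform into \<open>ift\<close> of the conjugate, so the
  same inequality covers both directions and no inversion formula is required.\<close>

lemma plancherel_fourier_le:
  fixes f :: "real^'n \<Rightarrow> complex"
  assumes f: "integrable lborel f"
  shows "(\<integral>\<^sup>+\<xi>. ennreal ((cmod (fourier f \<xi>))\<^sup>2) \<partial>lborel) \<le> (\<integral>\<^sup>+x. ennreal ((cmod (f x))\<^sup>2) \<partial>lborel)"
proof -
  have "cmod (fourier f \<xi>) = cmod (ift (\<lambda>x. cnj (f x)) \<xi>)" for \<xi>
  proof -
    have "cnj (fourier f \<xi>) = ift (\<lambda>x. cnj (f x)) \<xi>"
      unfolding fourier_def ift_def
      by (subst Bochner_Integration.integral_cnj[symmetric]) (simp add: cis_cnj inner_commute)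
    then show ?thesis by (metis complex_mod_cnj)
  qed
  then show ?thesis using plancherel_ift_le[of "\<lambda>x. cnj (f x)"] f by simp
qed

section \<open>Fourier transforms of Schwartz functions\<close>

lemma
  fixes g :: "'a::euclidean_space \<Rightarrow> 'b::{banach, second_countable_topology}"
  assumes g: "integrable lborel g"
  shows integrable_lborel_translate: "integrable lborel (\<lambda>x. g (x + a))"
    and integral_lborel_translate: "(\<integral>x. g (x + a) \<partial>lborel) = (\<integral>x. g x \<partial>lborel)"
proof -
  have [measurable]: "g \<in> borel_measurable borel" using g by (auto dest: borel_measurable_integrable)
  have "integrable (distr lborel borel ((+) a)) g" using g by (simp add: lborel_distr_plus)
  then show "integrable lborel (\<lambda>x. g (x + a))" by (subst (asm) integrable_distr_eq) (auto simp: add.commute)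
  have "(\<integral>x. g x \<partial>lborel) = (\<integral>x. g x \<partial>distr lborel borel ((+) a))" by (simp add: lborel_distr_plus)
  also have "\<dots> = (\<integral>x. g (x + a) \<partial>lborel)" by (subst integral_distr) (auto simp: add.commute)
  finally show "(\<integral>x. g (x + a) \<partial>lborel) = (\<integral>x. g x \<partial>lborel)" ..
qed

text \<open>The integral of g(x + u) - g(x) vanishes by translation invariance. Writing the
  difference as an integral of the derivative over the segment and exchanging the integrals gives
  the integral of \<open>g'\<close>. No boundary terms arise.\<close>

lemma integral_directional_derivative_eq_0:
  fixes g g' :: "'a::euclidean_space \<Rightarrow> complex"
  assumes g: "integrable lborel g" and g': "integrable lborel g'" "continuous_on UNIV g'"
    and der: "\<And>x t. ((\<lambda>t. g (x + t *\<^sub>R u)) has_vector_derivative g' (x + t *\<^sub>R u)) (at t)"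
  shows "(\<integral>x. g' x \<partial>lborel) = 0"
proof -
  have [measurable]: "g' \<in> borel_measurable borel" using g' by (auto dest: borel_measurable_integrable)
  have ftc: "(\<integral>t. indicator {0..1::real} t *\<^sub>R g' (x + t *\<^sub>R u) \<partial>lborel) = g (x + 1 *\<^sub>R u) - g (x + 0 *\<^sub>R u)" for x
  proof (rule integral_FTC_Icc)
    show "((\<lambda>t. g (x + t *\<^sub>R u)) has_vector_derivative g' (x + t *\<^sub>R u)) (at t within {0..1})" for t
      using der has_vector_derivative_at_within by blast
    show "continuous_on {0..1} (\<lambda>t. g' (x + t *\<^sub>R u))"
      by (rule continuous_on_compose2[OF g'(2)]) (auto intro!: continuous_intros)
  qed simp
  have int: "integrable (lborel \<Otimes>\<^sub>M lborel) (\<lambda>(t, x). indicator {0..1::real} t *\<^sub>R g' (x + t *\<^sub>R u))"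
  proof (rule lborel_pair.Fubini_integrable)
    have "(\<lambda>t::real. \<integral>x. norm (case (t, x) of (t, x) \<Rightarrow> indicator {0..1::real} t *\<^sub>R g' (x + t *\<^sub>R u)) \<partial>lborel)
      = (\<lambda>t. indicator {0..1} t *\<^sub>R (\<integral>x. norm (g' x) \<partial>lborel))"
      by (simp add: fun_eq_iff integral_lborel_translate[OF integrable_norm[OF g'(1)]])
    then show "integrable lborel (\<lambda>t::real. \<integral>x. norm (case (t, x) of (t, x) \<Rightarrow> indicator {0..1::real} t *\<^sub>R g' (x + t *\<^sub>R u)) \<partial>lborel)"
      by simp
    show "AE t in lborel. integrable lborel (\<lambda>x. case (t, x) of (t::real, x) \<Rightarrow> indicator {0..1::real} t *\<^sub>R g' (x + t *\<^sub>R u))"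
      by (auto intro!: integrable_lborel_translate g')
  qed measurable
  have "0 = (\<integral>x. g (x + u) - g x \<partial>lborel)"
    using integral_lborel_translate[OF g, of u] integrable_lborel_translate[OF g, of u] g by simp
  also have "\<dots> = (\<integral>x. (\<integral>t. indicator {0..1::real} t *\<^sub>R g' (x + t *\<^sub>R u) \<partial>lborel) \<partial>lborel)"
    by (simp add: ftc)
  also have "\<dots> = (\<integral>t. (\<integral>x. indicator {0..1::real} t *\<^sub>R g' (x + t *\<^sub>R u) \<partial>lborel) \<partial>lborel)"
    by (rule lborel_pair.Fubini_integral[OF int])
  also have "\<dots> = (\<integral>t. indicator {0..1::real} t *\<^sub>R (\<integral>x. g' x \<partial>lborel) \<partial>lborel)"
    by (simp add: integral_lborel_translate[OF g'(1)])
  also have "\<dots> = (\<integral>x. g' x \<partial>lborel)" by simp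
  finally show ?thesis by simp
qed

definition rapid_decay :: "(real^'n \<Rightarrow> 'b::real_normed_vector) \<Rightarrow> bool" where
  "rapid_decay g \<longleftrightarrow> (\<forall>N::nat. \<exists>C. \<forall>x. (1 + norm x) ^ N * norm (g x) \<le> C)"

lemma rapid_decay_integrable:
  fixes g :: "real^'n \<Rightarrow> 'b::{banach, second_countable_topology}"
  assumes [measurable]: "g \<in> borel_measurable borel" and g: "rapid_decay g"
  shows "integrable lborel g"
proof -
  have 1: "integrable lborel (\<lambda>t::real. inverse (1 + t\<^sup>2))"
    using integrable_inverse_1_plus_square by (simp add: set_integrable_def)
  have int: "integrable lborel (\<lambda>x::real^'n. \<Prod>b\<in>Basis. inverse (1 + (x \<bullet> b)\<^sup>2))"
    by (rule integrable_lborel_prod) (rule 1)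
  \<comment> \<open>Each factor 1 + (x.b)^2 of the comparison product is at most (1 + |x|)^2, and
    there is one factor per dimension.\<close>
  obtain C where C: "\<And>x. (1 + norm x) ^ (2 * DIM(real^'n)) * norm (g x) \<le> C"
    using g unfolding rapid_decay_def by metis
  show ?thesis
  proof (rule Bochner_Integration.integrable_bound[OF integrable_mult_right[OF int, of C]])
    show "AE x in lborel. norm (g x) \<le> norm (C * (\<Prod>b\<in>Basis. inverse (1 + (x \<bullet> b)\<^sup>2)))"
    proof (rule AE_I2)
      fix x :: "real^'n"
      let ?P = "\<Prod>b\<in>(Basis::(real^'n) set). (1 + (x \<bullet> b)\<^sup>2)"
      have P: "0 < ?P" by (intro prod_pos) (auto simp: add_pos_nonneg)
      have "?P \<le> (\<Prod>b\<in>(Basis::(real^'n) set). (1 + norm x)\<^sup>2)"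
      proof (rule prod_mono)
        fix b :: "real^'n" assume b: "b \<in> Basis"
        have "(x \<bullet> b)\<^sup>2 \<le> (norm x)\<^sup>2" using Basis_le_norm[OF b, of x] by (simp add: abs_le_square_iff[symmetric])
        moreover have "(1 + norm x)\<^sup>2 = 1 + (norm x)\<^sup>2 + 2 * norm x" by (simp add: power2_sum)
        ultimately show "0 \<le> 1 + (x \<bullet> b)\<^sup>2 \<and> 1 + (x \<bullet> b)\<^sup>2 \<le> (1 + norm x)\<^sup>2"
          using norm_ge_zero[of x] zero_le_power2[of "x \<bullet> b"] by linarith
      qed
      also have "\<dots> = (1 + norm x) ^ (2 * DIM(real^'n))" by (simp add: power_mult)
      finally have "?P * norm (g x) \<le> (1 + norm x) ^ (2 * DIM(real^'n)) * norm (g x)" by (intro mult_right_mono) auto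
      also have "\<dots> \<le> C" by (rule C)
      finally have "norm (g x) \<le> C / ?P" using P by (simp add: pos_le_divide_eq mult.commute)
      also have "\<dots> = C * (\<Prod>b\<in>Basis. inverse (1 + (x \<bullet> b)\<^sup>2))" by (simp add: divide_inverse prod_inversef[symmetric] comp_def)
      also have "\<dots> \<le> norm \<dots>" by simp
      finally show "norm (g x) \<le> norm (C * (\<Prod>b\<in>Basis. inverse (1 + (x \<bullet> b)\<^sup>2)))" .
    qed
  qed simp
qed

lemma
  assumes f: "schwartz f" and us: "us \<in> lists Basis"
  shows schwartz_continuous: "continuous_on UNIV (pderivs us f)"
    and schwartz_rapid_decay: "rapid_decay (pderivs us f)"
    and schwartz_integrable: "integrable lborel (pderivs us f)"
proof -
  show c: "continuous_on UNIV (pderivs us f)" and d: "rapid_decay (pderivs us f)"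
    using assms unfolding schwartz_def smooth_fun_def rapid_decay_def by blast+
  show "integrable lborel (pderivs us f)"
    by (rule rapid_decay_integrable[OF borel_measurable_continuous_onI[OF c] d])
qed

text \<open>\<open>pderivs\<close> differentiates at parameter 0 only. Moving the base point along
  the line gives the derivative at every parameter.\<close>

lemma schwartz_derivative:
  assumes f: "schwartz f" and us: "us \<in> lists Basis" and u: "u \<in> Basis"
  shows "((\<lambda>t. pderivs us f (x + t *\<^sub>R u)) has_vector_derivative pderivs (u # us) f (x + t *\<^sub>R u)) (at t)"
proof -
  have "(\<lambda>s. pderivs us f ((x + t *\<^sub>R u) + s *\<^sub>R u)) differentiable (at 0)"
    using f us u unfolding schwartz_def smooth_fun_def by blast
  then have "((\<lambda>s. pderivs us f ((x + t *\<^sub>R u) + s *\<^sub>R u)) has_vector_derivative pderivs (u # us) f (x + t *\<^sub>R u)) (at (t - t))"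
    by (simp add: vector_derivative_works)
  moreover have "((\<lambda>s. s - t) has_vector_derivative 1) (at t)"
    by (auto intro!: derivative_eq_intros simp: has_vector_derivative_def)
  ultimately have "((\<lambda>s. pderivs us f ((x + t *\<^sub>R u) + s *\<^sub>R u)) \<circ> (\<lambda>s. s - t) has_vector_derivative 1 *\<^sub>R pderivs (u # us) f (x + t *\<^sub>R u)) (at t)"
    by (intro vector_diff_chain_at) auto
  moreover have "(\<lambda>s. pderivs us f ((x + t *\<^sub>R u) + s *\<^sub>R u)) \<circ> (\<lambda>s. s - t) = (\<lambda>s. pderivs us f (x + s *\<^sub>R u))"
    by (auto simp: fun_eq_iff algebra_simps)
  ultimately show ?thesis by (simp del: pderivs.simps)
qed

lemma has_vector_derivative_cis:
  assumes "(f has_real_derivative f') (at t)"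
  shows "((\<lambda>t. cis (f t)) has_vector_derivative (\<i> * of_real f') * cis (f t)) (at t)"
proof -
  have 1: "((\<lambda>t. complex_of_real (f t)) has_vector_derivative of_real f') (at t)"
    using assms by (intro has_vector_derivative_of_real) (simp add: has_real_derivative_iff_has_vector_derivative)
  have 2: "((\<lambda>z. exp (\<i> * z)) has_field_derivative \<i> * exp (\<i> * complex_of_real (f t))) (at (complex_of_real (f t)))"
    by (auto intro!: derivative_eq_intros)
  from field_vector_diff_chain_at[OF 1 2] show ?thesis
    by (simp add: comp_def cis_conv_exp mult_ac)
qed

text \<open>Integration by parts: the derivative along u of the function times the character has
  integral 0.\<close>

lemma fourier_pderivs_Cons:
  assumes f: "schwartz f" and us: "us \<in> lists Basis" and u: "u \<in> Basis"
  shows "fourier (pderivs (u # us) f) \<xi> = (2 * pi * \<i> * of_real (u \<bullet> \<xi>)) * fourier (pderivs us f) \<xi>"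
proof -
  define g where "g = pderivs us f"
  define g' where "g' = pderivs (u # us) f"
  have us': "u # us \<in> lists Basis" using us u by auto
  define E where "E x = cis (- (2 * pi * (x \<bullet> \<xi>)))" for x
  define c where "c = 2 * pi * \<i> * complex_of_real (u \<bullet> \<xi>)"
  have cE: "continuous_on UNIV E" unfolding E_def[abs_def] by (intro continuous_intros)
  have cg: "continuous_on UNIV g" "continuous_on UNIV g'"
    unfolding g_def g'_def by (rule schwartz_continuous[OF f us] schwartz_continuous[OF f us'])+
  have [measurable]: "E \<in> borel_measurable borel" using cE by (rule borel_measurable_continuous_onI)
  have ig: "integrable lborel g" "integrable lborel g'"
    unfolding g_def g'_def by (rule schwartz_integrable[OF f us] schwartz_integrable[OF f us'])+
  have igE: "integrable lborel (\<lambda>x. h x * E x)" if "integrable lborel h" for h :: "real^'a \<Rightarrow> complex"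
    by (rule Bochner_Integration.integrable_bound[OF that])
       (use that in \<open>auto simp: norm_mult E_def dest: borel_measurable_integrable\<close>)
  have "(\<integral>x. g' x * E x - c * (g x * E x) \<partial>lborel) = 0"
  proof (rule integral_directional_derivative_eq_0[where u=u])
    show "integrable lborel (\<lambda>x. g x * E x)" by (rule igE[OF ig(1)])
    show "integrable lborel (\<lambda>x. g' x * E x - c * (g x * E x))"
      by (intro Bochner_Integration.integrable_diff integrable_mult_right igE ig)
    show "continuous_on UNIV (\<lambda>x. g' x * E x - c * (g x * E x))"
      by (intro continuous_intros cg cE)
    fix x t
    have dE: "((\<lambda>t. E (x + t *\<^sub>R u)) has_vector_derivative - c * E (x + t *\<^sub>R u)) (at t)"
    proof -
      have "((\<lambda>t. - (2 * pi * ((x + t *\<^sub>R u) \<bullet> \<xi>))) has_real_derivative - (2 * pi * (u \<bullet> \<xi>))) (at t)"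
        by (auto intro!: derivative_eq_intros simp: inner_add_left)
      from has_vector_derivative_cis[OF this] show ?thesis by (simp add: E_def c_def mult_ac)
    qed
    have "((\<lambda>t. g (x + t *\<^sub>R u)) has_vector_derivative g' (x + t *\<^sub>R u)) (at t)"
      unfolding g_def g'_def by (rule schwartz_derivative[OF f us u])
    from has_vector_derivative_mult[OF this dE]
    show "((\<lambda>t. g (x + t *\<^sub>R u) * E (x + t *\<^sub>R u)) has_vector_derivative
       g' (x + t *\<^sub>R u) * E (x + t *\<^sub>R u) - c * (g (x + t *\<^sub>R u) * E (x + t *\<^sub>R u))) (at t)"
      by (simp add: algebra_simps)
  qed
  then have "(\<integral>x. g' x * E x \<partial>lborel) = c * (\<integral>x. g x * E x \<partial>lborel)"
    using igE[OF ig(1)] igE[OF ig(2)] by simp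
  then show ?thesis by (simp add: fourier_def g_def g'_def E_def c_def del: pderivs.simps)
qed

lemma cmod_fourier_le: "cmod (fourier f \<xi>) \<le> (\<integral>x. cmod (f x) \<partial>lborel)"
  unfolding fourier_def by (rule order_trans[OF integral_norm_bound]) (simp add: norm_mult)

text \<open>Derivatives repeated in a single coordinate direction suffice, because the largest
  coordinate of \<xi> controls its norm up to the dimension.\<close>

lemma fourier_rapid_decay:
  fixes f :: "real^'n \<Rightarrow> complex"
  assumes f: "schwartz f"
  shows "rapid_decay (fourier f)"
  unfolding rapid_decay_def
proof
  fix N :: nat
  have us: "replicate N u \<in> lists Basis" if "u \<in> Basis" for N and u :: "real^'n" using that by auto
  have rep: "fourier (pderivs (replicate N u) f) \<xi> = (2 * pi * \<i> * of_real (u \<bullet> \<xi>)) ^ N * fourier f \<xi>" if "u \<in> Basis" for N u \<xi>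
    by (induction N) (use fourier_pderivs_Cons[OF f us[OF that] that] in \<open>simp_all del: pderivs.simps(2)\<close>)
  define D where "D u = (\<integral>x. cmod (pderivs (replicate N u) f x) \<partial>lborel)" for u
  have D: "\<bar>u \<bullet> \<xi>\<bar> ^ N * cmod (fourier f \<xi>) \<le> D u" if "u \<in> Basis" for u \<xi>
  proof -
    have "\<bar>u \<bullet> \<xi>\<bar> ^ N \<le> (2 * pi * \<bar>u \<bullet> \<xi>\<bar>) ^ N"
      using pi_gt3 by (intro power_mono) (auto simp: mult_le_cancel_right1)
    then have "\<bar>u \<bullet> \<xi>\<bar> ^ N * cmod (fourier f \<xi>) \<le> (2 * pi * \<bar>u \<bullet> \<xi>\<bar>) ^ N * cmod (fourier f \<xi>)"
      by (rule mult_right_mono) simp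
    also have "\<dots> = cmod (fourier (pderivs (replicate N u) f) \<xi>)"
      unfolding rep[OF that] by (simp add: norm_mult norm_power)
    also have "\<dots> \<le> D u" unfolding D_def by (rule cmod_fourier_le)
    finally show ?thesis .
  qed
  define d where "d = real DIM(real^'n)"
  define C where "C = 2 ^ N * ((\<integral>x. cmod (f x) \<partial>lborel) + d ^ N * (\<Sum>u\<in>Basis. D u))"
  show "\<exists>C. \<forall>\<xi>. (1 + norm \<xi>) ^ N * norm (fourier f \<xi>) \<le> C"
  proof (intro exI allI)
    fix \<xi> :: "real^'n"
    have Dnn: "0 \<le> D u" for u unfolding D_def by simp
    let ?A = "(\<lambda>b. \<bar>b \<bullet> \<xi>\<bar>) ` (Basis :: (real^'n) set)"
    have "Max ?A \<in> ?A" by (rule Max_in) auto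
    then obtain u where u: "u \<in> Basis" "Max ?A = \<bar>u \<bullet> \<xi>\<bar>" by (rule imageE)
    have u2: "\<bar>b \<bullet> \<xi>\<bar> \<le> \<bar>u \<bullet> \<xi>\<bar>" if "b \<in> Basis" for b
      unfolding u(2)[symmetric] using that by (intro Max_ge) auto
    have "norm \<xi> \<le> (\<Sum>b\<in>Basis. \<bar>\<xi> \<bullet> b\<bar>)" by (rule norm_le_l1)
    also have "\<dots> \<le> (\<Sum>b\<in>(Basis::(real^'n) set). \<bar>u \<bullet> \<xi>\<bar>)" using u2 by (intro sum_mono) (simp add: inner_commute)
    also have "\<dots> = d * \<bar>u \<bullet> \<xi>\<bar>" by (simp add: d_def)
    finally have n: "norm \<xi> \<le> d * \<bar>u \<bullet> \<xi>\<bar>" .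
    have "(norm \<xi>) ^ N * cmod (fourier f \<xi>) \<le> d ^ N * (\<bar>u \<bullet> \<xi>\<bar> ^ N * cmod (fourier f \<xi>))"
      using power_mono[OF n, of N] by (simp add: power_mult_distrib mult_right_mono mult.assoc[symmetric])
    also have "\<dots> \<le> d ^ N * D u" using D[OF u(1)] by (intro mult_left_mono) (auto simp: d_def)
    also have "\<dots> \<le> d ^ N * (\<Sum>u\<in>Basis. D u)"
      using u(1) Dnn by (intro mult_left_mono member_le_sum) (auto simp: d_def)
    finally have b1: "(norm \<xi>) ^ N * cmod (fourier f \<xi>) \<le> d ^ N * (\<Sum>u\<in>Basis. D u)" .
    have "(1 + norm \<xi>) ^ N \<le> (2 * max 1 (norm \<xi>)) ^ N" by (intro power_mono) auto
    also have "\<dots> = 2 ^ N * (max 1 (norm \<xi>)) ^ N" by (rule power_mult_distrib)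
    also have "\<dots> \<le> 2 ^ N * (1 + norm \<xi> ^ N)" by (intro mult_left_mono) (auto simp: max_def)
    finally have "(1 + norm \<xi>) ^ N * cmod (fourier f \<xi>) \<le> 2 ^ N * (1 + norm \<xi> ^ N) * cmod (fourier f \<xi>)"
      by (rule mult_right_mono) simp
    also have "\<dots> = 2 ^ N * (cmod (fourier f \<xi>) + norm \<xi> ^ N * cmod (fourier f \<xi>))" by (simp add: algebra_simps)
    also have "\<dots> \<le> C" unfolding C_def using b1 cmod_fourier_le[of f \<xi>] by (intro mult_left_mono add_mono) auto
    finally show "(1 + norm \<xi>) ^ N * norm (fourier f \<xi>) \<le> C" .
  qed
qed

lemma measurable_fourier:
  assumes [measurable]: "f \<in> borel_measurable borel"
  shows "fourier f \<in> borel_measurable borel"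
  unfolding fourier_def[abs_def] by measurable

lemma schwartz_measurable: "schwartz f \<Longrightarrow> f \<in> borel_measurable borel"
  using schwartz_continuous[of f "[]"] by (auto intro: borel_measurable_continuous_onI)

lemma schwartz_fourier_integrable:
  fixes f :: "real^'n \<Rightarrow> complex"
  assumes f: "schwartz f"
  shows "integrable lborel (\<lambda>\<xi>. cmod (fourier f \<xi>) * (1 + norm \<xi>))"
proof (rule rapid_decay_integrable)
  have [measurable]: "fourier f \<in> borel_measurable borel"
    by (rule measurable_fourier[OF schwartz_measurable[OF f]])
  show "(\<lambda>\<xi>. cmod (fourier f \<xi>) * (1 + norm \<xi>)) \<in> borel_measurable borel" by measurable
  show "rapid_decay (\<lambda>\<xi>. cmod (fourier f \<xi>) * (1 + norm \<xi>))"
    unfolding rapid_decay_def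
  proof
    fix N
    obtain C where "\<forall>\<xi>. (1 + norm \<xi>) ^ Suc N * norm (fourier f \<xi>) \<le> C"
      using fourier_rapid_decay[OF f] unfolding rapid_decay_def by blast
    then show "\<exists>C. \<forall>x. (1 + norm x) ^ N * norm (cmod (fourier f x) * (1 + norm x)) \<le> C"
      by (intro exI[of _ C]) (simp add: abs_mult mult_ac)
  qed
qed

lemma schwartz_square_integrable:
  fixes f :: "real^'n \<Rightarrow> complex"
  assumes f: "schwartz f"
  shows "integrable lborel (\<lambda>x. (cmod (f x))\<^sup>2)"
proof -
  have [measurable]: "f \<in> borel_measurable borel" by (rule schwartz_measurable[OF f])
  obtain C where C: "\<And>x. cmod (f x) \<le> C"
    using schwartz_rapid_decay[OF f lists.Nil, unfolded rapid_decay_def, rule_format, of 0] by auto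
  have "integrable lborel f" using schwartz_integrable[OF f, of "[]"] by simp
  then have "integrable lborel (\<lambda>x. C * cmod (f x))" by (intro integrable_mult_right integrable_norm)
  then show ?thesis
  proof (rule Bochner_Integration.integrable_bound)
    show "AE x in lborel. norm ((cmod (f x))\<^sup>2) \<le> norm (C * cmod (f x))"
      using C by (auto simp: power2_eq_square abs_mult intro!: mult_right_mono order_trans[OF C abs_ge_self])
  qed simp
qed

section \<open>The maximal operator\<close>

lemma continuous_on_lebesgue_integral:
  fixes h :: "real \<Rightarrow> 'a \<Rightarrow> 'b::{banach, second_countable_topology}"
  assumes meas: "\<And>t. h t \<in> borel_measurable M" and w: "integrable M w"
    and bound: "\<And>t x. norm (h t x) \<le> w x"
    and cont: "\<And>x. continuous_on UNIV (\<lambda>t. h t x)"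
  shows "continuous_on UNIV (\<lambda>t. \<integral>x. h t x \<partial>M)"
  unfolding continuous_on_sequentially comp_def
proof (intro allI ballI impI)
  fix X :: "nat \<Rightarrow> real" and t assume X: "(\<forall>n. X n \<in> UNIV) \<and> X \<longlonglongrightarrow> t"
  show "(\<lambda>n. \<integral>x. h (X n) x \<partial>M) \<longlonglongrightarrow> (\<integral>x. h t x \<partial>M)"
  proof (rule integral_dominated_convergence[OF meas meas w])
    show "AE x in M. (\<lambda>n. h (X n) x) \<longlonglongrightarrow> h t x"
      using cont X unfolding continuous_on_sequentially comp_def by (intro AE_I2) auto
  qed (use bound in auto)
qed

text \<open>The transform of the frame measure, written over the ball. It is defined and measurable
  for all frames, and it agrees with \<open>fourier_measure\<close> of \<open>frame_sigma\<close> at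
  admissible ones.\<close>

definition sphere_ft :: "(nat \<Rightarrow> real^'n) \<Rightarrow> nat \<Rightarrow> (nat \<Rightarrow> real^'n) \<Rightarrow> real \<Rightarrow> real^'n \<Rightarrow> complex" where
  "sphere_ft v i y t \<xi> = (\<integral>g. cis (- (2 * pi * (Phi v i y g \<bullet> (t *\<^sub>R \<xi>)))) \<partial>ball_measure)"

definition sphere_ft_deriv :: "(nat \<Rightarrow> real^'n) \<Rightarrow> nat \<Rightarrow> (nat \<Rightarrow> real^'n) \<Rightarrow> real \<Rightarrow> real^'n \<Rightarrow> complex" where
  "sphere_ft_deriv v i y t \<xi> = (\<integral>g. - (\<i> * of_real (2 * pi * (Phi v i y g \<bullet> \<xi>))) * cis (- (2 * pi * (Phi v i y g \<bullet> (t *\<^sub>R \<xi>)))) \<partial>ball_measure)"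

lemma
  fixes y :: "nat \<Rightarrow> real^'n"
  assumes "gram v i y" "i < CARD('n)"
  shows sphere_ft_eq: "sphere_ft v i y t \<xi> = fourier_measure (frame_sigma v (Suc i) y) (t *\<^sub>R \<xi>)"
    and sphere_ft_deriv_eq: "sphere_ft_deriv v i y t \<xi> = dfourier (frame_sigma v (Suc i) y) t \<xi>"
  unfolding sphere_ft_def sphere_ft_deriv_def fourier_measure_def dfourier_def frame_sigma_eq_distr[OF assms]
  by (rule integral_distr[symmetric]; simp)+

lemma measurable_sphere_ft[measurable]:
  assumes [measurable]: "y \<in> M \<rightarrow>\<^sub>M borel" "t \<in> borel_measurable M" "\<xi> \<in> borel_measurable M"
  shows "(\<lambda>w. sphere_ft v i (y w) (t w) (\<xi> w)) \<in> borel_measurable M"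
    and "(\<lambda>w. sphere_ft_deriv v i (y w) (t w) (\<xi> w)) \<in> borel_measurable M"
proof -
  interpret sigma_finite_measure ball_measure by (rule sigma_finite_ball_measure)
  have [measurable]: "(\<lambda>p. Phi v i (y (fst p)) (snd p)) \<in> borel_measurable (M \<Otimes>\<^sub>M ball_measure)"
    by (rule measurable_Phi) measurable
  show "(\<lambda>w. sphere_ft v i (y w) (t w) (\<xi> w)) \<in> borel_measurable M"
    unfolding sphere_ft_def by (rule borel_measurable_lebesgue_integral) (simp add: case_prod_unfold)
  show "(\<lambda>w. sphere_ft_deriv v i (y w) (t w) (\<xi> w)) \<in> borel_measurable M"
    unfolding sphere_ft_deriv_def by (rule borel_measurable_lebesgue_integral) (simp add: case_prod_unfold)
qed

lemma measurable_ift_param: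
  assumes [measurable]: "(\<lambda>p. h (fst p) (snd p)) \<in> borel_measurable (M \<Otimes>\<^sub>M borel)" "x \<in> borel_measurable M"
  shows "(\<lambda>w. ift (h w) (x w)) \<in> borel_measurable M"
  unfolding ift_def
  by (rule lborel.borel_measurable_lebesgue_integral) (simp add: case_prod_unfold measurable_cong_sets[OF sets_pair_measure_cong[OF refl sets_lborel] refl])

lemma Phi_norm_le: "norm (Phi v i y g) \<le> norm (ctr v i y) + \<bar>rho v i\<bar>"
proof -
  have "norm (Phi v i y g) \<le> norm (ctr v i y) + norm (rho v i *\<^sub>R sgn (perp y i g))"
    unfolding Phi_def by (rule norm_triangle_ineq)
  also have "norm (rho v i *\<^sub>R sgn (perp y i g)) \<le> \<bar>rho v i\<bar>"
    by (simp add: norm_sgn)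
  finally show ?thesis by simp
qed

text \<open>It depends on y because the centre is not uniformly bounded off admissible frames. It
  only justifies differentiation under the integral and integrability, and it does not reach the
  final constant.\<close>

definition phase_bound :: "(nat \<Rightarrow> real^'n) \<Rightarrow> nat \<Rightarrow> (nat \<Rightarrow> real^'n) \<Rightarrow> real" where
  "phase_bound v i y = 2 * pi * (norm (ctr v i y) + \<bar>rho v i\<bar>)"

lemma phase_bound_nonneg: "0 \<le> phase_bound v i y"
  by (simp add: phase_bound_def)

lemma sphere_ft_deriv_integrand_le:
  "cmod (- (\<i> * of_real (2 * pi * (Phi v i y g \<bullet> \<xi>))) * cis s) \<le> phase_bound v i y * norm \<xi>"
proof -
  have "\<bar>Phi v i y g \<bullet> \<xi>\<bar> \<le> (norm (ctr v i y) + \<bar>rho v i\<bar>) * norm \<xi>"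
    by (rule order_trans[OF Cauchy_Schwarz_ineq2]) (intro mult_right_mono Phi_norm_le, simp)
  then have "2 * pi * \<bar>Phi v i y g \<bullet> \<xi>\<bar> \<le> 2 * pi * ((norm (ctr v i y) + \<bar>rho v i\<bar>) * norm \<xi>)"
    by (intro mult_left_mono) auto
  then show ?thesis by (simp add: norm_mult abs_mult phase_bound_def mult.assoc)
qed

lemma
  shows cmod_sphere_ft_le: "cmod (sphere_ft v i y t \<xi>) \<le> 1"
    and cmod_sphere_ft_deriv_le: "cmod (sphere_ft_deriv v i y t \<xi>) \<le> phase_bound v i y * norm \<xi>"
    and sphere_ft_has_deriv: "((\<lambda>t. sphere_ft v i y t \<xi>) has_vector_derivative sphere_ft_deriv v i y t \<xi>) (at t)"
    and sphere_ft_deriv_continuous: "continuous_on UNIV (\<lambda>t. sphere_ft_deriv v i y t \<xi>)"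
proof -
  let ?E = "\<lambda>t g. cis (- (2 * pi * (Phi v i y g \<bullet> (t *\<^sub>R \<xi>))))"
  let ?d = "\<lambda>g. - (\<i> * of_real (2 * pi * (Phi v i y g \<bullet> \<xi>)))"
  interpret prob_space ball_measure by (rule prob_space_ball_measure)
  have m: "(\<lambda>g. ?d g * ?E t g) \<in> borel_measurable ball_measure" for t
    by measurable
  have i1: "integrable ball_measure (\<lambda>g. ?E t g)" for t
    by (rule integrable_const_bound[where B=1]) auto
  have i2: "integrable ball_measure (\<lambda>g. ?d g * ?E t g)" for t
    by (rule integrable_const_bound[where B="phase_bound v i y * norm \<xi>"]) (rule AE_I2, rule sphere_ft_deriv_integrand_le, rule m)
  show "cmod (sphere_ft v i y t \<xi>) \<le> 1" unfolding sphere_ft_def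
    by (rule norm_integral_le_const[OF i1]) auto
  show "cmod (sphere_ft_deriv v i y t \<xi>) \<le> phase_bound v i y * norm \<xi>" unfolding sphere_ft_deriv_def
    by (rule norm_integral_le_const[OF i2]) (rule AE_I2, rule sphere_ft_deriv_integrand_le)
  show "((\<lambda>t. sphere_ft v i y t \<xi>) has_vector_derivative sphere_ft_deriv v i y t \<xi>) (at t)"
    unfolding sphere_ft_def sphere_ft_deriv_def
  proof (rule has_vector_derivative_integral[where w="\<lambda>_. phase_bound v i y * norm \<xi>", OF i1])
    have "((\<lambda>t. ?E t g) has_vector_derivative
       ?d g * ?E t g) (at t)" for g t
    proof -
      have "((\<lambda>t. - (2 * pi * (Phi v i y g \<bullet> (t *\<^sub>R \<xi>)))) has_real_derivative - (2 * pi * (Phi v i y g \<bullet> \<xi>))) (at t)"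
        unfolding inner_scaleR_right by (auto intro!: derivative_eq_intros)
      from has_vector_derivative_cis[OF this] show ?thesis by simp
    qed
    then show "AE g in ball_measure. \<forall>t. ((\<lambda>t. ?E t g) has_vector_derivative
       ?d g * ?E t g) (at t) \<and>
       norm (?d g * ?E t g) \<le> phase_bound v i y * norm \<xi>"
      using sphere_ft_deriv_integrand_le by (intro AE_I2) blast
  qed (use m in auto)
  show "continuous_on UNIV (\<lambda>t. sphere_ft_deriv v i y t \<xi>)"
    unfolding sphere_ft_deriv_def
    by (rule continuous_on_lebesgue_integral[where w="\<lambda>_. phase_bound v i y * norm \<xi>", OF m])
       (use sphere_ft_deriv_integrand_le in \<open>auto intro!: continuous_intros\<close>)
qed

text \<open>Here i = j - 1 is the number of frame vectors, so the first assumption is the hypothesis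
  d at least j + 2.\<close>

locale multiplier_setup =
  fixes v :: "nat \<Rightarrow> real^'n" and i :: nat and f m :: "real^'n \<Rightarrow> complex" and B L :: real
  assumes card: "i + 3 \<le> CARD('n)" and rho: "\<And>l. l \<le> i \<Longrightarrow> 0 < rho v l"
    and f: "schwartz f" and m: "smooth_fun m" and mB: "\<And>\<xi>. cmod (m \<xi>) \<le> B * min 1 (L * norm \<xi>)"
    and L: "0 < L" and B: "0 \<le> B"
begin

text \<open>The multiplier operator with the transform replaced by its extension to all frames, and
  its derivative in the dilation parameter.\<close>

definition "F t y x = ift (\<lambda>\<xi>. fourier f \<xi> * (m \<xi> * sphere_ft v i y t \<xi>)) x"
definition "dF t y x = ift (\<lambda>\<xi>. fourier f \<xi> * (m \<xi> * sphere_ft_deriv v i y t \<xi>)) x"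

lemma measurable_fm[measurable]: "fourier f \<in> borel_measurable borel" "m \<in> borel_measurable borel" "f \<in> borel_measurable borel"
proof -
  show "f \<in> borel_measurable borel" by (rule schwartz_measurable[OF f])
  then show "fourier f \<in> borel_measurable borel" by (rule measurable_fourier)
  have "continuous_on UNIV (pderivs [] m)" using m unfolding smooth_fun_def by blast
  then show "m \<in> borel_measurable borel" by (simp add: borel_measurable_continuous_onI)
qed

lemma m_le_B: "cmod (m \<xi>) \<le> B"
  using mB[of \<xi>] mult_left_mono[OF min.cobounded1 B, of 1 "L * norm \<xi>"] by simp

lemma m_le_BL: "cmod (m \<xi>) \<le> B * L * norm \<xi>"
  using mB[of \<xi>] mult_left_mono[OF min.cobounded2 B, of 1 "L * norm \<xi>"] by simp

lemma integrable_fourier_weight: "integrable lborel (\<lambda>\<xi>. cmod (fourier f \<xi>) * (1 + norm \<xi>))"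
  by (rule schwartz_fourier_integrable[OF f])

lemma norm_integrand_le: "cmod (fourier f \<xi> * (m \<xi> * sphere_ft v i y t \<xi>)) \<le> B * (cmod (fourier f \<xi>) * (1 + norm \<xi>))"
proof -
  have "cmod (m \<xi>) * cmod (sphere_ft v i y t \<xi>) \<le> B * (1 + norm \<xi>)"
    using m_le_B cmod_sphere_ft_le[of v i y t \<xi>] B by (intro mult_mono) (auto intro: order_trans)
  then have "cmod (fourier f \<xi>) * (cmod (m \<xi>) * cmod (sphere_ft v i y t \<xi>)) \<le> cmod (fourier f \<xi>) * (B * (1 + norm \<xi>))"
    by (rule mult_left_mono) simp
  then show ?thesis by (simp add: norm_mult mult_ac)
qed

lemma norm_deriv_integrand_le: "cmod (fourier f \<xi> * (m \<xi> * sphere_ft_deriv v i y t \<xi>)) \<le> B * phase_bound v i y * (cmod (fourier f \<xi>) * (1 + norm \<xi>))"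
proof -
  have "cmod (sphere_ft_deriv v i y t \<xi>) \<le> phase_bound v i y * (1 + norm \<xi>)"
    using phase_bound_nonneg by (intro order_trans[OF cmod_sphere_ft_deriv_le] mult_left_mono) auto
  then have "cmod (m \<xi>) * cmod (sphere_ft_deriv v i y t \<xi>) \<le> B * (phase_bound v i y * (1 + norm \<xi>))"
    using m_le_B B by (intro mult_mono) auto
  then have "cmod (fourier f \<xi>) * (cmod (m \<xi>) * cmod (sphere_ft_deriv v i y t \<xi>)) \<le> cmod (fourier f \<xi>) * (B * (phase_bound v i y * (1 + norm \<xi>)))"
    by (rule mult_left_mono) simp
  then show ?thesis by (simp add: norm_mult mult_ac)
qed

lemma integrable_integrand: "integrable lborel (\<lambda>\<xi>. fourier f \<xi> * (m \<xi> * sphere_ft v i y t \<xi>))"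
  by (rule Bochner_Integration.integrable_bound[OF integrable_mult_right[OF integrable_fourier_weight, of B]])
     (auto intro!: order_trans[OF norm_integrand_le] simp del: mult_eq_0_iff)

lemma integrable_deriv_integrand: "integrable lborel (\<lambda>\<xi>. fourier f \<xi> * (m \<xi> * sphere_ft_deriv v i y t \<xi>))"
  by (rule Bochner_Integration.integrable_bound[OF integrable_mult_right[OF integrable_fourier_weight, of "B * phase_bound v i y"]])
     (auto intro!: order_trans[OF norm_deriv_integrand_le] simp del: mult_eq_0_iff)

lemma F_deriv: "((\<lambda>t. F t y x) has_vector_derivative dF t y x) (at t)"
  unfolding F_def dF_def ift_def
proof (rule has_vector_derivative_integral)
  let ?A = "\<lambda>t \<xi>. fourier f \<xi> * (m \<xi> * sphere_ft v i y t \<xi>) * cis (2 * pi * (x \<bullet> \<xi>))"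
  let ?G = "\<lambda>t \<xi>. fourier f \<xi> * (m \<xi> * sphere_ft_deriv v i y t \<xi>) * cis (2 * pi * (x \<bullet> \<xi>))"
  let ?w = "\<lambda>\<xi>. B * phase_bound v i y * (cmod (fourier f \<xi>) * (1 + norm \<xi>))"
  show "integrable lborel (\<lambda>\<xi>. ?A t \<xi>)" for t
    by (rule Bochner_Integration.integrable_bound[OF integrable_integrand[of y t]]) (auto simp: norm_mult)
  show "integrable lborel (\<lambda>\<xi>. ?w \<xi>)"
    by (rule integrable_mult_right[OF integrable_fourier_weight])
  show "AE \<xi> in lborel. \<forall>t. ((\<lambda>t. ?A t \<xi>) has_vector_derivative
      ?G t \<xi>) (at t) \<and>
      norm (?G t \<xi>) \<le> ?w \<xi>"
  proof (intro AE_I2 allI conjI)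
    fix \<xi> t
    show "((\<lambda>t. ?A t \<xi>) has_vector_derivative
      ?G t \<xi>) (at t)"
      by (intro has_vector_derivative_mult_left has_vector_derivative_mult_right sphere_ft_has_deriv)
    show "norm (?G t \<xi>) \<le> ?w \<xi>"
      using norm_deriv_integrand_le[of \<xi> y t] by (simp add: norm_mult)
  qed
qed simp

lemma dF_continuous: "continuous_on UNIV (\<lambda>t. dF t y x)"
  unfolding dF_def ift_def
proof (rule continuous_on_lebesgue_integral)
  let ?G = "\<lambda>t \<xi>. fourier f \<xi> * (m \<xi> * sphere_ft_deriv v i y t \<xi>) * cis (2 * pi * (x \<bullet> \<xi>))"
  let ?w = "\<lambda>\<xi>. B * phase_bound v i y * (cmod (fourier f \<xi>) * (1 + norm \<xi>))"
  show "integrable lborel (\<lambda>\<xi>. ?w \<xi>)"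
    by (rule integrable_mult_right[OF integrable_fourier_weight])
  show "norm (?G t \<xi>) \<le> ?w \<xi>" for t \<xi>
    using norm_deriv_integrand_le[of \<xi> y t] by (simp add: norm_mult)
  show "continuous_on UNIV (\<lambda>t. ?G t \<xi>)" for \<xi>
    by (intro continuous_intros sphere_ft_deriv_continuous)
qed simp

definition "integrand s y x = ennreal (1 / L) * ennreal ((cmod (F s y x))\<^sup>2) + ennreal L * ennreal ((cmod (dF s y x))\<^sup>2)"

text \<open>The fundamental theorem for |F|^2 produces 2 |F| |F'|, split as |F|^2 / L + L |F'|^2.
  The weight L balances the halves, since the L2 bound for |F|^2 carries a factor L^2 that the one
  for |F'|^2 lacks.\<close>

lemma sup_bound:
  assumes t: "a \<le> t" "t \<le> b"
  shows "ennreal ((cmod (F t y x))\<^sup>2) \<le> ennreal ((cmod (F a y x))\<^sup>2) + (\<integral>\<^sup>+s. indicator {a..b} s * integrand s y x \<partial>lborel)"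
proof -
  define u where "u s = F s y x" for s
  define u' where "u' s = dF s y x" for s
  have du: "(u has_vector_derivative u' s) (at s within A)" for s A
    unfolding u_def u'_def using F_deriv has_vector_derivative_at_within by blast
  have cu': "continuous_on A u'" for A unfolding u'_def using dF_continuous continuous_on_subset by blast
  have cu: "continuous_on A u" for A
    by (rule continuous_on_vector_derivative) (rule du)
  let ?d = "\<lambda>s. indicator {a..t} s *\<^sub>R (2 * (u s \<bullet> u' s))"
  have "(\<integral>s. ?d s \<partial>lborel) = (cmod (u t))\<^sup>2 - (cmod (u a))\<^sup>2"
  proof (rule integral_FTC_Icc)
    show "((\<lambda>s. (cmod (u s))\<^sup>2) has_vector_derivative 2 * (u s \<bullet> u' s)) (at s within {a..t})" for s
    proof -
      have "((\<lambda>s. u s \<bullet> u s) has_derivative (\<lambda>h. u s \<bullet> (h *\<^sub>R u' s) + (h *\<^sub>R u' s) \<bullet> u s)) (at s within {a..t})"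
        using du[of s "{a..t}"] unfolding has_vector_derivative_def by (intro has_derivative_inner)
      then show ?thesis unfolding has_vector_derivative_def power2_norm_eq_inner
        by (simp add: inner_commute mult_ac)
    qed
    show "continuous_on {a..t} (\<lambda>s. 2 * (u s \<bullet> u' s))" by (intro continuous_intros cu cu')
  qed (use t in simp)
  then have "(cmod (u t))\<^sup>2 \<le> (cmod (u a))\<^sup>2 + norm (\<integral>s. ?d s \<partial>lborel)"
    by simp
  from ennreal_leI[OF this] have le: "ennreal ((cmod (u t))\<^sup>2) \<le> ennreal ((cmod (u a))\<^sup>2) + ennreal (norm (\<integral>s. ?d s \<partial>lborel))"
    by (simp only: ennreal_plus zero_le_power2 norm_ge_zero)
  have "ennreal (norm (\<integral>s. ?d s \<partial>lborel)) \<le> (\<integral>\<^sup>+s. ennreal (norm (?d s)) \<partial>lborel)"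
    by (rule ennreal_norm_integral_le)
  also have "\<dots> \<le> (\<integral>\<^sup>+s. indicator {a..b} s * integrand s y x \<partial>lborel)"
  proof (rule nn_integral_mono)
    fix s
    show "ennreal (norm (?d s)) \<le> indicator {a..b} s * integrand s y x"
    proof (cases "s \<in> {a..t}")
      case True
      define p q where "p = cmod (u s)" and "q = cmod (u' s)"
      have "\<bar>u s \<bullet> u' s\<bar> \<le> p * q" unfolding p_def q_def by (rule Cauchy_Schwarz_ineq2)
      moreover have "2 * (p * q) \<le> 1 / L * p\<^sup>2 + L * q\<^sup>2"
      proof -
        have "0 \<le> (p - L * q)\<^sup>2 / L" using L by simp
        also have "\<dots> = 1 / L * p\<^sup>2 + L * q\<^sup>2 - 2 * (p * q)"
          using L by (simp add: power2_eq_square field_simps)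
        finally show ?thesis by simp
      qed
      ultimately have "norm (2 * (u s \<bullet> u' s)) \<le> 1 / L * p\<^sup>2 + L * q\<^sup>2" by (simp add: abs_mult)
      then have "ennreal (norm (2 * (u s \<bullet> u' s))) \<le> ennreal (1 / L * p\<^sup>2 + L * q\<^sup>2)" by (rule ennreal_leI)
      also have "\<dots> = integrand s y x"
      proof -
        have "ennreal (1 / L * p\<^sup>2 + L * q\<^sup>2) = ennreal (1 / L * p\<^sup>2) + ennreal (L * q\<^sup>2)"
          using L by (intro ennreal_plus) auto
        moreover have "ennreal (1 / L * p\<^sup>2) = ennreal (1 / L) * ennreal (p\<^sup>2)" using L by (intro ennreal_mult) auto
        moreover have "ennreal (L * q\<^sup>2) = ennreal L * ennreal (q\<^sup>2)" using L by (intro ennreal_mult) auto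
        ultimately show ?thesis by (simp only: integrand_def p_def q_def u_def u'_def)
      qed
      finally show ?thesis using True t by simp
    qed simp
  qed
  finally show ?thesis using order_trans[OF le add_left_mono] by (simp add: u_def)
qed

end

section \<open>L2 bounds and their averages over frames\<close>

context multiplier_setup
begin

lemma measurable_F[measurable]:
  assumes [measurable]: "t \<in> borel_measurable M" "y \<in> M \<rightarrow>\<^sub>M borel" "x \<in> borel_measurable M"
  shows "(\<lambda>w. F (t w) (y w) (x w)) \<in> borel_measurable M"
    and "(\<lambda>w. dF (t w) (y w) (x w)) \<in> borel_measurable M"
proof -
  show "(\<lambda>w. F (t w) (y w) (x w)) \<in> borel_measurable M"
    unfolding F_def by (rule measurable_ift_param) measurable
  show "(\<lambda>w. dF (t w) (y w) (x w)) \<in> borel_measurable M"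
    unfolding dF_def by (rule measurable_ift_param) measurable
qed

lemma measurable_integrand[measurable]:
  assumes [measurable]: "t \<in> borel_measurable M" "y \<in> M \<rightarrow>\<^sub>M borel" "x \<in> borel_measurable M"
  shows "(\<lambda>w. integrand (t w) (y w) (x w)) \<in> borel_measurable M"
  unfolding integrand_def by measurable

text \<open>The common frequency-side density for F and its derivative. The factor |\<xi>|^2 comes
  from the bound on \<open>m\<close> in the one case and from the differentiation in the
  other.\<close>

definition "u s y \<xi> = ennreal ((cmod (fourier f \<xi>))\<^sup>2 * (norm \<xi>)\<^sup>2 / (1 + s\<^sup>2 * (norm (perp y i \<xi>))\<^sup>2))"

definition "U s y = (\<integral>\<^sup>+\<xi>. u s y \<xi> \<partial>lborel)"

lemma measurable_u[measurable]:
  assumes [measurable]: "s \<in> borel_measurable M" "y \<in> M \<rightarrow>\<^sub>M borel" "\<xi> \<in> borel_measurable M"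
  shows "(\<lambda>w. u (s w) (y w) (\<xi> w)) \<in> borel_measurable M"
  unfolding u_def by measurable

lemma measurable_U[measurable]:
  assumes [measurable]: "s \<in> borel_measurable M" "y \<in> M \<rightarrow>\<^sub>M borel"
  shows "(\<lambda>w. U (s w) (y w)) \<in> borel_measurable M"
  unfolding U_def by measurable

abbreviation "D \<equiv> decay_const v i"

lemma power2_product_le:
  fixes a b c K n q :: real
  assumes "b\<^sup>2 * (q * c\<^sup>2) \<le> K * n" "0 < q"
  shows "a\<^sup>2 * (b\<^sup>2 * c\<^sup>2) \<le> K * (a\<^sup>2 * n / q)"
proof -
  have "b\<^sup>2 * c\<^sup>2 \<le> K * n / q" using assms by (simp add: pos_le_divide_eq mult_ac)
  then have "a\<^sup>2 * (b\<^sup>2 * c\<^sup>2) \<le> a\<^sup>2 * (K * n / q)" by (rule mult_left_mono) simp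
  then show ?thesis by (simp add: mult_ac)
qed

lemma ift_square_integral_le:
  assumes int: "integrable lborel (\<lambda>\<xi>. fourier f \<xi> * (m \<xi> * a \<xi>))" and K: "0 \<le> K"
    and le: "\<And>\<xi>. (cmod (m \<xi>))\<^sup>2 * ((1 + s\<^sup>2 * (norm (perp y i \<xi>))\<^sup>2) * (cmod (a \<xi>))\<^sup>2) \<le> K * (norm \<xi>)\<^sup>2"
  shows "(\<integral>\<^sup>+x. ennreal ((cmod (ift (\<lambda>\<xi>. fourier f \<xi> * (m \<xi> * a \<xi>)) x))\<^sup>2) \<partial>lborel) \<le> ennreal K * U s y"
proof -
  have "(\<integral>\<^sup>+x. ennreal ((cmod (ift (\<lambda>\<xi>. fourier f \<xi> * (m \<xi> * a \<xi>)) x))\<^sup>2) \<partial>lborel)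
      \<le> (\<integral>\<^sup>+\<xi>. ennreal ((cmod (fourier f \<xi> * (m \<xi> * a \<xi>)))\<^sup>2) \<partial>lborel)"
    by (rule plancherel_ift_le[OF int])
  also have "\<dots> \<le> (\<integral>\<^sup>+\<xi>. ennreal K * u s y \<xi> \<partial>lborel)"
  proof (rule nn_integral_mono)
    fix \<xi>
    have q: "0 < 1 + s\<^sup>2 * (norm (perp y i \<xi>))\<^sup>2" by (simp add: add_pos_nonneg)
    have "(cmod (fourier f \<xi> * (m \<xi> * a \<xi>)))\<^sup>2
        \<le> K * ((cmod (fourier f \<xi>))\<^sup>2 * (norm \<xi>)\<^sup>2 / (1 + s\<^sup>2 * (norm (perp y i \<xi>))\<^sup>2))"
      unfolding norm_mult power_mult_distrib by (rule power2_product_le[OF le q])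
    from ennreal_leI[OF this]
    show "ennreal ((cmod (fourier f \<xi> * (m \<xi> * a \<xi>)))\<^sup>2) \<le> ennreal K * u s y \<xi>"
      unfolding u_def using K q by (subst ennreal_mult[symmetric]) auto
  qed
  also have "\<dots> = ennreal K * U s y" unfolding U_def by (rule nn_integral_cmult) measurable
  finally show ?thesis .
qed

text \<open>For F the bound B L |\<xi>| of \<open>m\<close> is used, which pays for |\<xi>|^2 and
  gains L^2. For the derivative the bound B is used, because |\<xi>|^2 is already present in its
  decay estimate.\<close>

lemma F_square_integral_le:
  assumes g: "gram v i y" and s: "0 \<le> s"
  shows "(\<integral>\<^sup>+x. ennreal ((cmod (F s y x))\<^sup>2) \<partial>lborel) \<le> ennreal (B\<^sup>2 * L\<^sup>2 * D) * U s y"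
    and "(\<integral>\<^sup>+x. ennreal ((cmod (dF s y x))\<^sup>2) \<partial>lborel) \<le> ennreal (B\<^sup>2 * D) * U s y"
proof -
  let ?q = "\<lambda>\<xi>. 1 + s\<^sup>2 * (norm (perp y i \<xi>))\<^sup>2"
  have i': "i < CARD('n)" using card by simp
  have D: "0 \<le> D" by (rule decay_const_nonneg)
  have mB2: "(cmod (m \<xi>))\<^sup>2 \<le> B\<^sup>2" for \<xi> using m_le_B by (intro power_mono) auto
  have mBL2: "(cmod (m \<xi>))\<^sup>2 \<le> B\<^sup>2 * L\<^sup>2 * (norm \<xi>)\<^sup>2" for \<xi>
    using power_mono[OF m_le_BL[of \<xi>] norm_ge_zero, of 2] by (simp add: power_mult_distrib)
  show "(\<integral>\<^sup>+x. ennreal ((cmod (F s y x))\<^sup>2) \<partial>lborel) \<le> ennreal (B\<^sup>2 * L\<^sup>2 * D) * U s y"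
    unfolding F_def
  proof (rule ift_square_integral_le[OF integrable_integrand])
    fix \<xi>
    have "?q \<xi> * (cmod (sphere_ft v i y s \<xi>))\<^sup>2 \<le> D"
      unfolding sphere_ft_eq[OF g i'] by (rule frame_sigma_decay(1)[OF g card rho s]) simp
    then have "(cmod (m \<xi>))\<^sup>2 * (?q \<xi> * (cmod (sphere_ft v i y s \<xi>))\<^sup>2) \<le> B\<^sup>2 * L\<^sup>2 * (norm \<xi>)\<^sup>2 * D"
      by (rule mult_mono[OF mBL2]) auto
    then show "(cmod (m \<xi>))\<^sup>2 * (?q \<xi> * (cmod (sphere_ft v i y s \<xi>))\<^sup>2) \<le> B\<^sup>2 * L\<^sup>2 * D * (norm \<xi>)\<^sup>2"
      by (simp add: mult_ac)
  qed (use D in auto)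
  show "(\<integral>\<^sup>+x. ennreal ((cmod (dF s y x))\<^sup>2) \<partial>lborel) \<le> ennreal (B\<^sup>2 * D) * U s y"
    unfolding dF_def
  proof (rule ift_square_integral_le[OF integrable_deriv_integrand])
    fix \<xi>
    have "?q \<xi> * (cmod (sphere_ft_deriv v i y s \<xi>))\<^sup>2 \<le> D * (norm \<xi>)\<^sup>2"
      unfolding sphere_ft_deriv_eq[OF g i'] by (rule frame_sigma_decay(2)[OF g card rho s]) simp
    then have "(cmod (m \<xi>))\<^sup>2 * (?q \<xi> * (cmod (sphere_ft_deriv v i y s \<xi>))\<^sup>2) \<le> B\<^sup>2 * (D * (norm \<xi>)\<^sup>2)"
      by (rule mult_mono[OF mB2]) auto
    then show "(cmod (m \<xi>))\<^sup>2 * (?q \<xi> * (cmod (sphere_ft_deriv v i y s \<xi>))\<^sup>2) \<le> B\<^sup>2 * D * (norm \<xi>)\<^sup>2"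
      by (simp add: mult_ac)
  qed (use D in auto)
qed

abbreviation "y0 \<equiv> (\<lambda>_::nat. 0 :: real^'n)"

abbreviation "avg \<equiv> ball_frame_int v i 0 y0"

abbreviation "frame_avg \<equiv> frame_int v i (Suc 0) y0"

lemma gram_0: "gram v 0 y0"
  by (simp add: gram_def)

definition "norm2 = (\<integral>x. (cmod (f x))\<^sup>2 \<partial>lborel)"

lemma norm2_nonneg: "0 \<le> norm2"
  unfolding norm2_def by simp

lemma fourier_square_integral_le: "(\<integral>\<^sup>+\<xi>. ennreal ((cmod (fourier f \<xi>))\<^sup>2) \<partial>lborel) \<le> ennreal norm2"
proof -
  have "(\<integral>\<^sup>+x. ennreal ((cmod (f x))\<^sup>2) \<partial>lborel) = ennreal norm2"
    unfolding norm2_def by (rule nn_integral_eq_integral[OF schwartz_square_integrable[OF f]]) simp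
  then show ?thesis using plancherel_fourier_le[of f] schwartz_integrable[OF f lists.Nil] by simp
qed

text \<open>With \<delta> = 1 / s^2 the weight is |\<xi>|^2 / (s^2 (\<delta> + |P \<xi>|^2)), P
  being the projection \<open>perp y i\<close>. Averaging replaces P \<xi> by \<xi> at the cost of
  2^i, and the remaining quotient |\<xi>|^2 / (\<delta> + |\<xi>|^2) is at most 1.\<close>

lemma ball_frame_int_U_le:
  assumes s: "0 < s"
  shows "avg (U s) \<le> ennreal (2 ^ i / s\<^sup>2 * norm2)"
proof -
  have pt: "avg (\<lambda>y. u s y \<xi>) \<le> ennreal (2 ^ i / s\<^sup>2) * ennreal ((cmod (fourier f \<xi>))\<^sup>2)" for \<xi>
  proof -
    define c where "c = (cmod (fourier f \<xi>))\<^sup>2 * (norm \<xi>)\<^sup>2 / s\<^sup>2"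
    define \<delta> where "\<delta> = 1 / s\<^sup>2"
    have c: "0 \<le> c" and \<delta>: "0 < \<delta>" using s by (auto simp: c_def \<delta>_def)
    have ueq: "u s y \<xi> = ennreal c * ennreal (1 / (\<delta> + (norm (perp y (0 + i) \<xi>))\<^sup>2))" for y
    proof -
      have "(cmod (fourier f \<xi>))\<^sup>2 * (norm \<xi>)\<^sup>2 / (1 + s\<^sup>2 * (norm (perp y i \<xi>))\<^sup>2) = c * (1 / (\<delta> + (norm (perp y i \<xi>))\<^sup>2))"
        using s by (simp add: c_def \<delta>_def field_simps)
      then show ?thesis unfolding u_def using c \<delta> by (simp add: ennreal_mult[symmetric])
    qed
    have meas: "(\<lambda>y. ennreal (1 / (\<delta> + (norm (perp y (0 + i) \<xi>))\<^sup>2))) \<in> borel_measurable borel" by measurable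
    have "avg (\<lambda>y. u s y \<xi>) = ennreal c * avg (\<lambda>y. ennreal (1 / (\<delta> + (norm (perp y (0 + i) \<xi>))\<^sup>2)))"
      unfolding ueq by (rule ball_frame_int_cmult[OF meas])
    also have "avg (\<lambda>y. ennreal (1 / (\<delta> + (norm (perp y (0 + i) \<xi>))\<^sup>2)))
       = frame_avg (\<lambda>y. ennreal (1 / (\<delta> + (norm (perp y (0 + i) \<xi>))\<^sup>2)))"
      by (rule frame_int_eq_ball_frame_int[OF meas gram_0, symmetric]) (use card in simp)
    also have "\<dots> \<le> ennreal (2 ^ i / (\<delta> + (norm (perp y0 0 \<xi>))\<^sup>2))"
      by (rule frame_int_average[OF gram_0 _ _ \<delta>]) (use card rho in auto)
    finally have "avg (\<lambda>y. u s y \<xi>) \<le> ennreal c * ennreal (2 ^ i / (\<delta> + (norm \<xi>)\<^sup>2))"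
      by (simp add: mult_left_mono)
    also have "\<dots> = ennreal (c * (2 ^ i / (\<delta> + (norm \<xi>)\<^sup>2)))"
      using c \<delta> by (intro ennreal_mult[symmetric]) auto
    also have "\<dots> \<le> ennreal (2 ^ i / s\<^sup>2 * (cmod (fourier f \<xi>))\<^sup>2)"
    proof (rule ennreal_leI)
      have "(norm \<xi>)\<^sup>2 / (\<delta> + (norm \<xi>)\<^sup>2) \<le> 1" using \<delta> by (simp add: divide_le_eq_1 add_pos_nonneg)
      then have "2 ^ i / s\<^sup>2 * (cmod (fourier f \<xi>))\<^sup>2 * ((norm \<xi>)\<^sup>2 / (\<delta> + (norm \<xi>)\<^sup>2)) \<le> 2 ^ i / s\<^sup>2 * (cmod (fourier f \<xi>))\<^sup>2 * 1"
        by (intro mult_left_mono) auto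
      then show "c * (2 ^ i / (\<delta> + (norm \<xi>)\<^sup>2)) \<le> 2 ^ i / s\<^sup>2 * (cmod (fourier f \<xi>))\<^sup>2"
        by (simp add: c_def mult_ac)
    qed
    also have "\<dots> = ennreal (2 ^ i / s\<^sup>2) * ennreal ((cmod (fourier f \<xi>))\<^sup>2)" by (rule ennreal_mult) auto
    finally show ?thesis .
  qed
  have "avg (U s) = (\<integral>\<^sup>+\<xi>. avg (\<lambda>y. u s y \<xi>) \<partial>lborel)"
    unfolding U_def[abs_def]
    by (rule ball_frame_int_swap[OF sigma_finite_lborel, where H="\<lambda>\<xi> y. u s y \<xi>"]) measurable
  also have "\<dots> \<le> (\<integral>\<^sup>+\<xi>. ennreal (2 ^ i / s\<^sup>2) * ennreal ((cmod (fourier f \<xi>))\<^sup>2) \<partial>lborel)"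
    by (rule nn_integral_mono) (rule pt)
  also have "\<dots> = ennreal (2 ^ i / s\<^sup>2) * (\<integral>\<^sup>+\<xi>. ennreal ((cmod (fourier f \<xi>))\<^sup>2) \<partial>lborel)"
    by (rule nn_integral_cmult) measurable
  also have "\<dots> \<le> ennreal (2 ^ i / s\<^sup>2) * ennreal norm2"
    by (rule mult_left_mono[OF fourier_square_integral_le]) simp
  also have "\<dots> = ennreal (2 ^ i / s\<^sup>2 * norm2)" using norm2_nonneg by (intro ennreal_mult[symmetric]) auto
  finally show ?thesis .
qed

text \<open>A majorant of |F|^2 for all parameters between a and b at once; \<open>Z\<close> is the
  resulting majorant of its integral over x.\<close>

definition "H a b y x = ennreal ((cmod (F a y x))\<^sup>2) + (\<integral>\<^sup>+s. indicator {a..b} s * integrand s y x \<partial>lborel)"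

definition "Z a b y = ennreal (B\<^sup>2 * L\<^sup>2 * D) * U a y + (\<integral>\<^sup>+s. indicator {a..b} s * (ennreal (2 * B\<^sup>2 * D * L) * U s y) \<partial>lborel)"

lemma measurable_H[measurable]:
  assumes [measurable]: "y \<in> M \<rightarrow>\<^sub>M borel" "x \<in> borel_measurable M"
  shows "(\<lambda>w. H a b (y w) (x w)) \<in> borel_measurable M"
  unfolding H_def by measurable

lemma measurable_Z[measurable]:
  assumes [measurable]: "y \<in> M \<rightarrow>\<^sub>M borel"
  shows "(\<lambda>w. Z a b (y w)) \<in> borel_measurable M"
  unfolding Z_def by measurable

lemma H_integral_le:
  assumes g: "gram v i y" and a: "0 < a"
  shows "(\<integral>\<^sup>+x. H a b y x \<partial>lborel) \<le> Z a b y"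
proof -
  have D: "0 \<le> D" by (rule decay_const_nonneg)
  have "(\<integral>\<^sup>+x. H a b y x \<partial>lborel) = (\<integral>\<^sup>+x. ennreal ((cmod (F a y x))\<^sup>2) \<partial>lborel) + (\<integral>\<^sup>+x. (\<integral>\<^sup>+s. indicator {a..b} s * integrand s y x \<partial>lborel) \<partial>lborel)"
    unfolding H_def by (rule nn_integral_add) measurable
  also have "(\<integral>\<^sup>+x. (\<integral>\<^sup>+s. indicator {a..b} s * integrand s y x \<partial>lborel) \<partial>lborel) = (\<integral>\<^sup>+s. (\<integral>\<^sup>+x. indicator {a..b} s * integrand s y x \<partial>lborel) \<partial>lborel)"
    by (rule lborel_pair.Fubini') measurable
  also have "\<dots> \<le> (\<integral>\<^sup>+s. indicator {a..b} s * (ennreal (2 * B\<^sup>2 * D * L) * U s y) \<partial>lborel)"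
  proof (rule nn_integral_mono)
    fix s
    have "(\<integral>\<^sup>+x. integrand s y x \<partial>lborel) \<le> ennreal (2 * B\<^sup>2 * D * L) * U s y" if s: "0 \<le> s"
    proof -
      have "(\<integral>\<^sup>+x. integrand s y x \<partial>lborel) = ennreal (1 / L) * (\<integral>\<^sup>+x. ennreal ((cmod (F s y x))\<^sup>2) \<partial>lborel) + ennreal L * (\<integral>\<^sup>+x. ennreal ((cmod (dF s y x))\<^sup>2) \<partial>lborel)"
        unfolding integrand_def by (subst nn_integral_add) (simp_all add: nn_integral_cmult)
      also have "\<dots> \<le> ennreal (1 / L) * (ennreal (B\<^sup>2 * L\<^sup>2 * D) * U s y) + ennreal L * (ennreal (B\<^sup>2 * D) * U s y)"
        by (intro add_mono mult_left_mono F_square_integral_le[OF g s]) auto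
      also have "\<dots> = (ennreal (1 / L) * ennreal (B\<^sup>2 * L\<^sup>2 * D) + ennreal L * ennreal (B\<^sup>2 * D)) * U s y"
        by (simp only: distrib_right mult.assoc)
      also have "ennreal (1 / L) * ennreal (B\<^sup>2 * L\<^sup>2 * D) = ennreal (1 / L * (B\<^sup>2 * L\<^sup>2 * D))"
        using L D by (intro ennreal_mult[symmetric]) auto
      also have "ennreal L * ennreal (B\<^sup>2 * D) = ennreal (L * (B\<^sup>2 * D))"
        using L D by (intro ennreal_mult[symmetric]) auto
      also have "ennreal (1 / L * (B\<^sup>2 * L\<^sup>2 * D)) + ennreal (L * (B\<^sup>2 * D)) = ennreal (1 / L * (B\<^sup>2 * L\<^sup>2 * D) + L * (B\<^sup>2 * D))"
        using L D by (intro ennreal_plus[symmetric]) auto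
      also have "1 / L * (B\<^sup>2 * L\<^sup>2 * D) + L * (B\<^sup>2 * D) = 2 * B\<^sup>2 * D * L"
        using L by (simp add: power2_eq_square)
      finally show ?thesis .
    qed
    then show "(\<integral>\<^sup>+x. indicator {a..b} s * integrand s y x \<partial>lborel) \<le> indicator {a..b} s * (ennreal (2 * B\<^sup>2 * D * L) * U s y)"
      using a by (cases "s \<in> {a..b}") auto
  qed
  finally show ?thesis unfolding Z_def
    using F_square_integral_le(1)[OF g less_imp_le[OF a]] by (meson add_mono order_trans add_left_mono add_right_mono)
qed

text \<open>The integral of 1 / s^2 over [a, b] is at most 1 / a, so b disappears and this part
  contributes 2. The endpoint term carries (L / a)^2, which is at most L / a because L is at most a,
  and contributes 1; together these are the constant 3.\<close>

lemma ball_frame_int_Z_le: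
  assumes a: "0 < a" and ab: "a \<le> b" and La: "L \<le> a"
  shows "avg (Z a b) \<le> ennreal (3 * B\<^sup>2 * D * 2 ^ i * (L / a) * norm2)"
proof -
  have D: "0 \<le> D" by (rule decay_const_nonneg)
  define c where "c = B\<^sup>2 * D * 2 ^ i * norm2"
  have c: "0 \<le> c" using D norm2_nonneg by (simp add: c_def)
  have mU: "U s \<in> borel_measurable borel" for s
    using measurable_U[of "\<lambda>_. s" borel "\<lambda>y. y"] by simp
  have "avg (Z a b) = avg (\<lambda>y. ennreal (B\<^sup>2 * L\<^sup>2 * D) * U a y)
      + avg (\<lambda>y. \<integral>\<^sup>+s. indicator {a..b} s * (ennreal (2 * B\<^sup>2 * D * L) * U s y) \<partial>lborel)"
    unfolding Z_def[abs_def] by (rule ball_frame_int_add) measurable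
  also have "avg (\<lambda>y. ennreal (B\<^sup>2 * L\<^sup>2 * D) * U a y) = ennreal (B\<^sup>2 * L\<^sup>2 * D) * avg (U a)"
    by (rule ball_frame_int_cmult[OF mU])
  also have "avg (\<lambda>y. \<integral>\<^sup>+s. indicator {a..b} s * (ennreal (2 * B\<^sup>2 * D * L) * U s y) \<partial>lborel)
     = (\<integral>\<^sup>+s. avg (\<lambda>y. indicator {a..b} s * (ennreal (2 * B\<^sup>2 * D * L) * U s y)) \<partial>lborel)"
    by (rule ball_frame_int_swap[OF sigma_finite_lborel, where H="\<lambda>s y. indicator {a..b} s * (ennreal (2 * B\<^sup>2 * D * L) * U s y)"]) measurable
  also have "\<dots> = (\<integral>\<^sup>+s. indicator {a..b} s * (ennreal (2 * B\<^sup>2 * D * L) * avg (U s)) \<partial>lborel)"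
    by (intro nn_integral_cong) (simp add: ball_frame_int_cmult mU)
  also have "\<dots> \<le> (\<integral>\<^sup>+s. ennreal (2 * L * c / s\<^sup>2) * indicator {a..b} s \<partial>lborel)"
  proof (rule nn_integral_mono)
    fix s
    show "indicator {a..b} s * (ennreal (2 * B\<^sup>2 * D * L) * avg (U s)) \<le> ennreal (2 * L * c / s\<^sup>2) * indicator {a..b} s"
    proof (cases "s \<in> {a..b}")
      case True
      then have s: "0 < s" using a by simp
      have "ennreal (2 * B\<^sup>2 * D * L) * avg (U s) \<le> ennreal (2 * B\<^sup>2 * D * L) * ennreal (2 ^ i / s\<^sup>2 * norm2)"
        by (rule mult_left_mono[OF ball_frame_int_U_le[OF s]]) simp
      also have "\<dots> = ennreal (2 * B\<^sup>2 * D * L * (2 ^ i / s\<^sup>2 * norm2))"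
        using D L norm2_nonneg by (intro ennreal_mult[symmetric]) auto
      also have "2 * B\<^sup>2 * D * L * (2 ^ i / s\<^sup>2 * norm2) = 2 * L * c / s\<^sup>2" by (simp add: c_def)
      finally show ?thesis using True by simp
    qed simp
  qed
  also have "(\<integral>\<^sup>+s. ennreal (2 * L * c / s\<^sup>2) * indicator {a..b} s \<partial>lborel) = ennreal (- (2 * L * c) / b - (- (2 * L * c) / a))"
  proof (rule nn_integral_FTC_Icc[where F="\<lambda>s. - (2 * L * c) / s"])
    show "((\<lambda>s. - (2 * L * c) / s) has_real_derivative 2 * L * c / s\<^sup>2) (at s)" if "s \<in> {a..b}" for s
      using that a by (auto intro!: derivative_eq_intros simp: power2_eq_square)
    show "0 \<le> 2 * L * c / s\<^sup>2" if "s \<in> {a..b}" for s using L c by simp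
  qed (use ab in auto)
  also have "\<dots> \<le> ennreal (2 * L * c / a)"
    using L c a ab by (intro ennreal_leI) (simp add: divide_nonneg_pos)
  also have "ennreal (B\<^sup>2 * L\<^sup>2 * D) * avg (U a) \<le> ennreal (L * c / a)"
  proof -
    have "ennreal (B\<^sup>2 * L\<^sup>2 * D) * avg (U a) \<le> ennreal (B\<^sup>2 * L\<^sup>2 * D) * ennreal (2 ^ i / a\<^sup>2 * norm2)"
      by (rule mult_left_mono[OF ball_frame_int_U_le[OF a]]) simp
    also have "\<dots> = ennreal (B\<^sup>2 * L\<^sup>2 * D * (2 ^ i / a\<^sup>2 * norm2))"
      using D norm2_nonneg by (intro ennreal_mult[symmetric]) auto
    also have "B\<^sup>2 * L\<^sup>2 * D * (2 ^ i / a\<^sup>2 * norm2) = (L / a) * (L * c / a)"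
      by (simp add: c_def power2_eq_square)
    also have "ennreal ((L / a) * (L * c / a)) \<le> ennreal (1 * (L * c / a))"
      using L c a La by (intro ennreal_leI mult_right_mono) auto
    finally show ?thesis by simp
  qed
  finally have "avg (Z a b) \<le> ennreal (L * c / a) + ennreal (2 * L * c / a)"
    by (simp add: add_mono add_left_mono add_right_mono)
  also have "\<dots> = ennreal (L * c / a + 2 * L * c / a)" using L c a by (intro ennreal_plus[symmetric]) auto
  also have "L * c / a + 2 * L * c / a = 3 * B\<^sup>2 * D * 2 ^ i * (L / a) * norm2" by (simp add: c_def)
  finally show ?thesis .
qed

text \<open>After Cauchy-Schwarz over frames the integrand is bounded by \<open>H\<close>, which
  does not involve the dilation parameter, so the supremum disappears pointwise in x and the
  integral over x can be moved inside the average.\<close>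

lemma max_op_le:
  assumes a: "0 < a" and ab: "a \<le> b" and La: "L \<le> a"
  shows "(\<integral>\<^sup>+x. (max_op v (Suc i) a b m f x)\<^sup>2 \<partial>lborel) \<le> ennreal (3 * B\<^sup>2 * D * 2 ^ i * (L / a) * norm2)"
proof -
  have i': "i < CARD('n)" "0 + i \<le> CARD('n)" using card by auto
  have mH: "H a b y \<in> borel_measurable borel" "(\<lambda>y. H a b y x) \<in> borel_measurable borel" for x y
    using measurable_H[of "\<lambda>_. y" borel "\<lambda>x. x" a b] measurable_H[of "\<lambda>y. y" borel "\<lambda>_. x" a b] by simp_all
  have "(max_op v (Suc i) a b m f x)\<^sup>2 \<le> avg (\<lambda>y. H a b y x)" for x
  proof -
    define G where "G t y = ennreal (cmod (multiplier_op (\<lambda>\<xi>. m \<xi> * fourier_measure (frame_sigma v (Suc i) y) (t *\<^sub>R \<xi>)) f x))" for t y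
    have GF: "(G t y)\<^sup>2 \<le> H a b y x" if "gram v (0 + i) y" "t \<in> {a..b}" for t y
    proof -
      have g: "gram v i y" using that by simp
      have "multiplier_op (\<lambda>\<xi>. m \<xi> * fourier_measure (frame_sigma v (Suc i) y) (t *\<^sub>R \<xi>)) f x = F t y x"
        unfolding multiplier_op_def F_def ift_def sphere_ft_eq[OF g i'(1)] ..
      then have "(G t y)\<^sup>2 = ennreal ((cmod (F t y x))\<^sup>2)" by (simp add: G_def ennreal_power)
      then show ?thesis unfolding H_def using sup_bound[of a t b y x] that by simp
    qed
    have le: "(frame_avg (G t))\<^sup>2 \<le> avg (\<lambda>y. H a b y x)" if t: "t \<in> {a..b}" for t
    proof -
      have "(frame_avg (G t))\<^sup>2 \<le> frame_avg (\<lambda>y. (G t y)\<^sup>2)"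
        by (rule frame_int_power2_le[OF gram_0 i'(2)])
      also have "\<dots> \<le> frame_avg (\<lambda>y. H a b y x)"
        by (rule frame_int_mono_gram[OF gram_0 i'(2)]) (rule GF[OF _ t])
      also have "\<dots> = avg (\<lambda>y. H a b y x)"
        by (rule frame_int_eq_ball_frame_int[OF mH(2) gram_0 i'(2)])
      finally show ?thesis .
    qed
    have mo: "max_op v (Suc i) a b m f x = (SUP t\<in>{a..b}. frame_avg (G t))"
      unfolding max_op_def G_def by simp
    have "(max_op v (Suc i) a b m f x)\<^sup>2 = (SUP t\<in>{a..b}. SUP s\<in>{a..b}. frame_avg (G t) * frame_avg (G s))"
      unfolding mo power2_eq_square by (simp add: SUP_mult_left_ennreal SUP_mult_right_ennreal mult.commute)
    also have "\<dots> \<le> avg (\<lambda>y. H a b y x)"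
    proof (intro SUP_least)
      fix t s assume "t \<in> {a..b}" "s \<in> {a..b}"
      then have "(max (frame_avg (G t)) (frame_avg (G s)))\<^sup>2 \<le> avg (\<lambda>y. H a b y x)"
        using le by (auto simp: max_def)
      moreover have "frame_avg (G t) * frame_avg (G s) \<le> (max (frame_avg (G t)) (frame_avg (G s)))\<^sup>2"
        unfolding power2_eq_square by (intro mult_mono) auto
      ultimately show "frame_avg (G t) * frame_avg (G s) \<le> avg (\<lambda>y. H a b y x)" by simp
    qed
    finally show ?thesis .
  qed
  then have "(\<integral>\<^sup>+x. (max_op v (Suc i) a b m f x)\<^sup>2 \<partial>lborel) \<le> (\<integral>\<^sup>+x. avg (\<lambda>y. H a b y x) \<partial>lborel)"
    by (rule nn_integral_mono)
  also have "\<dots> = avg (\<lambda>y. \<integral>\<^sup>+x. H a b y x \<partial>lborel)"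
    by (rule ball_frame_int_swap[OF sigma_finite_lborel, where H="\<lambda>x y. H a b y x", symmetric]) measurable
  \<comment> \<open>The passage back to \<open>frame_int\<close> is needed because the L2 bound is
    known at admissible frames only. The next steps compare there and return to the ball form to
    evaluate the average of \<open>Z\<close>.\<close>
  also have "\<dots> = frame_avg (\<lambda>y. \<integral>\<^sup>+x. H a b y x \<partial>lborel)"
    by (rule frame_int_eq_ball_frame_int[OF _ gram_0 i'(2), symmetric]) measurable
  also have "\<dots> \<le> frame_avg (Z a b)"
    by (rule frame_int_mono_gram[OF gram_0 i'(2)]) (simp add: H_integral_le[OF _ a])
  also have "\<dots> = avg (Z a b)"
    by (rule frame_int_eq_ball_frame_int[OF _ gram_0 i'(2)]) (use measurable_Z[of "\<lambda>y. y" borel a b] in simp)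
  also have "\<dots> \<le> ennreal (3 * B\<^sup>2 * D * 2 ^ i * (L / a) * norm2)" by (rule ball_frame_int_Z_le[OF assms])
  finally show ?thesis .
qed

end

theorem theorem6p1:
  fixes v :: "nat \<Rightarrow> real^'d" and k j :: nat and B :: real
  assumes "1 \<le> j" and "j \<le> k" and "CARD('d) \<ge> j + 2"
    and "inj_on v {1..k}" and "independent (v ` {1..k})"
    and "norm (v 1) = 1"
  shows "\<exists>C. \<forall>lam0 lam1 L (m :: real^'d \<Rightarrow> complex) (f :: real^'d \<Rightarrow> complex).
           0 < lam0 \<longrightarrow> lam0 \<le> lam1 \<longrightarrow> 0 < L \<longrightarrow> L \<le> lam0 \<longrightarrow>
           smooth_fun m \<longrightarrow> (\<forall>\<xi>. cmod (m \<xi>) \<le> B * min 1 (L * norm \<xi>)) \<longrightarrow>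
           schwartz f \<longrightarrow>
           (\<integral>\<^sup>+ x. (max_op v j lam0 lam1 m f x)\<^sup>2 \<partial>lborel)
             \<le> ennreal (C * (L / lam0) powr (1/3) * (\<integral>x. (cmod (f x))\<^sup>2 \<partial>lborel))"
proof -
  obtain i where j: "j = Suc i" using assms(1) by (cases j) auto
  define C where "C = 3 * B\<^sup>2 * decay_const v i * 2 ^ i"
  have C: "0 \<le> C" by (simp add: C_def decay_const_nonneg)
  show ?thesis
  proof (intro exI[of _ C] allI impI)
    fix lam0 lam1 L and m f :: "real^'d \<Rightarrow> complex"
    assume l: "0 < lam0" "lam0 \<le> lam1" "0 < L" "L \<le> lam0" and m: "smooth_fun m"
      and mB: "\<forall>\<xi>. cmod (m \<xi>) \<le> B * min 1 (L * norm \<xi>)" and f: "schwartz f"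
    \<comment> \<open>The multiplier bound at one nonzero frequency forces this, since the minimum
      there is positive.\<close>
    have B: "0 \<le> B"
    proof -
      obtain b :: "real^'d" where b: "b \<in> Basis" using nonempty_Basis by blast
      have "0 \<le> B * min 1 (L * norm b)" using mB norm_ge_zero order_trans by blast
      moreover have "0 < min 1 (L * norm b)" using l b by simp
      ultimately show ?thesis using zero_le_mult_iff[of B] by fastforce
    qed
    interpret multiplier_setup v i f m B L
      by unfold_locales (use assms j l m mB f B rho_pos[OF assms(5,4)] in auto)
    have "(\<integral>\<^sup>+ x. (max_op v j lam0 lam1 m f x)\<^sup>2 \<partial>lborel) \<le> ennreal (C * (L / lam0) * norm2)"
      unfolding j C_def by (rule max_op_le[OF l(1,2,4)])
    also have "\<dots> \<le> ennreal (C * (L / lam0) powr (1/3) * norm2)"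
    \<comment> \<open>The ratio L / lam0 is at most 1, so lowering its exponent from 1 to 1/3 can
      only increase it.\<close>
    proof (intro ennreal_leI mult_right_mono mult_left_mono)
      have "(L / lam0) powr 1 \<le> (L / lam0) powr (1/3)"
        using l by (intro powr_mono') auto
      then show "L / lam0 \<le> (L / lam0) powr (1/3)" using l by simp
    qed (use C norm2_nonneg in auto)
    finally show "(\<integral>\<^sup>+ x. (max_op v j lam0 lam1 m f x)\<^sup>2 \<partial>lborel)
             \<le> ennreal (C * (L / lam0) powr (1/3) * (\<integral>x. (cmod (f x))\<^sup>2 \<partial>lborel))"
      by (simp add: norm2_def)
  qed
qed

end
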